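(* Let $G$ be any finitely presented group. Then there exists a number $P_G > 0$ such that for every fixed $p$ with $0 < p < P_G$ and $Q \sim Q_2(n,p)$, with high probability $G$ is a free factor of $\pi_1(Q)$, i.e. $\pi_1(Q) \cong G * H$ for some group $H$.
   Context: $Q^n=[0,1]^n$ is the $n$-dimensional cube with its standard cubical (face) structure, with vertex set $\{0,1\}^n$; $Q^n_k$ denotes its $k$-skeleton. The random $2$-dimensional cubical complex $Q_2(n,p)$ has $1$-skeleton equal to $Q^n_1$, and each $2$-dimensional face of $Q^n$ is included independently with probability $p$. "With high probability" means with probability tending to $1$ as $n \to \infty$. *)

theory Defs
  imports "HOL-Algebra.Coset" "HOL-Probability.Probability"
begin

section \<open>Groups given by words\<close>

text \<open>The congruence on the free monoid of words over \<open>A\<close> generated by the rewriting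
  pairs in \<open>R\<close>.\<close>

inductive word_cong :: "'x set \<Rightarrow> ('x list \<times> 'x list) set \<Rightarrow> 'x list \<Rightarrow> 'x list \<Rightarrow> bool"
  for A R where
  refl: "u \<in> lists A \<Longrightarrow> word_cong A R u u"
| sym: "word_cong A R u v \<Longrightarrow> word_cong A R v u"
| trans: "word_cong A R u v \<Longrightarrow> word_cong A R v w \<Longrightarrow> word_cong A R u w"
| step: "(l, r) \<in> R \<Longrightarrow> l \<in> lists A \<Longrightarrow> r \<in> lists A \<Longrightarrow> u \<in> lists A \<Longrightarrow> v \<in> lists A
    \<Longrightarrow> word_cong A R (u @ l @ v) (u @ r @ v)"

definition word_monoid :: "'x set \<Rightarrow> ('x list \<times> 'x list) set \<Rightarrow> 'x list set monoid" where
  "word_monoid A R =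
    \<lparr>carrier = lists A // {(u, v). word_cong A R u v},
     monoid.mult = (\<lambda>X Y. {w. \<exists>u\<in>X. \<exists>v\<in>Y. word_cong A R (u @ v) w}),
     monoid.one = {w. word_cong A R [] w}\<rparr>"

text \<open>The letters \<open>(s, True)\<close> and \<open>(s, False)\<close> stand for \<open>s\<close> and its formal inverse.\<close>

definition free_group :: "'s set \<Rightarrow> ('s \<times> bool) list set monoid" where
  "free_group S = word_monoid (S \<times> UNIV) {([(s, b), (s, \<not> b)], []) | s b. s \<in> S}"

definition normal_closure :: "('a, 'c) monoid_scheme \<Rightarrow> 'a set \<Rightarrow> 'a set" where
  "normal_closure G R = \<Inter>{N. N \<lhd> G \<and> R \<subseteq> N}"

text \<open>A finite generating set may be taken to be a set of natural numbers.\<close>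

definition finitely_presented_group :: "('a, 'c) monoid_scheme \<Rightarrow> bool" where
  "finitely_presented_group G \<longleftrightarrow> group G \<and>
    (\<exists>(S :: nat set) R. finite S \<and> finite R \<and> R \<subseteq> carrier (free_group S) \<and>
      G \<cong> free_group S Mod normal_closure (free_group S) R)"

text \<open>The free product consists of the words in the letters of both groups, where products of
  adjacent letters from the same factor are multiplied out and unit letters are dropped.\<close>

definition free_product ::
  "('a, 'c) monoid_scheme \<Rightarrow> ('b, 'd) monoid_scheme \<Rightarrow> ('a + 'b) list set monoid" where
  "free_product G H = word_monoid (carrier G <+> carrier H)
    ({([Inl x, Inl y], [Inl (x \<otimes>\<^bsub>G\<^esub> y)]) | x y. x \<in> carrier G \<and> y \<in> carrier G} \<union>
     {([Inr x, Inr y], [Inr (x \<otimes>\<^bsub>H\<^esub> y)]) | x y. x \<in> carrier H \<and> y \<in> carrier H} \<union>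
     {([Inl \<one>\<^bsub>G\<^esub>], []), ([Inr \<one>\<^bsub>H\<^esub>], [])})"

text \<open>The complementary factor \<open>H\<close> embeds in \<open>K\<close>, so nothing is lost by taking its elements
  from the type underlying \<open>K\<close>.\<close>

definition free_factor :: "('a, 'c) monoid_scheme \<Rightarrow> ('b, 'd) monoid_scheme \<Rightarrow> bool" where
  "free_factor G K \<longleftrightarrow> (\<exists>H :: 'b monoid. group H \<and> K \<cong> free_product G H)"


section \<open>The fundamental group\<close>

definition fundamental_group :: "'a::topological_space set \<Rightarrow> 'a \<Rightarrow> (real \<Rightarrow> 'a) set monoid" where
  "fundamental_group X x0 =
    \<lparr>carrier = {g. path g \<and> path_image g \<subseteq> X \<and> pathstart g = x0 \<and> pathfinish g = x0}
                 // {(g, h). homotopic_paths X g h},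
     monoid.mult = (\<lambda>A B. {h. \<exists>f\<in>A. \<exists>g\<in>B. homotopic_paths X (f +++ g) h}),
     monoid.one = {h. homotopic_paths X (\<lambda>_. x0) h}\<rparr>"


section \<open>The random cubical complex\<close>

text \<open>Points of \<open>\<real>\<^sup>n\<close> are sequences vanishing from index \<open>n\<close> on, with the product topology. The
  closed face below has the free coordinates \<open>I\<close>; of the remaining coordinates, those in \<open>V\<close> are
  fixed to \<open>1\<close> and the others to \<open>0\<close>.\<close>

definition cube_face :: "nat set \<Rightarrow> nat set \<Rightarrow> (nat \<Rightarrow> real) set" where
  "cube_face I V =
    {x. (\<forall>i\<in>I. x i \<in> {0..1}) \<and> (\<forall>i\<in>V. x i = 1) \<and> (\<forall>i. i \<notin> I \<union> V \<longrightarrow> x i = 0)}"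

definition cube_faces :: "nat \<Rightarrow> nat \<Rightarrow> (nat \<Rightarrow> real) set set" where
  "cube_faces n k = {cube_face I V | I V. I \<union> V \<subseteq> {..<n} \<and> I \<inter> V = {} \<and> card I = k}"

text \<open>A cubical complex is represented by the set of its closed faces; its underlying space is the
  union of this set. The complexes below are connected and contain the origin \<open>\<lambda>_. 0\<close>, which serves
  as basepoint for their fundamental groups.\<close>

definition cube_skeleton :: "nat \<Rightarrow> nat \<Rightarrow> (nat \<Rightarrow> real) set set" where
  "cube_skeleton n k = (\<Union>j\<le>k. cube_faces n j)"

definition random_cubical_complex :: "nat \<Rightarrow> real \<Rightarrow> (nat \<Rightarrow> real) set set pmf" where
  "random_cubical_complex n p =
    map_pmf (\<lambda>\<omega>. cube_skeleton n 1 \<union> {F \<in> cube_faces n 2. \<omega> F})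
      (Pi_pmf (cube_faces n 2) False (\<lambda>_. bernoulli_pmf p))"

end

theory Submission
  imports Defs "HOL-Algebra.Generated_Groups"
begin

text \<open>
  Give \<open>Q\<close> a spanning tree. Its fundamental group is presented by the directed edges of the cube
  graph, with the tree edges and the boundaries of the squares of \<open>Q\<close> as relations. Now let \<open>C\<close> be
  a subcube that is isolated in \<open>Q\<close>: no square of \<open>Q\<close> outside \<open>C\<close> has an edge in \<open>C\<close>. Then no
  relation mixes edges of \<open>C\<close> with edges outside \<open>C\<close>, for a tree relation concerns a single edge.
  So the presentation splits, and the group presented by the edges of \<open>C\<close>, its part of the tree and
  the squares of \<open>Q\<close> inside \<open>C\<close> is a free factor. It remains to find an isolated \<open>C\<close> on which the
  squares of \<open>Q\<close> present \<open>G\<close>.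

  The pattern of squares comes from a labelling of the edges of an \<open>m\<close>-cube by elements of \<open>G\<close>: a
  square is kept exactly if the labels around it commute. A finitely presented group is determined by
  a finite part of its multiplication table (\<open>finite_multiplication_table\<close>), and each entry of the
  table is enforced by a few squares in directions of its own (\<open>gadget_universal\<close>). The other
  edges are labelled by the unit, and one more direction makes room for a tree together with the
  squares that kill them (\<open>labelled_cube_exists\<close>).

  The dimension \<open>m\<close> depends on \<open>G\<close> only. For one translate of the \<open>m\<close>-cube in the \<open>n\<close>-cube, a bounded
  number of squares must be present and at most \<open>c n\<close> squares must be absent, so the pattern occurs,
  and occurs isolated, with probability at least a constant times \<open>(1 - p)\<close> to the power \<open>c n\<close>. There are
  \<open>2\<close> to the power \<open>n - m - 1\<close> translates by vectors of even weight, and their conditions concern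
  disjoint sets of squares, hence are independent. If \<open>2 (1 - p)\<close>-to-the-\<open>c\<close> exceeds \<open>1\<close>, which holds
  for \<open>p < 1 / (2 c)\<close>, some translate succeeds with probability tending to \<open>1\<close>
  (\<open>prob_isolated_cube\<close>).

  The presentation of the fundamental group is used through two facts. The classes of the edges
  generate (\<open>edge_classes_generate\<close>), and every labelling of the edges by elements of a group that
  respects the relations extends to a homomorphism (\<open>edge_class_universal\<close>). The second one is the
  analytic heart: the homomorphism is the holonomy of a cocycle on the cover by the open stars of the
  vertices. With the free product as the target group it provides an inverse of the natural
  homomorphism in the other direction (\<open>isolated_cube_free_factor\<close>).
\<close>

section \<open>Monoids of words modulo relations\<close>

(* Membership in lists A is treated by the rules for Nil, Cons and append; its translation into a
   statement about all entries of the list would get in their way. *)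
declare in_listsD [rule del] in_listsI [rule del]

lemma Nil_in_lists [simp]: "[] \<in> lists A"
  by (rule lists.Nil)

lemma Inl_in_Plus [simp]: "Inl x \<in> A <+> B \<longleftrightarrow> x \<in> A" "Inr y \<in> A <+> B \<longleftrightarrow> y \<in> B"
  by auto

definition word_class :: "'x set \<Rightarrow> ('x list \<times> 'x list) set \<Rightarrow> 'x list \<Rightarrow> 'x list set" where
  "word_class A R u = {v. word_cong A R u v}"

definition word_value :: "('k, 'c) monoid_scheme \<Rightarrow> ('x \<Rightarrow> 'k) \<Rightarrow> 'x list \<Rightarrow> 'k" where
  "word_value K \<theta> u = foldr (\<lambda>x y. \<theta> x \<otimes>\<^bsub>K\<^esub> y) u \<one>\<^bsub>K\<^esub>"

lemma word_value_simps [simp]: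
  "word_value K \<theta> [] = \<one>\<^bsub>K\<^esub>"
  "word_value K \<theta> (x # u) = \<theta> x \<otimes>\<^bsub>K\<^esub> word_value K \<theta> u"
  by (simp_all add: word_value_def)

lemma word_cong_lists:
  assumes "word_cong A R u v"
  shows "u \<in> lists A" "v \<in> lists A"
  using assms by (induction rule: word_cong.induct) auto

lemma word_cong_append:
  assumes "word_cong A R u v" "a \<in> lists A" "b \<in> lists A"
  shows "word_cong A R (a @ u @ b) (a @ v @ b)"
  using assms
proof (induction rule: word_cong.induct)
  case (step l r u v)
  then show ?case
    using word_cong.step[of l r R A "a @ u" "v @ b"] by simp
qed (auto intro: word_cong.intros)

lemma word_cong_mult:
  assumes "word_cong A R u u'" "word_cong A R v v'"
  shows "word_cong A R (u @ v) (u' @ v')"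
proof -
  have "word_cong A R ([] @ u @ v) ([] @ u' @ v)"
    using assms word_cong_lists by (intro word_cong_append) auto
  moreover have "word_cong A R (u' @ v @ []) (u' @ v' @ [])"
    using assms word_cong_lists by (intro word_cong_append) auto
  ultimately show ?thesis
    by (auto intro: word_cong.trans)
qed

lemma word_class_eq_iff:
  assumes "u \<in> lists A"
  shows "word_class A R u = word_class A R v \<longleftrightarrow> word_cong A R u v"
  using assms unfolding word_class_def
  by (auto intro: word_cong.intros)

lemma carrier_word_monoid: "carrier (word_monoid A R) = word_class A R ` lists A"
  by (auto simp: word_monoid_def quotient_def word_class_def Image_def)

lemma one_word_monoid: "\<one>\<^bsub>word_monoid A R\<^esub> = word_class A R []"
  by (simp add: word_monoid_def word_class_def)

lemma mult_word_class:
  assumes "u \<in> lists A" "v \<in> lists A"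
  shows "word_class A R u \<otimes>\<^bsub>word_monoid A R\<^esub> word_class A R v = word_class A R (u @ v)"
proof -
  have "word_cong A R (u @ v) w"
    if "word_cong A R u u'" "word_cong A R v v'" "word_cong A R (u' @ v') w" for u' v' w
    using word_cong.trans[OF word_cong_mult[OF that(1,2)] that(3)] .
  then show ?thesis
    using word_cong.refl[OF assms(1)] word_cong.refl[OF assms(2)]
    unfolding word_monoid_def word_class_def by fastforce
qed

lemma monoid_word_monoid: "monoid (word_monoid A R)"
  by (rule monoidI) (auto simp: carrier_word_monoid one_word_monoid mult_word_class)

lemma group_word_monoid:
  assumes "\<And>a. a \<in> A \<Longrightarrow> \<exists>b\<in>lists A. word_cong A R (b @ [a]) []"
  shows "group (word_monoid A R)"
proof -
  interpret M: monoid "word_monoid A R" by (rule monoid_word_monoid)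
  have *: "\<exists>v\<in>lists A. word_cong A R (v @ u) []" if "u \<in> lists A" for u
    using that
  proof (induction u)
    case Nil
    then show ?case by (auto intro!: bexI[of _ "[]"] word_cong.refl)
  next
    case (Cons a u)
    then have "a \<in> A" "u \<in> lists A"
      by simp_all
    with Cons.IH assms obtain v b where v: "v \<in> lists A" "word_cong A R (v @ u) []"
      and b: "b \<in> lists A" "word_cong A R (b @ [a]) []"
      by blast
    have "word_cong A R (v @ (b @ [a]) @ u) (v @ [] @ u)"
      using v b \<open>u \<in> lists A\<close> by (intro word_cong_append) auto
    then have "word_cong A R ((v @ b) @ (a # u)) []"
      using v by (auto intro: word_cong.trans)
    then show ?case
      using v b by (intro bexI[of _ "v @ b"]) auto
  qed
  have "\<exists>y\<in>carrier (word_monoid A R). y \<otimes>\<^bsub>word_monoid A R\<^esub> x = \<one>\<^bsub>word_monoid A R\<^esub>"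
    if x: "x \<in> carrier (word_monoid A R)" for x
  proof -
    obtain u where u: "u \<in> lists A" "x = word_class A R u"
      using x by (auto simp: carrier_word_monoid)
    with * obtain v where "v \<in> lists A" "word_cong A R (v @ u) []"
      by blast
    with u show ?thesis
      by (intro bexI[of _ "word_class A R v"])
        (auto simp: carrier_word_monoid one_word_monoid mult_word_class word_class_eq_iff)
  qed
  then show ?thesis
    by (intro groupI) (auto simp: M.m_assoc)
qed

lemma word_value_closed:
  assumes "monoid K" "\<theta> \<in> A \<rightarrow> carrier K" "u \<in> lists A"
  shows "word_value K \<theta> u \<in> carrier K"
  using assms(3) by (induction u) (use assms(1,2) in \<open>auto intro!: monoid.m_closed\<close>)

lemma word_value_append:
  assumes "monoid K" "\<theta> \<in> A \<rightarrow> carrier K" "u \<in> lists A" "v \<in> lists A"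
  shows "word_value K \<theta> (u @ v) = word_value K \<theta> u \<otimes>\<^bsub>K\<^esub> word_value K \<theta> v"
  using assms(3)
proof (induction u)
  case Nil
  then show ?case using word_value_closed[OF assms(1,2,4)] assms(1) by (simp add: monoid.l_one)
next
  case (Cons a u)
  then show ?case
    using word_value_closed[OF assms(1,2)] assms
    by (simp add: monoid.m_assoc Pi_iff)
qed

text \<open>Two congruent words have equal values, since this holds for a single rewriting step; so the value
  of a word depends on its class only.\<close>

lemma word_monoid_hom:
  assumes K: "monoid K" and \<theta>: "\<theta> \<in> A \<rightarrow> carrier K"
    and R: "\<And>l r. (l, r) \<in> R \<Longrightarrow> l \<in> lists A \<Longrightarrow> r \<in> lists A \<Longrightarrow> word_value K \<theta> l = word_value K \<theta> r"
  shows "\<exists>h \<in> hom (word_monoid A R) K. \<forall>u\<in>lists A. h (word_class A R u) = word_value K \<theta> u"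
proof -
  have cong: "word_value K \<theta> u = word_value K \<theta> v" if "word_cong A R u v" for u v
    using that
  proof (induction rule: word_cong.induct)
    case (step l r u v)
    then show ?case
      using R[of l r] word_value_append[OF K \<theta>] by simp
  qed auto
  define h where "h X = the_elem (word_value K \<theta> ` X)" for X
  have h: "h (word_class A R u) = word_value K \<theta> u" if "u \<in> lists A" for u
  proof -
    have "word_value K \<theta> ` word_class A R u = {word_value K \<theta> u}"
      using cong word_cong.refl[OF that] by (fastforce simp: word_class_def)
    then show ?thesis by (simp add: h_def)
  qed
  have "h \<in> hom (word_monoid A R) K"
    by (rule homI)
      (auto simp: carrier_word_monoid mult_word_class h word_value_closed[OF K \<theta>] word_value_append[OF K \<theta>])
  then show ?thesis using h by blast
qed

lemma hom_word_class:
  assumes h: "h \<in> hom (word_monoid A R) K" "h (word_class A R []) = \<one>\<^bsub>K\<^esub>" and u: "u \<in> lists A"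
  shows "h (word_class A R u) = word_value K (\<lambda>a. h (word_class A R [a])) u"
  using u
proof (induction u)
  case Nil
  then show ?case using h by simp
next
  case (Cons a u)
  then have "word_class A R (a # u) = word_class A R [a] \<otimes>\<^bsub>word_monoid A R\<^esub> word_class A R u"
    by (subst mult_word_class) auto
  then show ?case
    using Cons hom_mult[OF h(1), of "word_class A R [a]" "word_class A R u"] by (auto simp: carrier_word_monoid)
qed

lemma hom_eq_on_generate:
  assumes "group G" "group K" "f \<in> hom G K" "g \<in> hom G K" "S \<subseteq> carrier G"
    and "\<And>x. x \<in> S \<Longrightarrow> f x = g x" and "x \<in> generate G S"
  shows "f x = g x"
proof -
  interpret f: group_hom G K f by (intro group_hom.intro group_hom_axioms.intro assms)
  interpret g: group_hom G K g by (intro group_hom.intro group_hom_axioms.intro assms)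
  note * = group.generate_in_carrier[OF assms(1,5)]
  show ?thesis
    using assms(7)
  proof (induction rule: generate.induct)
    case (eng h1 h2)
    then show ?case using * by auto
  next
    case (inv h)
    then have "h \<in> carrier G" using assms(5) by auto
    then show ?case using inv assms(6) by simp
  qed (use assms in auto)
qed

section \<open>Free products\<close>

definition free_product_relations where
  "free_product_relations G H =
    {([Inl x, Inl y], [Inl (x \<otimes>\<^bsub>G\<^esub> y)]) | x y. x \<in> carrier G \<and> y \<in> carrier G} \<union>
     {([Inr x, Inr y], [Inr (x \<otimes>\<^bsub>H\<^esub> y)]) | x y. x \<in> carrier H \<and> y \<in> carrier H} \<union>
     {([Inl \<one>\<^bsub>G\<^esub>], []), ([Inr \<one>\<^bsub>H\<^esub>], [])}"

lemma free_product_alt: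
  "free_product G H = word_monoid (carrier G <+> carrier H) (free_product_relations G H)"
  by (simp add: free_product_def free_product_relations_def)

definition fp_inl :: "('a, 'c) monoid_scheme \<Rightarrow> ('b, 'd) monoid_scheme \<Rightarrow> 'a \<Rightarrow> ('a + 'b) list set" where
  "fp_inl G H x = word_class (carrier G <+> carrier H) (free_product_relations G H) [Inl x]"

definition fp_inr :: "('a, 'c) monoid_scheme \<Rightarrow> ('b, 'd) monoid_scheme \<Rightarrow> 'b \<Rightarrow> ('a + 'b) list set" where
  "fp_inr G H y = word_class (carrier G <+> carrier H) (free_product_relations G H) [Inr y]"

locale two_groups = G: group G + H: group H
  for G :: "('a, 'c) monoid_scheme" and H :: "('b, 'd) monoid_scheme"
begin

abbreviation "letters \<equiv> carrier G <+> carrier H"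
abbreviation "rels \<equiv> free_product_relations G H"

lemma word_cong_free_product:
  "x \<in> carrier G \<Longrightarrow> y \<in> carrier G \<Longrightarrow> word_cong letters rels [Inl x, Inl y] [Inl (x \<otimes>\<^bsub>G\<^esub> y)]"
  "x' \<in> carrier H \<Longrightarrow> y' \<in> carrier H \<Longrightarrow> word_cong letters rels [Inr x', Inr y'] [Inr (x' \<otimes>\<^bsub>H\<^esub> y')]"
  "word_cong letters rels [Inl \<one>\<^bsub>G\<^esub>] []"
  "word_cong letters rels [Inr \<one>\<^bsub>H\<^esub>] []"
  using word_cong.step[of "[Inl x, Inl y]" "[Inl (x \<otimes>\<^bsub>G\<^esub> y)]" rels letters "[]" "[]"]
    word_cong.step[of "[Inr x', Inr y']" "[Inr (x' \<otimes>\<^bsub>H\<^esub> y')]" rels letters "[]" "[]"]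
    word_cong.step[of "[Inl \<one>\<^bsub>G\<^esub>]" "[]" rels letters "[]" "[]"]
    word_cong.step[of "[Inr \<one>\<^bsub>H\<^esub>]" "[]" rels letters "[]" "[]"]
  by (auto simp: free_product_relations_def)

lemma group_free_product: "group (free_product G H)"
  unfolding free_product_alt
proof (rule group_word_monoid)
  fix a assume "a \<in> letters"
  then show "\<exists>b\<in>lists letters. word_cong letters rels (b @ [a]) []"
  proof
    fix x assume x: "x \<in> carrier G" "a = Inl x"
    have "word_cong letters rels [Inl (inv\<^bsub>G\<^esub> x), Inl x] []"
      using word_cong_free_product(1)[of "inv\<^bsub>G\<^esub> x" x] word_cong_free_product(3) x
      by (auto intro: word_cong.trans)
    then show ?thesis using x by (intro bexI[of _ "[Inl (inv\<^bsub>G\<^esub> x)]"]) auto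
  next
    fix x assume x: "x \<in> carrier H" "a = Inr x"
    have "word_cong letters rels [Inr (inv\<^bsub>H\<^esub> x), Inr x] []"
      using word_cong_free_product(2)[of "inv\<^bsub>H\<^esub> x" x] word_cong_free_product(4) x
      by (auto intro: word_cong.trans)
    then show ?thesis using x by (intro bexI[of _ "[Inr (inv\<^bsub>H\<^esub> x)]"]) auto
  qed
qed

lemma fp_inl_hom: "fp_inl G H \<in> hom G (free_product G H)"
  unfolding fp_inl_def free_product_alt
  by (rule homI) (auto simp: carrier_word_monoid mult_word_class word_class_eq_iff
      intro: word_cong.sym word_cong_free_product)

lemma fp_inr_hom: "fp_inr G H \<in> hom H (free_product G H)"
  unfolding fp_inr_def free_product_alt
  by (rule homI) (auto simp: carrier_word_monoid mult_word_class word_class_eq_iff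
      intro: word_cong.sym word_cong_free_product)

lemma free_product_hom_exists:
  assumes K: "group K" and f: "f \<in> hom G K" and g: "g \<in> hom H K"
  shows "\<exists>h \<in> hom (free_product G H) K.
    (\<forall>x\<in>carrier G. h (fp_inl G H x) = f x) \<and> (\<forall>y\<in>carrier H. h (fp_inr G H y) = g y)"
proof -
  interpret K: group K by fact
  have "\<exists>h \<in> hom (word_monoid letters rels) K. \<forall>u\<in>lists letters.
      h (word_class letters rels u) = word_value K (case_sum f g) u"
  proof (rule word_monoid_hom)
    show "case_sum f g \<in> letters \<rightarrow> carrier K"
      using f g by (auto simp: hom_def)
    have "f \<one>\<^bsub>G\<^esub> = \<one>\<^bsub>K\<^esub>" "g \<one>\<^bsub>H\<^esub> = \<one>\<^bsub>K\<^esub>"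
      using f g K G.is_group H.is_group by (auto intro: hom_one)
    then show "word_value K (case_sum f g) l = word_value K (case_sum f g) r"
      if "(l, r) \<in> rels" "l \<in> lists letters" "r \<in> lists letters" for l r
      using that unfolding free_product_relations_def using hom_in_carrier[OF f] hom_in_carrier[OF g] by (auto simp: hom_mult[OF f] hom_mult[OF g])
  qed (rule K.monoid_axioms)
  then obtain h where h: "h \<in> hom (word_monoid letters rels) K"
    "\<And>u. u \<in> lists letters \<Longrightarrow> h (word_class letters rels u) = word_value K (case_sum f g) u"
    by blast
  have "h (fp_inl G H x) = f x" if "x \<in> carrier G" for x
    using that h(2)[of "[Inl x]"] hom_in_carrier[OF f that] by (simp add: fp_inl_def)
  moreover have "h (fp_inr G H y) = g y" if "y \<in> carrier H" for y
    using that h(2)[of "[Inr y]"] hom_in_carrier[OF g that] by (simp add: fp_inr_def)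
  ultimately show ?thesis
    using h(1) unfolding free_product_alt by blast
qed

text \<open>Every element of the free product is a product of classes of letters.\<close>

lemma free_product_hom_eqI:
  assumes "group K" and f: "f \<in> hom (free_product G H) K" and g: "g \<in> hom (free_product G H) K"
    and l: "\<And>x. x \<in> carrier G \<Longrightarrow> f (fp_inl G H x) = g (fp_inl G H x)"
    and r: "\<And>y. y \<in> carrier H \<Longrightarrow> f (fp_inr G H y) = g (fp_inr G H y)"
    and z: "z \<in> carrier (free_product G H)"
  shows "f z = g z"
proof -
  interpret K: group K by fact
  obtain u where u: "u \<in> lists letters" "z = word_class letters rels u"
    using z by (auto simp: free_product_alt carrier_word_monoid)
  have one: "f (word_class letters rels []) = \<one>\<^bsub>K\<^esub>" "g (word_class letters rels []) = \<one>\<^bsub>K\<^esub>"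
    using f g hom_one[OF f group_free_product \<open>group K\<close>] hom_one[OF g group_free_product \<open>group K\<close>]
    by (simp_all add: free_product_alt one_word_monoid)
  have "f (word_class letters rels [a]) = g (word_class letters rels [a])" if "a \<in> letters" for a
    using that l r by (auto simp: fp_inl_def fp_inr_def)
  then have "word_value K (\<lambda>a. f (word_class letters rels [a])) u =
      word_value K (\<lambda>a. g (word_class letters rels [a])) u"
    using u(1) by (induction u) auto
  then show ?thesis
    using hom_word_class[where h = f, OF _ one(1) u(1)] hom_word_class[where h = g, OF _ one(2) u(1)] f g u(2)
    by (simp add: free_product_alt)
qed

end

section \<open>Finitely presented groups\<close>

abbreviation free_group_relations :: "'s set \<Rightarrow> (('s \<times> bool) list \<times> ('s \<times> bool) list) set" where
  "free_group_relations S \<equiv> {([(s, b), (s, \<not> b)], []) | s b. s \<in> S}"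

lemma group_free_group: "group (free_group S)"
  unfolding free_group_def
proof (rule group_word_monoid)
  fix a assume "a \<in> S \<times> (UNIV :: bool set)"
  then obtain s b where a: "a = (s, b)" "s \<in> S" by auto
  have "word_cong (S \<times> UNIV) (free_group_relations S) ([] @ [(s, \<not> b), (s, \<not> \<not> b)] @ []) ([] @ [] @ [])"
    using a by (intro word_cong.step) auto
  then show "\<exists>c\<in>lists (S \<times> UNIV). word_cong (S \<times> UNIV) (free_group_relations S) (c @ [a]) []"
    using a by (intro bexI[of _ "[(s, \<not> b)]"]) auto
qed

lemma free_group_hom:
  assumes K: "monoid K" and \<theta>: "\<theta> \<in> S \<times> UNIV \<rightarrow> carrier K"
    and inv: "\<And>s b. s \<in> S \<Longrightarrow> \<theta> (s, b) \<otimes>\<^bsub>K\<^esub> \<theta> (s, \<not> b) = \<one>\<^bsub>K\<^esub>"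
  shows "\<exists>h \<in> hom (free_group S) K. \<forall>u\<in>lists (S \<times> UNIV).
    h (word_class (S \<times> UNIV) (free_group_relations S) u) = word_value K \<theta> u"
  unfolding free_group_def
proof (rule word_monoid_hom[OF K \<theta>])
  fix l r assume "(l, r) \<in> free_group_relations S"
  then obtain s b where "l = [(s, b), (s, \<not> b)]" "r = []" "s \<in> S"
    by auto
  then show "word_value K \<theta> l = word_value K \<theta> r"
    using inv[of s b] \<theta> K by (simp add: Pi_iff monoid.r_one)
qed

lemma normal_normal_closure:
  assumes "group G" "R \<subseteq> carrier G"
  shows "normal_closure G R \<lhd> G"
proof -
  interpret group G by fact
  have "carrier G \<lhd> G"
    by (simp add: normal_inv_iff subgroup_self)
  then have "subgroup (normal_closure G R) G"
    unfolding normal_closure_def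
    using assms by (intro subgroups_Inter) (auto simp: normal_imp_subgroup)
  then show ?thesis
    by (auto simp: normal_inv_iff normal_closure_def)
qed

lemma subset_normal_closure: "R \<subseteq> normal_closure G R"
  by (auto simp: normal_closure_def)

lemma normal_closure_subset:
  "N \<lhd> G \<Longrightarrow> R \<subseteq> N \<Longrightarrow> normal_closure G R \<subseteq> N"
  by (auto simp: normal_closure_def)

text \<open>The set \<open>B\<close> consists of the unit, the generators with their inverses, and the values of all prefixes
  of the relators. A prefix arises from the preceding one by multiplication with a letter, and this
  product stays in \<open>B\<close>. Hence a map that respects the products inside \<open>B\<close> sends the value of a prefix
  to the product of the images of its letters. Applied to a whole relator this gives the image of the
  unit, so the relators are mapped to the unit and the map extends to \<open>G\<close>.\<close>

theorem finite_multiplication_table: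
  fixes G :: "('a, 'c) monoid_scheme"
  assumes "finitely_presented_group G"
  shows "\<exists>B. finite B \<and> B \<subseteq> carrier G \<and> \<one>\<^bsub>G\<^esub> \<in> B \<and> generate G B = carrier G \<and>
    (\<forall>(K :: ('k, 'd) monoid_scheme) f. group K \<longrightarrow> f \<in> B \<rightarrow> carrier K \<longrightarrow> f \<one>\<^bsub>G\<^esub> = \<one>\<^bsub>K\<^esub> \<longrightarrow>
      (\<forall>g\<in>B. \<forall>h\<in>B. g \<otimes>\<^bsub>G\<^esub> h \<in> B \<longrightarrow> f (g \<otimes>\<^bsub>G\<^esub> h) = f g \<otimes>\<^bsub>K\<^esub> f h) \<longrightarrow>
      (\<exists>i\<in>hom G K. \<forall>b\<in>B. i b = f b))"
proof -
  obtain S :: "nat set" and R where G: "group G" and S: "finite S" and R: "finite R" "R \<subseteq> carrier (free_group S)"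
    and iso: "G \<cong> free_group S Mod normal_closure (free_group S) R"
    using assms by (auto simp: finitely_presented_group_def)
  define F where "F = free_group S"
  define N where "N = normal_closure F R"
  define A where "A = S \<times> (UNIV :: bool set)"
  define cl where "cl = word_class A (free_group_relations S)"
  interpret G: group G by fact
  interpret F: group F unfolding F_def by (rule group_free_group)
  have N: "N \<lhd> F"
    using normal_normal_closure[OF F.is_group] R by (simp add: N_def F_def)
  interpret N: normal N F by fact
  have "group (F Mod N)" by (rule N.factorgroup_is_group)
  obtain \<iota> where \<iota>: "\<iota> \<in> iso G (F Mod N)"
    using iso by (auto simp: is_iso_def F_def N_def)
  define \<phi> where "\<phi> = inv_into (carrier G) \<iota>"
  have \<phi>: "\<phi> \<in> iso (F Mod N) G"
    unfolding \<phi>_def by (rule G.iso_set_sym[OF \<iota>])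
  have \<phi>\<iota>: "\<phi> (\<iota> g) = g" if "g \<in> carrier G" for g
    using that \<iota> by (simp add: \<phi>_def iso_iff inv_into_f_f)
  have \<iota>\<phi>: "\<iota> (\<phi> x) = x" if "x \<in> carrier (F Mod N)" for x
    using that \<iota> by (auto simp: \<phi>_def iso_iff intro!: f_inv_into_f)
  \<comment> \<open>\<open>q\<close> is the projection of the free group onto \<open>G\<close>, with kernel \<open>N\<close>.\<close>
  define q where "q x = \<phi> (N #>\<^bsub>F\<^esub> x)" for x
  have q: "q \<in> hom F G"
    using hom_compose[OF N.r_coset_hom_Mod, of \<phi> G] \<phi> by (simp add: q_def[abs_def] o_def iso_def)
  have carF: "carrier F = cl ` lists A" and cl_mult: "\<And>u v. u \<in> lists A \<Longrightarrow> v \<in> lists A \<Longrightarrow> cl (u @ v) = cl u \<otimes>\<^bsub>F\<^esub> cl v"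
    and cl_one: "cl [] = \<one>\<^bsub>F\<^esub>"
    by (auto simp: F_def cl_def A_def free_group_def carrier_word_monoid mult_word_class one_word_monoid)
  have "q ` carrier F = carrier G"
  proof
    show "carrier G \<subseteq> q ` carrier F"
    proof
      fix g assume g: "g \<in> carrier G"
      then have "\<iota> g \<in> carrier (F Mod N)" using \<iota> by (auto simp: iso_iff)
      then obtain x where "x \<in> carrier F" "\<iota> g = N #>\<^bsub>F\<^esub> x"
        by (auto simp: carrier_FactGroup)
      then show "g \<in> q ` carrier F"
        using \<phi>\<iota>[OF g] by (auto simp: q_def)
    qed
  qed (use hom_in_carrier[OF q] in auto)
  have "\<forall>r\<in>R. \<exists>w\<in>lists A. r = cl w"
    using R by (auto simp: F_def[symmetric] carF)
  then obtain w where w: "\<And>r. r \<in> R \<Longrightarrow> w r \<in> lists A" "\<And>r. r \<in> R \<Longrightarrow> r = cl (w r)"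
    by metis
  define P where "P = insert [] ((\<lambda>a. [a]) ` A \<union> (\<Union>r\<in>R. (\<lambda>k. take k (w r)) ` {..length (w r)}))"
  have take_lists: "take k u \<in> lists A" if "u \<in> lists A" for k u
    using that by (metis append_take_drop_id append_in_lists_conv)
  have P: "finite P" "P \<subseteq> lists A" "[] \<in> P"
    using S R take_lists[OF w(1)] by (auto simp: P_def A_def)
  have P_prefix: "u \<in> P" if "u @ [a] \<in> P" for u a
  proof -
    consider "u = []" | r k where "r \<in> R" "u @ [a] = take k (w r)" "k \<le> length (w r)"
      using \<open>u @ [a] \<in> P\<close> by (auto simp: P_def)
    then show ?thesis
    proof cases
      case 2
      then have "length u = k - 1" by (metis butlast_snoc length_butlast length_take min.absorb2)
      then have "u = take (k - 1) (w r)"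
        using 2 by (metis append_eq_conv_conj butlast_snoc butlast_take)
      moreover have "k - 1 \<in> {..length (w r)}" using 2 by auto
      ultimately show ?thesis using 2(1) unfolding P_def by blast
    qed (use P in auto)
  qed
  define B where "B = (\<lambda>u. q (cl u)) ` P"
  have B: "finite B" "B \<subseteq> carrier G" "\<one>\<^bsub>G\<^esub> \<in> B"
  proof -
    show "finite B" using P by (simp add: B_def)
    show "B \<subseteq> carrier G" using P carF hom_in_carrier[OF q] by (auto simp: B_def)
    have "q (cl []) = \<one>\<^bsub>G\<^esub>" using hom_one[OF q F.is_group G] by (simp add: cl_one)
    then show "\<one>\<^bsub>G\<^esub> \<in> B" using P by (auto simp: B_def intro!: rev_image_eqI)
  qed
  have letter: "q (cl [a]) \<in> B" if "a \<in> A" for a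
    using that by (auto simp: B_def P_def)
  have q_snoc: "q (cl (u @ [a])) = q (cl u) \<otimes>\<^bsub>G\<^esub> q (cl [a])" if "u \<in> lists A" "a \<in> A" for u a
    using that hom_mult[OF q, of "cl u" "cl [a]"] by (simp add: cl_mult carF)
  have gen: "generate G B = carrier G"
  proof
    show "generate G B \<subseteq> carrier G" by (rule G.generate_incl[OF B(2)])
    have "q (cl u) \<in> generate G B" if "u \<in> lists A" for u
      using that
    proof (induction u rule: rev_induct)
      case Nil
      then show ?case using P by (auto simp: B_def intro: generate.incl)
    next
      case (snoc a u)
      then show ?case
        by (auto simp: q_snoc intro!: generate.eng generate.incl[OF letter])
    qed
    then show "carrier G \<subseteq> generate G B"
      unfolding \<open>q ` carrier F = carrier G\<close>[symmetric] carF by blast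
  qed
  have univ: "\<exists>i\<in>hom G K. \<forall>b\<in>B. i b = f b"
    if K: "group K" and f: "f \<in> B \<rightarrow> carrier K" "f \<one>\<^bsub>G\<^esub> = \<one>\<^bsub>K\<^esub>"
      and mult: "\<forall>g\<in>B. \<forall>h\<in>B. g \<otimes>\<^bsub>G\<^esub> h \<in> B \<longrightarrow> f (g \<otimes>\<^bsub>G\<^esub> h) = f g \<otimes>\<^bsub>K\<^esub> f h"
    for K :: "('k, 'd) monoid_scheme" and f
  proof -
    interpret K: group K by fact
    define \<theta> where "\<theta> a = f (q (cl [a]))" for a
    have \<theta>: "\<theta> \<in> A \<rightarrow> carrier K"
      using f letter by (auto simp: \<theta>_def)
    have "\<theta> (s, b) \<otimes>\<^bsub>K\<^esub> \<theta> (s, \<not> b) = \<one>\<^bsub>K\<^esub>" if "s \<in> S" for s b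
    proof -
      have sA: "(s, b) \<in> A" "(s, \<not> b) \<in> A" using that by (auto simp: A_def)
      have "word_cong A (free_group_relations S) ([] @ [(s, b), (s, \<not> b)] @ []) ([] @ [] @ [])"
        using that sA by (intro word_cong.step) auto
      then have "cl ([(s, b)] @ [(s, \<not> b)]) = cl []"
        using sA by (simp add: cl_def word_class_eq_iff)
      then have "q (cl [(s, b)]) \<otimes>\<^bsub>G\<^esub> q (cl [(s, \<not> b)]) = \<one>\<^bsub>G\<^esub>"
        using q_snoc[of "[(s, b)]" "(s, \<not> b)"] sA hom_one[OF q F.is_group G] by (simp add: cl_one)
      then show ?thesis
        using mult letter[OF sA(1)] letter[OF sA(2)] B(3) f(2) by (metis \<theta>_def)
    qed
    then obtain h where h: "h \<in> hom F K" "\<And>u. u \<in> lists A \<Longrightarrow> h (cl u) = word_value K \<theta> u"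
      using free_group_hom[OF K.is_monoid, of \<theta> S] \<theta> unfolding F_def cl_def A_def by blast
    have hP: "h (cl u) = f (q (cl u))" if "u \<in> P" for u
      using that
    proof (induction u rule: rev_induct)
      case Nil
      then show ?case
        using f hom_one[OF q F.is_group G] hom_one[OF h(1) F.is_group K] by (simp add: cl_one)
    next
      case (snoc a u)
      then have u: "u \<in> P" "u \<in> lists A" "a \<in> A" using P_prefix P by auto
      have "h (cl (u @ [a])) = h (cl u) \<otimes>\<^bsub>K\<^esub> h (cl [a])"
        using u hom_mult[OF h(1), of "cl u" "cl [a]"] by (simp add: cl_mult carF)
      also have "h (cl [a]) = f (q (cl [a]))"
        using u \<theta> by (simp add: h(2) \<theta>_def Pi_iff)
      also have "h (cl u) \<otimes>\<^bsub>K\<^esub> f (q (cl [a])) = f (q (cl u) \<otimes>\<^bsub>G\<^esub> q (cl [a]))"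
      proof -
        have "q (cl u) \<otimes>\<^bsub>G\<^esub> q (cl [a]) \<in> B"
          using snoc.prems u by (auto simp: B_def q_snoc[symmetric])
        moreover have "q (cl u) \<in> B" using u by (auto simp: B_def)
        ultimately show ?thesis
          using mult letter[OF u(3)] snoc.IH[OF u(1)] by simp
      qed
      finally show ?case using u by (simp add: q_snoc)
    qed
    interpret h: group_hom F K h
      by (intro group_hom.intro group_hom_axioms.intro F.is_group K h)
    have "r \<in> kernel F K h" if "r \<in> R" for r
    proof -
      have "w r \<in> P" using that by (auto simp: P_def intro!: bexI[of _ r] rev_image_eqI[of "length (w r)"])
      then have "h r = f (q r)" using hP w that by metis
      moreover have "r \<in> N" unfolding N_def by (rule subsetD[OF subset_normal_closure that])
      then have "N #>\<^bsub>F\<^esub> r = N"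
        by (simp add: F.coset_join2 N.subgroup_axioms N.subset[THEN subsetD])
      then have "q r = \<one>\<^bsub>G\<^esub>"
        using \<phi> hom_one[of \<phi> "F Mod N" G] \<open>group (F Mod N)\<close> G by (simp add: q_def iso_def)
      ultimately show ?thesis
        using R that f by (auto simp: kernel_def F_def)
    qed
    then have NK: "N \<subseteq> kernel F K h"
      unfolding N_def by (intro normal_closure_subset h.normal_kernel) auto
    obtain g where g: "g \<in> hom (F Mod N) K" "\<And>x. x \<in> carrier F \<Longrightarrow> g (N #>\<^bsub>F\<^esub> x) = h x"
    proof (rule FactGroup_universal[OF h(1) N])
      fix x y assume xy: "x \<in> carrier F" "y \<in> carrier F" "N #>\<^bsub>F\<^esub> x = N #>\<^bsub>F\<^esub> y"
      then obtain n where n: "n \<in> N" "x = n \<otimes>\<^bsub>F\<^esub> y"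
        using F.rcos_self[OF xy(1) N.subgroup_axioms] by (auto simp: r_coset_def)
      then show "h x = h y"
        using NK xy by (auto simp: kernel_def)
    qed auto
    have "g \<circ> \<iota> \<in> hom G K"
      using hom_compose[of \<iota> G "F Mod N" g K] \<iota> g by (simp add: iso_def)
    moreover have "(g \<circ> \<iota>) b = f b" if b: "b \<in> B" for b
    proof -
      obtain u where u: "u \<in> P" "b = q (cl u)" using b by (auto simp: B_def)
      then have c: "cl u \<in> carrier F" using P carF by auto
      then have "\<iota> b = N #>\<^bsub>F\<^esub> cl u"
        using u by (simp add: q_def \<iota>\<phi> carrier_FactGroup)
      then show ?thesis using g(2)[OF c] hP u by simp
    qed
    ultimately show ?thesis by blast
  qed
  show ?thesis
    using B gen univ by (intro exI[of _ B] conjI) blast+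
qed

section \<open>Classes of paths in the fundamental group\<close>

definition path_in :: "'a::topological_space set \<Rightarrow> (real \<Rightarrow> 'a) \<Rightarrow> bool" where
  "path_in X p \<longleftrightarrow> path p \<and> path_image p \<subseteq> X"

definition path_class :: "'a::topological_space set \<Rightarrow> (real \<Rightarrow> 'a) \<Rightarrow> (real \<Rightarrow> 'a) set" where
  "path_class X p = {q. homotopic_paths X p q}"

lemma path_in_simps [simp]:
  "path_in X p \<Longrightarrow> path_in X q \<Longrightarrow> pathfinish p = pathstart q \<Longrightarrow> path_in X (p +++ q)"
  "path_in X (reversepath p) \<longleftrightarrow> path_in X p"
  "path_in X (\<lambda>_. x) \<longleftrightarrow> x \<in> X"
  using path_def[of "\<lambda>_. x"] path_image_def[of "\<lambda>_. x"]
  by (auto simp: path_in_def path_join_imp subset_path_image_join)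

lemma path_in_refl [simp]: "path_in X p \<Longrightarrow> homotopic_paths X p p"
  by (simp add: path_in_def)

lemma path_in_homotopic: "homotopic_paths X p q \<Longrightarrow> path_in X p \<and> path_in X q"
  by (simp add: path_in_def homotopic_paths_imp_path homotopic_paths_imp_subset)

lemma path_class_eq_iff:
  assumes "path_in X p"
  shows "path_class X p = path_class X q \<longleftrightarrow> homotopic_paths X p q"
  using assms homotopic_paths_sym homotopic_paths_trans path_in_refl
  unfolding path_class_def by blast

text \<open>Paths that run along one fixed path \<open>p\<close> are compared in the parameter interval, where a straight
  line homotopy is available. The laws of the fundamental groupoid are of this kind.\<close>

lemma homotopic_paths_pullback:
  assumes p: "path_in X p" and q: "path q" "path_image q \<subseteq> {0..1::real}" and q': "path q'" "path_image q' \<subseteq> {0..1}"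
    and ends: "pathstart q = pathstart q'" "pathfinish q = pathfinish q'"
  shows "homotopic_paths X (p \<circ> q) (p \<circ> q')"
proof (rule homotopic_paths_continuous_image)
  show "homotopic_paths {0..1} q q'"
  proof (rule homotopic_paths_linear)
    fix t :: real assume "t \<in> {0..1}"
    then have "q t \<in> {0..1}" "q' t \<in> {0..1}"
      using q q' by (auto simp: path_image_def image_subset_iff)
    then show "closed_segment (q t) (q' t) \<subseteq> {0..1}"
      by (intro closed_segment_subset) auto
  qed (use q q' ends in auto)
qed (use p in \<open>auto simp: path_in_def path_def path_image_def\<close>)

definition subarc :: "(real \<Rightarrow> 'a) \<Rightarrow> real \<Rightarrow> real \<Rightarrow> real \<Rightarrow> 'a" where
  "subarc p a b = p \<circ> linepath a b"

lemma subarc_simps [simp]: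
  "pathstart (subarc p a b) = p a" "pathfinish (subarc p a b) = p b"
  "subarc p a a = (\<lambda>_. p a)" "reversepath (subarc p a b) = subarc p b a" "subarc p 0 1 = p"
  by (auto simp: subarc_def pathstart_def pathfinish_def linepath_def reversepath_def algebra_simps)

lemma path_image_subarc: "path_image (subarc p a b) = p ` closed_segment a b"
  by (simp add: subarc_def path_image_compose)

lemma path_in_subarc:
  assumes "path_in X p" "a \<in> {0..1}" "b \<in> {0..1}"
  shows "path_in X (subarc p a b)"
proof -
  have "closed_segment a b \<subseteq> {0..1}"
    using assms by (intro closed_segment_subset) auto
  moreover from this have "path (subarc p a b)"
    using assms unfolding subarc_def path_in_def
    by (intro path_continuous_image) (auto simp: path_def elim: continuous_on_subset)
  ultimately show ?thesis
    using assms unfolding path_in_def path_image_subarc by (auto simp: path_image_def)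
qed

lemma homotopic_join_subarcs:
  assumes "path_in X p" "a \<in> {0..1}" "b \<in> {0..1}" "c \<in> {0..1}"
  shows "homotopic_paths X (subarc p a b +++ subarc p b c) (subarc p a c)"
proof -
  have "closed_segment a b \<subseteq> {0..1}" "closed_segment b c \<subseteq> {0..1}" "closed_segment a c \<subseteq> {0..1}"
    using assms by (intro closed_segment_subset; simp)+
  then have "homotopic_paths X (p \<circ> (linepath a b +++ linepath b c)) (p \<circ> linepath a c)"
    using assms by (intro homotopic_paths_pullback subset_path_image_join) auto
  then show ?thesis
    by (simp add: subarc_def path_compose_join)
qed

lemma homotopic_lid:
  assumes "path_in X p" "pathstart p = x"
  shows "homotopic_paths X ((\<lambda>_. x) +++ p) p"
  using homotopic_join_subarcs[OF assms(1), of 0 0 1] assms(2) by (simp add: pathstart_def)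

lemma homotopic_rid:
  assumes "path_in X p" "pathfinish p = x"
  shows "homotopic_paths X (p +++ (\<lambda>_. x)) p"
  using homotopic_join_subarcs[OF assms(1), of 0 1 1] assms(2) by (simp add: pathfinish_def)

lemma homotopic_rinv:
  assumes "path_in X p" "pathstart p = x"
  shows "homotopic_paths X (p +++ reversepath p) (\<lambda>_. x)"
  using homotopic_join_subarcs[OF assms(1), of 0 1 0] assms(2) subarc_simps(4)[of p 0 1]
  by (simp add: pathstart_def)

lemma homotopic_linv:
  assumes "path_in X p" "pathfinish p = x"
  shows "homotopic_paths X (reversepath p +++ p) (\<lambda>_. x)"
  using homotopic_rinv[of X "reversepath p" x] assms by simp

lemma homotopic_assoc:
  assumes "path_in X p" "path_in X q" "path_in X r" "pathfinish p = pathstart q" "pathfinish q = pathstart r"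
  shows "homotopic_paths X ((p +++ q) +++ r) (p +++ (q +++ r))"
  using assms by (intro homotopic_paths_sym[OF homotopic_paths_assoc]) (auto simp: path_in_def)

lemma homotopic_join:
  assumes "homotopic_paths X p p'" "homotopic_paths X q q'" "pathfinish p = pathstart q"
  shows "homotopic_paths X (p +++ q) (p' +++ q')"
  using assms by (rule homotopic_paths_join)

text \<open>A path \<open>\<tau> x\<close> from the base point to each point \<open>x\<close> closes up an arbitrary path to a loop at the base
  point. In this way the fundamental groupoid is mapped to the fundamental group, and paths that are
  not closed can be calculated with in a single group.\<close>

locale based_space =
  fixes X :: "'a::topological_space set" and x0 :: 'a and \<tau> :: "'a \<Rightarrow> real \<Rightarrow> 'a"
  assumes connector: "\<And>x. x \<in> X \<Longrightarrow> path_in X (\<tau> x)"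
    and connector_start [simp]: "\<And>x. x \<in> X \<Longrightarrow> pathstart (\<tau> x) = x0"
    and connector_finish [simp]: "\<And>x. x \<in> X \<Longrightarrow> pathfinish (\<tau> x) = x"
    and base_in: "x0 \<in> X"
    and connector_base: "homotopic_paths X (\<tau> x0) (\<lambda>_. x0)"
begin

abbreviation "K \<equiv> fundamental_group X x0"

definition loop_class :: "(real \<Rightarrow> 'a) \<Rightarrow> (real \<Rightarrow> 'a) set" where
  "loop_class p = path_class X (\<tau> (pathstart p) +++ (p +++ reversepath (\<tau> (pathfinish p))))"

lemma start_finish_in [simp]:
  "path_in X p \<Longrightarrow> pathstart p \<in> X" "path_in X p \<Longrightarrow> pathfinish p \<in> X"
  by (auto simp: path_in_def)

lemma const_simps [simp]: "pathstart (\<lambda>_. x) = x" "pathfinish (\<lambda>_. x) = x"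
  by (auto simp: pathstart_def pathfinish_def)

lemma carrier_K: "carrier K = path_class X ` {p. path_in X p \<and> pathstart p = x0 \<and> pathfinish p = x0}"
proof -
  have "path p \<and> path_image p \<subseteq> X \<and> pathstart p = x0 \<and> pathfinish p = x0 \<longleftrightarrow>
      path_in X p \<and> pathstart p = x0 \<and> pathfinish p = x0" for p
    by (auto simp: path_in_def)
  then show ?thesis
    by (auto simp: fundamental_group_def quotient_def path_class_def Image_def)
qed

lemma one_K: "\<one>\<^bsub>K\<^esub> = path_class X (\<lambda>_. x0)"
  by (simp add: fundamental_group_def path_class_def)

lemma mult_path_class:
  assumes "path_in X p" "path_in X q" "pathfinish p = x0" "pathstart q = x0"
  shows "path_class X p \<otimes>\<^bsub>K\<^esub> path_class X q = path_class X (p +++ q)"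
proof -
  have "homotopic_paths X (p +++ q) h"
    if "homotopic_paths X p f" "homotopic_paths X q g" "homotopic_paths X (f +++ g) h" for f g h
    using homotopic_paths_trans[OF homotopic_join[OF that(1,2)] that(3)] assms by simp
  moreover have "\<exists>f\<in>path_class X p. \<exists>g\<in>path_class X q. homotopic_paths X (f +++ g) h"
    if "homotopic_paths X (p +++ q) h" for h
    using that path_in_refl[OF assms(1)] path_in_refl[OF assms(2)] unfolding path_class_def by blast
  ultimately show ?thesis
    by (auto simp: fundamental_group_def path_class_def)
qed

lemma group_K: "group K"
proof (rule groupI)
  fix a b c assume "a \<in> carrier K" "b \<in> carrier K" "c \<in> carrier K"
  then obtain p q r where "path_in X p" "pathstart p = x0" "pathfinish p = x0" "a = path_class X p"
    "path_in X q" "pathstart q = x0" "pathfinish q = x0" "b = path_class X q"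
    "path_in X r" "pathstart r = x0" "pathfinish r = x0" "c = path_class X r"
    by (auto simp: carrier_K)
  then show "a \<otimes>\<^bsub>K\<^esub> b \<otimes>\<^bsub>K\<^esub> c = a \<otimes>\<^bsub>K\<^esub> (b \<otimes>\<^bsub>K\<^esub> c)"
    by (simp add: mult_path_class path_class_eq_iff homotopic_assoc)
next
  fix a assume "a \<in> carrier K"
  then obtain p where p: "path_in X p" "pathstart p = x0" "pathfinish p = x0" "a = path_class X p"
    by (auto simp: carrier_K)
  then show "\<one>\<^bsub>K\<^esub> \<otimes>\<^bsub>K\<^esub> a = a"
    using base_in by (simp add: one_K mult_path_class path_class_eq_iff homotopic_lid)
  have "path_class X (reversepath p) \<otimes>\<^bsub>K\<^esub> a = \<one>\<^bsub>K\<^esub>"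
    using p base_in by (simp add: one_K mult_path_class path_class_eq_iff homotopic_linv)
  moreover have "path_class X (reversepath p) \<in> carrier K"
    using p by (auto simp: carrier_K)
  ultimately show "\<exists>b\<in>carrier K. b \<otimes>\<^bsub>K\<^esub> a = \<one>\<^bsub>K\<^esub>" by blast
next
  fix a b assume "a \<in> carrier K" "b \<in> carrier K"
  then obtain p q where "path_in X p" "pathstart p = x0" "pathfinish p = x0" "a = path_class X p"
    "path_in X q" "pathstart q = x0" "pathfinish q = x0" "b = path_class X q"
    by (auto simp: carrier_K)
  then show "a \<otimes>\<^bsub>K\<^esub> b \<in> carrier K"
    by (auto simp: mult_path_class carrier_K intro!: imageI)
qed (use base_in in \<open>auto simp: carrier_K one_K intro!: imageI\<close>)

sublocale K: group K by (rule group_K)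

lemma loop_class_closed [simp]: "path_in X p \<Longrightarrow> loop_class p \<in> carrier K"
  by (auto simp: loop_class_def carrier_K connector intro!: imageI)

lemma loop_class_cong:
  assumes "homotopic_paths X p q"
  shows "loop_class p = loop_class q"
proof -
  have pq: "path_in X p" "path_in X q" "pathstart p = pathstart q" "pathfinish p = pathfinish q"
    using assms path_in_homotopic homotopic_paths_imp_pathstart homotopic_paths_imp_pathfinish by auto
  then have "homotopic_paths X (\<tau> (pathstart q) +++ (p +++ reversepath (\<tau> (pathfinish q))))
     (\<tau> (pathstart q) +++ (q +++ reversepath (\<tau> (pathfinish q))))"
    using assms by (intro homotopic_join path_in_refl) (auto simp: connector)
  then show ?thesis
    using pq by (simp add: loop_class_def path_class_eq_iff connector)
qed

text \<open>The connecting path to the common end point is traversed back and forth, and cancels.\<close>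

lemma loop_class_join:
  assumes p: "path_in X p" and q: "path_in X q" and pq: "pathfinish p = pathstart q"
  shows "loop_class (p +++ q) = loop_class p \<otimes>\<^bsub>K\<^esub> loop_class q"
proof -
  define a b c where "a = \<tau> (pathstart p)" and "b = \<tau> (pathstart q)" and "c = reversepath (\<tau> (pathfinish q))"
  have ab: "path_in X a" "path_in X b" "path_in X c"
    and [simp]: "pathstart a = x0" "pathfinish a = pathstart p" "pathstart b = x0"
      "pathfinish b = pathstart q" "pathstart c = pathfinish q" "pathfinish c = x0"
    using assms by (simp_all add: a_def b_def c_def connector)
  note [simp] = ab p q pq
  have "homotopic_paths X ((a +++ (p +++ reversepath b)) +++ (b +++ (q +++ c)))
      (a +++ ((p +++ reversepath b) +++ (b +++ (q +++ c))))"
    by (rule homotopic_assoc) auto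
  also have "homotopic_paths X \<dots> (a +++ (p +++ (reversepath b +++ (b +++ (q +++ c)))))"
    by (intro homotopic_join path_in_refl homotopic_assoc) auto
  also have "homotopic_paths X \<dots> (a +++ (p +++ ((reversepath b +++ b) +++ (q +++ c))))"
    by (intro homotopic_join path_in_refl homotopic_paths_sym[OF homotopic_assoc]) auto
  also have "homotopic_paths X \<dots> (a +++ (p +++ ((\<lambda>_. pathstart q) +++ (q +++ c))))"
    by (intro homotopic_join path_in_refl homotopic_linv) auto
  also have "homotopic_paths X \<dots> (a +++ (p +++ (q +++ c)))"
    by (intro homotopic_join path_in_refl homotopic_lid) auto
  also have "homotopic_paths X \<dots> (a +++ ((p +++ q) +++ c))"
    by (intro homotopic_join path_in_refl homotopic_paths_sym[OF homotopic_assoc]) auto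
  finally have "path_class X ((a +++ (p +++ reversepath b)) +++ (b +++ (q +++ c))) =
      path_class X (a +++ ((p +++ q) +++ c))"
    by (simp add: path_class_eq_iff)
  then show ?thesis
    by (simp add: loop_class_def mult_path_class flip: a_def b_def c_def)
qed

lemma loop_class_const [simp]:
  assumes "x \<in> X"
  shows "loop_class (\<lambda>_. x) = \<one>\<^bsub>K\<^esub>"
proof -
  have "(\<lambda>_. x) +++ (\<lambda>_. x) = (\<lambda>_. x)"
    by (auto simp: joinpaths_def)
  then have "loop_class (\<lambda>_. x) = loop_class (\<lambda>_. x) \<otimes>\<^bsub>K\<^esub> loop_class (\<lambda>_. x)"
    using loop_class_join[of "\<lambda>_. x" "\<lambda>_. x"] assms by simp
  then show ?thesis
    using assms K.l_cancel_one[of "loop_class (\<lambda>_. x)" "loop_class (\<lambda>_. x)"] by simp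
qed

lemma loop_class_reversepath:
  assumes "path_in X p"
  shows "loop_class (reversepath p) = inv\<^bsub>K\<^esub> loop_class p"
proof -
  have "loop_class (reversepath p +++ p) = \<one>\<^bsub>K\<^esub>"
    using loop_class_cong[OF homotopic_linv[OF assms HOL.refl]] assms by simp
  then show ?thesis
    using assms by (intro K.inv_equality[symmetric]) (auto simp: loop_class_join)
qed

lemma loop_class_loop:
  assumes "path_in X p" "pathstart p = x0" "pathfinish p = x0"
  shows "loop_class p = path_class X p"
proof -
  have "homotopic_paths X (reversepath (\<tau> x0)) (\<lambda>_. x0)"
    using homotopic_paths_reversepath_D[OF connector_base] by (simp add: reversepath_def)
  then have "homotopic_paths X (\<tau> x0 +++ (p +++ reversepath (\<tau> x0))) ((\<lambda>_. x0) +++ (p +++ (\<lambda>_. x0)))"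
    using assms base_in connector_base by (intro homotopic_join path_in_refl) auto
  also have "homotopic_paths X \<dots> (p +++ (\<lambda>_. x0))"
    using assms base_in by (intro homotopic_lid) auto
  also have "homotopic_paths X \<dots> p"
    using assms base_in by (intro homotopic_rid) auto
  finally show ?thesis
    using assms base_in by (simp add: loop_class_def path_class_eq_iff connector)
qed

lemma carrier_eq_loop_classes:
  "carrier K = loop_class ` {p. path_in X p \<and> pathstart p = x0 \<and> pathfinish p = x0}"
  unfolding carrier_K by (intro image_cong) (auto simp: loop_class_loop)

end

section \<open>Straight segments in sequence space\<close>

definition segment :: "('i \<Rightarrow> real) \<Rightarrow> ('i \<Rightarrow> real) \<Rightarrow> real \<Rightarrow> 'i \<Rightarrow> real" where
  "segment x y t = (\<lambda>i. (1 - t) * x i + t * y i)"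

lemma segment_ends [simp]:
  "pathstart (segment x y) = x" "pathfinish (segment x y) = y"
  "segment x y 0 = x" "segment x y 1 = y"
  by (auto simp: segment_def pathstart_def pathfinish_def)

lemma segment_trivial [simp]: "segment x x = (\<lambda>_. x)"
  by (auto simp: segment_def algebra_simps)

lemma reversepath_segment [simp]: "reversepath (segment x y) = segment y x"
  by (simp add: segment_def reversepath_def algebra_simps fun_eq_iff)

lemma path_segment [simp]: "path (segment x y)"
  unfolding path_def segment_def by (intro continuous_intros)

lemma path_in_segment:
  assumes "\<And>t. t \<in> {0..1} \<Longrightarrow> segment x y t \<in> X"
  shows "path_in X (segment x y)"
  using assms by (auto simp: path_in_def path_image_def)

locale based_sequence_space = based_space X x0 \<tau>
  for X :: "('i \<Rightarrow> real) set" and x0 \<tau>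
begin

text \<open>The segments from the points of \<open>p\<close> to \<open>c\<close> sweep out the image of a square. One side of the square
  is \<open>p\<close>, the opposite side is constant, and the remaining two sides are the segments from the end
  points of \<open>p\<close> to \<open>c\<close>.\<close>

lemma loop_class_cone:
  assumes p: "path p" and H: "\<And>s t. s \<in> {0..1} \<Longrightarrow> t \<in> {0..1} \<Longrightarrow> segment (p t) c s \<in> X"
  shows "loop_class p = loop_class (segment (pathstart p) c) \<otimes>\<^bsub>K\<^esub> inv\<^bsub>K\<^esub> loop_class (segment (pathfinish p) c)"
proof -
  define D where "D = ({0..1::real} \<times> {0..1::real})"
  define F where "F = (\<lambda>z. segment (p (snd z)) c (fst z))"
  have "convex D" unfolding D_def by (intro convex_Times) auto
  have contF: "continuous_on D F"
  proof -
    have "continuous_on {0..1} p" using p by (simp add: path_def)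
    then have "continuous_on D (\<lambda>z. p (snd z))"
      by (rule continuous_on_compose2) (auto simp: D_def intro!: continuous_intros)
    then have "continuous_on D (\<lambda>z. p (snd z) i)" for i
      by (rule continuous_on_product_then_coordinatewise)
    then show ?thesis
      unfolding F_def segment_def by (intro continuous_intros)
  qed
  define q where "q = linepath (0, 0) (1, 0) +++ (linepath (1, 0) (1, 1) +++ linepath (1, 1) (0, 1 :: real) :: real \<Rightarrow> real \<times> real)"
  define q' where "q' = (linepath (0, 0) (0, 1) :: real \<Rightarrow> real \<times> real)"
  have im: "path_image (linepath a b) \<subseteq> D" if "a \<in> D" "b \<in> D" for a b
    using that \<open>convex D\<close> by (simp add: closed_segment_subset)
  have D01: "(0, 0) \<in> D" "(1, 0) \<in> D" "(1, 1) \<in> D" "(0, 1) \<in> D"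
    by (auto simp: D_def)
  have q: "path q" "path_image q \<subseteq> D" "pathstart q = (0, 0)" "pathfinish q = (0, 1)"
    unfolding q_def by (simp_all add: subset_path_image_join im[unfolded path_image_linepath] D01)
  have q': "path q'" "path_image q' \<subseteq> D" "pathstart q' = (0, 0)" "pathfinish q' = (0, 1)"
    unfolding q'_def using im[of "(0,0)" "(0,1)"] by (auto simp: D_def)
  have "homotopic_paths D q' q"
  proof (rule homotopic_paths_linear)
    fix t :: real assume "t \<in> {0..1}"
    then have "q' t \<in> D" "q t \<in> D"
      using q q' by (auto simp: path_image_def)
    then show "closed_segment (q' t) (q t) \<subseteq> D"
      using \<open>convex D\<close> by (simp add: closed_segment_subset)
  qed (use q q' in auto)
  then have "homotopic_paths X (F \<circ> q') (F \<circ> q)"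
    using contF by (rule homotopic_paths_continuous_image) (use H in \<open>auto simp: D_def F_def\<close>)
  moreover have "F \<circ> q' = p"
    by (auto simp: F_def q'_def linepath_def)
  moreover have "F \<circ> q = segment (pathstart p) c +++ ((\<lambda>_. c) +++ segment c (pathfinish p))"
    by (auto simp: F_def q_def joinpaths_def linepath_def segment_def pathstart_def pathfinish_def algebra_simps)
  ultimately have hom: "homotopic_paths X p (segment (pathstart p) c +++ ((\<lambda>_. c) +++ segment c (pathfinish p)))"
    by simp
  have "path_in X (segment (pathstart p) c)" "path_in X (segment (pathfinish p) c)"
    using H[of _ 0] H[of _ 1] by (auto intro!: path_in_segment simp: pathstart_def pathfinish_def)
  moreover from this have "c \<in> X"
    using start_finish_in(2)[of "segment (pathstart p) c"] by simp
  moreover have "path_in X (segment c (pathfinish p))"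
    using \<open>path_in X (segment (pathfinish p) c)\<close> path_in_simps(2)[of X "segment (pathfinish p) c"] by simp
  moreover have "loop_class (segment c (pathfinish p)) = inv\<^bsub>K\<^esub> loop_class (segment (pathfinish p) c)"
    using loop_class_reversepath[of "segment (pathfinish p) c"] calculation by simp
  ultimately show ?thesis
    using loop_class_cong[OF hom] by (simp add: loop_class_join)
qed

end

section \<open>Holonomy of a cocycle on an open cover\<close>

lemma Lebesgue_number_preimage:
  fixes h :: "'m::metric_space \<Rightarrow> 'a::topological_space"
  assumes S: "compact S" and h: "continuous_on S h" "h ` S \<subseteq> (\<Union>v\<in>J. U v)"
    and U: "\<And>v. v \<in> J \<Longrightarrow> open (U v)"
  obtains \<delta> where "\<delta> > 0" "\<And>T. T \<subseteq> S \<Longrightarrow> T \<noteq> {} \<Longrightarrow> diameter T < \<delta> \<Longrightarrow> \<exists>v\<in>J. h ` T \<subseteq> U v"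
proof (cases "S = {}")
  case True
  then show ?thesis using that[of 1] by auto
next
  case False
  have "\<exists>W. open W \<and> W \<inter> S = h -` U v \<inter> S" if "v \<in> J" for v
    using U[OF that] h(1) unfolding continuous_on_open_invariant by blast
  then obtain W where W: "\<And>v. v \<in> J \<Longrightarrow> open (W v)" "\<And>v. v \<in> J \<Longrightarrow> W v \<inter> S = h -` U v \<inter> S"
    by metis
  have cover: "S \<subseteq> \<Union>(W ` J)"
  proof
    fix x assume x: "x \<in> S"
    then obtain v where v: "v \<in> J" "h x \<in> U v" using h(2) by auto
    with x have "x \<in> W v" using W(2)[OF v(1)] by blast
    with v show "x \<in> \<Union>(W ` J)" by blast
  qed
  then have "W ` J \<noteq> {}" using False by auto
  then obtain \<delta> where \<delta>: "0 < \<delta>" "\<And>T. T \<subseteq> S \<Longrightarrow> diameter T < \<delta> \<Longrightarrow> \<exists>B\<in>W ` J. T \<subseteq> B"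
    using Lebesgue_number_lemma[OF S _ cover] W(1) by (metis (no_types, lifting) imageE)
  have "\<exists>v\<in>J. h ` T \<subseteq> U v" if T: "T \<subseteq> S" "diameter T < \<delta>" for T
  proof -
    obtain v where v: "v \<in> J" "T \<subseteq> W v" using \<delta>(2)[OF T] by auto
    then have "h ` T \<subseteq> U v" using W(2)[OF v(1)] T(1) by blast
    with v show ?thesis by blast
  qed
  then show ?thesis using that[OF \<delta>(1)] by blast
qed

abbreviation grid_step :: "nat \<Rightarrow> nat \<Rightarrow> real set" where
  "grid_step N j \<equiv> {real j / real N .. real (Suc j) / real N}"

lemma grid_step_subset:
  assumes "j < N"
  shows "grid_step N j \<subseteq> {0..1}"
  using assms by (auto simp: field_simps)

text \<open>The transition elements \<open>g u v\<close> depend on the sets of the cover only and not on the point of their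
  intersection. So the product of the transitions met along a path does not change if the path moves
  a little inside the same sets. This is why it is a homotopy invariant.\<close>

locale holonomy = \<Gamma>: group \<Gamma>
  for \<Gamma> :: "('k, 'd) monoid_scheme" and X :: "'a::topological_space set" and J :: "'v set"
    and U :: "'v \<Rightarrow> 'a set" and g :: "'v \<Rightarrow> 'v \<Rightarrow> 'k" +
  assumes cover_open: "\<And>v. v \<in> J \<Longrightarrow> open (U v)"
    and cover: "X \<subseteq> (\<Union>v\<in>J. U v)"
    and transition_closed: "\<And>u v x. u \<in> J \<Longrightarrow> v \<in> J \<Longrightarrow> x \<in> X \<Longrightarrow> x \<in> U u \<Longrightarrow> x \<in> U v \<Longrightarrow> g u v \<in> carrier \<Gamma>"
    and cocycle: "\<And>u v w x. u \<in> J \<Longrightarrow> v \<in> J \<Longrightarrow> w \<in> J \<Longrightarrow> x \<in> X \<Longrightarrow> x \<in> U u \<Longrightarrow> x \<in> U v \<Longrightarrow> x \<in> U w \<Longrightarrow>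
      g u v \<otimes>\<^bsub>\<Gamma>\<^esub> g v w = g u w"
begin

abbreviation mult_\<Gamma> (infixl "\<cdot>" 70) where "a \<cdot> b \<equiv> a \<otimes>\<^bsub>\<Gamma>\<^esub> b"

definition track :: "(real \<Rightarrow> 'a) \<Rightarrow> nat \<Rightarrow> (nat \<Rightarrow> 'v) \<Rightarrow> bool" where
  "track p N w \<longleftrightarrow> N > 0 \<and> (\<forall>j<N. w j \<in> J \<and> p ` grid_step N j \<subseteq> U (w j))"

fun track_value :: "(nat \<Rightarrow> 'v) \<Rightarrow> nat \<Rightarrow> 'k" where
  "track_value w 0 = \<one>\<^bsub>\<Gamma>\<^esub>"
| "track_value w (Suc k) = track_value w k \<cdot> g (w k) (w (Suc k))"

text \<open>At a point that lies in a single set of the cover, all tracks agree.\<close>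

definition only_in :: "'a \<Rightarrow> bool" where
  "only_in x \<longleftrightarrow> x \<in> X \<and> (\<forall>u\<in>J. \<forall>v\<in>J. x \<in> U u \<longrightarrow> x \<in> U v \<longrightarrow> u = v)"

definition trackable :: "(real \<Rightarrow> 'a) \<Rightarrow> bool" where
  "trackable p \<longleftrightarrow> path_in X p \<and> only_in (pathstart p) \<and> only_in (pathfinish p)"

definition hol :: "(real \<Rightarrow> 'a) \<Rightarrow> 'k" where
  "hol p = (SOME a. \<exists>N w. track p N w \<and> a = track_value w (N - 1))"

lemma transition_refl:
  assumes "v \<in> J" "x \<in> X" "x \<in> U v"
  shows "g v v = \<one>\<^bsub>\<Gamma>\<^esub>"
  using cocycle[OF assms(1,1,1,2,3,3,3)] transition_closed[OF assms(1,1,2,3,3)]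
  by (metis \<Gamma>.l_cancel_one)

lemma grid_point_in:
  assumes "path_in X p" "j \<le> N" "N > 0"
  shows "p (real j / real N) \<in> X"
proof -
  have "real j / real N \<in> {0..1}" using assms by (auto simp: field_simps)
  then show ?thesis using assms(1) by (auto simp: path_in_def path_image_def image_subset_iff)
qed

lemma track_grid_points:
  assumes "track p N w" "j < N"
  shows "w j \<in> J" "p (real j / real N) \<in> U (w j)" "p (real (Suc j) / real N) \<in> U (w j)"
proof -
  have "real j / real N \<in> grid_step N j" "real (Suc j) / real N \<in> grid_step N j"
    by (auto simp: divide_right_mono)
  then show "w j \<in> J" "p (real j / real N) \<in> U (w j)" "p (real (Suc j) / real N) \<in> U (w j)"
    using assms unfolding track_def by blast+
qed

lemma track_value_closed:
  assumes p: "path_in X p" and w: "track p N w" and k: "k < N"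
  shows "track_value w k \<in> carrier \<Gamma>"
  using k
proof (induction k)
  case (Suc k)
  have "g (w k) (w (Suc k)) \<in> carrier \<Gamma>"
    using Suc.prems track_grid_points[OF w, of k] track_grid_points[OF w, of "Suc k"]
      grid_point_in[OF p, of "Suc k" N] by (intro transition_closed[of _ _ "p (real (Suc k) / real N)"]) auto
  then show ?case using Suc by simp
qed simp

text \<open>At each grid point four sets of the two tracks meet, and the cocycle condition there moves the
  transition from \<open>w\<close> to \<open>w'\<close> one step along the path.\<close>

lemma track_value_change:
  assumes p: "path_in X p" and w: "track p N w" and w': "track p N w'" and k: "k < N"
  shows "track_value w k \<cdot> g (w k) (w' k) = g (w 0) (w' 0) \<cdot> track_value w' k"
  using k
proof (induction k)
  case 0
  have "g (w 0) (w' 0) \<in> carrier \<Gamma>"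
    using 0 track_grid_points[OF w, of 0] track_grid_points[OF w', of 0] grid_point_in[OF p, of 0 N]
    by (intro transition_closed[of _ _ "p (real 0 / real N)"]) auto
  then show ?case by simp
next
  case (Suc k)
  define x where "x = p (real (Suc k) / real N)"
  have x: "x \<in> X" "x \<in> U (w k)" "x \<in> U (w (Suc k))" "x \<in> U (w' k)" "x \<in> U (w' (Suc k))"
    and J: "w k \<in> J" "w (Suc k) \<in> J" "w' k \<in> J" "w' (Suc k) \<in> J" "w 0 \<in> J" "w' 0 \<in> J"
    using Suc.prems track_grid_points[OF w, of k] track_grid_points[OF w', of k]
      track_grid_points[OF w, of "Suc k"] track_grid_points[OF w', of "Suc k"]
      track_grid_points[OF w, of 0] track_grid_points[OF w', of 0]
      grid_point_in[OF p, of "Suc k" N] unfolding x_def by auto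
  have g0: "g (w 0) (w' 0) \<in> carrier \<Gamma>"
    using Suc.prems track_grid_points[OF w, of 0] track_grid_points[OF w', of 0] grid_point_in[OF p, of 0 N]
    by (intro transition_closed[of _ _ "p (real 0 / real N)"]) auto
  note closed = transition_closed[OF _ _ x(1)] track_value_closed[OF p w, of k] track_value_closed[OF p w', of k]
  have "track_value w (Suc k) \<cdot> g (w (Suc k)) (w' (Suc k))
      = track_value w k \<cdot> (g (w k) (w (Suc k)) \<cdot> g (w (Suc k)) (w' (Suc k)))"
    using closed Suc.prems x J by (simp add: \<Gamma>.m_assoc)
  also have "g (w k) (w (Suc k)) \<cdot> g (w (Suc k)) (w' (Suc k)) = g (w k) (w' k) \<cdot> g (w' k) (w' (Suc k))"
    using x J by (simp add: cocycle[of _ _ _ x])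
  also have "track_value w k \<cdot> \<dots> = (track_value w k \<cdot> g (w k) (w' k)) \<cdot> g (w' k) (w' (Suc k))"
    using closed Suc.prems x J by (simp add: \<Gamma>.m_assoc)
  also have "\<dots> = g (w 0) (w' 0) \<cdot> track_value w' (Suc k)"
    using Suc closed Suc.prems x J g0 by (simp add: \<Gamma>.m_assoc)
  finally show ?case .
qed

lemma track_ends:
  assumes "track p N w"
  shows "w 0 \<in> J" "pathstart p \<in> U (w 0)" "w (N - 1) \<in> J" "pathfinish p \<in> U (w (N - 1))"
  using assms track_grid_points[OF assms, of 0] track_grid_points[OF assms, of "N - 1"]
  by (auto simp: track_def pathstart_def pathfinish_def)

lemma track_value_unique_same:
  assumes p: "trackable p" and w: "track p N w" and w': "track p N w'"
  shows "track_value w (N - 1) = track_value w' (N - 1)"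
proof -
  have N: "N > 0" using w by (simp add: track_def)
  have pX: "path_in X p" using p by (simp add: trackable_def)
  have "w 0 = w' 0" "w (N - 1) = w' (N - 1)"
    using p track_ends[OF w] track_ends[OF w'] by (auto simp: trackable_def only_in_def)
  moreover have "g (w 0) (w 0) = \<one>\<^bsub>\<Gamma>\<^esub>" "g (w (N - 1)) (w (N - 1)) = \<one>\<^bsub>\<Gamma>\<^esub>"
    using p track_ends[OF w] by (auto simp: trackable_def only_in_def intro: transition_refl)
  ultimately show ?thesis
    using track_value_change[OF pX w w', of "N - 1"] track_value_closed[OF pX w, of "N - 1"]
      track_value_closed[OF pX w', of "N - 1"] N by simp
qed

lemma track_refine:
  assumes p: "path_in X p" and w: "track p N w" and M: "M > 0"
  shows "track p (N * M) (\<lambda>j. w (j div M))"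
    and "track_value (\<lambda>j. w (j div M)) (N * M - 1) = track_value w (N - 1)"
proof -
  have N: "N > 0" using w by (simp add: track_def)
  have div_less: "j div M < N" if "j < N * M" for j
    using that by (simp add: less_mult_imp_div_less)
  have "grid_step (N * M) j \<subseteq> grid_step N (j div M)" for j
  proof -
    have "j div M * M \<le> j" "Suc j \<le> Suc (j div M) * M"
      using M by (simp_all add: Suc_leI dividend_less_div_times)
    then have "real (j div M) * real M \<le> real j" "real (Suc j) \<le> real (Suc (j div M)) * real M"
      by (simp_all only: of_nat_mult[symmetric] of_nat_le_iff)
    then have "real (j div M) / real N \<le> real j / real (N * M)" "real (Suc j) / real (N * M) \<le> real (Suc (j div M)) / real N"
    proof -
      have eq: "real a / real N = real a * real M / real (N * M)" for a
        using M by simp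
      assume *: "real (j div M) * real M \<le> real j" "real (Suc j) \<le> real (Suc (j div M)) * real M"
      show "real (j div M) / real N \<le> real j / real (N * M)" "real (Suc j) / real (N * M) \<le> real (Suc (j div M)) / real N"
        unfolding eq using * by (intro divide_right_mono; simp)+
    qed
    then show ?thesis by auto
  qed
  then show "track p (N * M) (\<lambda>j. w (j div M))"
    using w M div_less unfolding track_def by (meson image_mono mult_pos_pos subset_trans)
  have "track_value (\<lambda>j. w (j div M)) k = track_value w (k div M)" if "k < N * M" for k
    using that
  proof (induction k)
    case (Suc k)
    then have k: "k div M < N" "Suc k div M < N" by (simp_all add: div_less)
    show ?case
    proof (cases "Suc k div M = k div M")
      case True
      have "g (w (k div M)) (w (k div M)) = \<one>\<^bsub>\<Gamma>\<^esub>"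
        using track_grid_points[OF w k(1)] grid_point_in[OF p, of "k div M" N] k N by (intro transition_refl) auto
      then show ?thesis
        using Suc True track_value_closed[OF p w k(1)] by simp
    next
      case False
      then have "Suc k div M = Suc (k div M)" by (simp add: div_Suc split: if_splits)
      then show ?thesis using Suc by simp
    qed
  qed simp
  moreover have "(N * M - 1) div M = N - 1"
  proof -
    have "N * M - 1 = (N - 1) * M + (M - 1)" using N M by (cases N) (auto simp: algebra_simps)
    also have "\<dots> div M = N - 1" using M by (simp only: div_mult_self3) simp
    finally show ?thesis .
  qed
  ultimately show "track_value (\<lambda>j. w (j div M)) (N * M - 1) = track_value w (N - 1)"
    using N M by simp
qed

lemma track_value_unique:
  assumes p: "trackable p" and w: "track p N w" and w': "track p N' w'"
  shows "track_value w (N - 1) = track_value w' (N' - 1)"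
proof -
  have pos: "N > 0" "N' > 0" using w w' by (simp_all add: track_def)
  have pX: "path_in X p" using p by (simp add: trackable_def)
  have "track p (N * N') (\<lambda>j. w (j div N'))" "track p (N * N') (\<lambda>j. w' (j div N))"
    using track_refine(1)[OF pX w pos(2)] track_refine(1)[OF pX w' pos(1)] by (simp_all add: mult.commute)
  then show ?thesis
    using track_value_unique_same[OF p] track_refine(2)[OF pX w pos(2)] track_refine(2)[OF pX w' pos(1)]
    by (metis mult.commute)
qed

lemma hol_eq:
  assumes "trackable p" "track p N w"
  shows "hol p = track_value w (N - 1)"
  unfolding hol_def
proof (rule some_equality)
  show "\<exists>M v. track p M v \<and> track_value w (N - 1) = track_value v (M - 1)"
    using assms(2) by blast
  show "a = track_value w (N - 1)" if "\<exists>M v. track p M v \<and> a = track_value v (M - 1)" for a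
    using that track_value_unique[OF assms(1) _ assms(2)] by blast
qed

lemma ex_small_grid:
  assumes "(\<delta>::real) > 0"
  obtains N where "N > 0" "2 / real N < \<delta>"
proof -
  obtain N where "real N > 2 / \<delta>" using reals_Archimedean2 by blast
  then show ?thesis using that[of N] assms
    by (metis divide_pos_pos gr0I less_le_not_le mult.commute of_nat_0 pos_divide_less_eq zero_less_numeral order.strict_trans)
qed

lemma diameter_grid_step:
  assumes "N > 0"
  shows "diameter (grid_step N i) \<le> 1 / real N"
  using assms by (simp add: field_simps)

lemma diameter_grid_square:
  assumes N: "N > 0"
  shows "diameter (grid_step N i \<times> grid_step N j) \<le> 2 / real N"
proof (rule diameter_le)
  fix x y assume x: "x \<in> grid_step N i \<times> grid_step N j" and y: "y \<in> grid_step N i \<times> grid_step N j"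
  have eq: "real (Suc k) / real N = real k / real N + 1 / real N" for k
    by (simp add: add_divide_distrib)
  have "norm (x - y) \<le> norm (fst x - fst y) + norm (snd x - snd y)"
    using norm_Pair_le[of "fst (x - y)" "snd (x - y)"] by (metis fst_diff prod.collapse snd_diff)
  also have "\<dots> \<le> 1 / real N + 1 / real N"
    using x y unfolding eq by (intro add_mono) (auto simp: mem_Times_iff)
  finally show "norm (x - y) \<le> 2 / real N" by simp
qed (use N in simp)

lemma ex_track:
  assumes "path_in X p"
  obtains N w where "track p N w"
proof -
  have "continuous_on {0..1} p" "p ` {0..1} \<subseteq> (\<Union>v\<in>J. U v)"
    using assms cover by (auto simp: path_in_def path_def path_image_def)
  then obtain \<delta> where \<delta>: "\<delta> > 0" "\<And>T. T \<subseteq> {0..1} \<Longrightarrow> T \<noteq> {} \<Longrightarrow> diameter T < \<delta> \<Longrightarrow> \<exists>v\<in>J. p ` T \<subseteq> U v"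
    using Lebesgue_number_preimage[of "{0..1::real}" p U J] cover_open by (metis compact_Icc)
  obtain N where N: "N > 0" "2 / real N < \<delta>" using ex_small_grid[OF \<delta>(1)] .
  have "\<exists>v\<in>J. p ` grid_step N j \<subseteq> U v" if "j < N" for j
  proof (rule \<delta>(2))
    show "grid_step N j \<subseteq> {0..1}" by (rule grid_step_subset[OF that])
    show "grid_step N j \<noteq> {}" by (simp add: divide_right_mono)
    have "1 / real N \<le> 2 / real N" by (simp add: divide_right_mono)
    then show "diameter (grid_step N j) < \<delta>"
      using diameter_grid_step[OF N(1), of j] N(2) by linarith
  qed
  then obtain w where "\<And>j. j < N \<Longrightarrow> w j \<in> J \<and> p ` grid_step N j \<subseteq> U (w j)"
    by metis
  then show ?thesis using that[of N w] N by (simp add: track_def)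
qed

lemma hol_closed:
  assumes "trackable p"
  shows "hol p \<in> carrier \<Gamma>"
proof -
  have pX: "path_in X p" using assms by (simp add: trackable_def)
  then obtain N w where w: "track p N w" using ex_track by blast
  then show ?thesis
    using hol_eq[OF assms w] track_value_closed[OF pX w, of "N - 1"] by (simp add: track_def)
qed

text \<open>On a fine grid each small square of the homotopy lies in a set of the cover. The sets along one row of
  the grid form a track of both the lower and the upper boundary path of the row, so these two paths
  have the same holonomy.\<close>

lemma hol_homotopic:
  assumes p: "trackable p" and q: "homotopic_paths X p q"
  shows "hol p = hol q"
proof -
  obtain h where h: "continuous_on ({0..1} \<times> {0..1}) h" "h \<in> {0..1} \<times> {0..1} \<rightarrow> X"
    "\<And>x. x \<in> {0..1} \<Longrightarrow> h (0, x) = p x" "\<And>x. x \<in> {0..1} \<Longrightarrow> h (1, x) = q x"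
    and ends: "\<And>t. t \<in> {0..1::real} \<Longrightarrow> pathstart (h \<circ> Pair t) = pathstart p \<and> pathfinish (h \<circ> Pair t) = pathfinish p"
    using q unfolding homotopic_paths by blast
  have tr: "trackable (h \<circ> Pair s)" if s: "s \<in> {0..1}" for s
  proof -
    have "continuous_on {0..1} (h \<circ> Pair s)"
      using s by (intro continuous_on_compose continuous_on_subset[OF h(1)] continuous_intros) auto
    moreover have "(h \<circ> Pair s) ` {0..1} \<subseteq> X" using h(2) s by (auto simp: Pi_iff)
    ultimately show ?thesis
      using p ends[OF s] by (simp add: trackable_def path_in_def path_def path_image_def)
  qed
  have "h ` ({0..1} \<times> {0..1}) \<subseteq> (\<Union>v\<in>J. U v)" using h(2) cover by blast
  then obtain \<delta> where \<delta>: "\<delta> > 0"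
    "\<And>T. T \<subseteq> {0..1} \<times> {0..1} \<Longrightarrow> T \<noteq> {} \<Longrightarrow> diameter T < \<delta> \<Longrightarrow> \<exists>v\<in>J. h ` T \<subseteq> U v"
    using Lebesgue_number_preimage[OF compact_Times[OF compact_Icc compact_Icc] h(1)] cover_open by metis
  obtain N where N: "N > 0" "2 / real N < \<delta>" using ex_small_grid[OF \<delta>(1)] .
  have "\<exists>v\<in>J. h ` (grid_step N i \<times> grid_step N j) \<subseteq> U v" if ij: "i < N" "j < N" for i j
  proof (rule \<delta>(2))
    show "grid_step N i \<times> grid_step N j \<subseteq> {0..1} \<times> {0..1}"
      using grid_step_subset[OF ij(1)] grid_step_subset[OF ij(2)] by (intro Sigma_mono)
    show "grid_step N i \<times> grid_step N j \<noteq> {}" by (simp add: divide_right_mono)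
    show "diameter (grid_step N i \<times> grid_step N j) < \<delta>"
      using diameter_grid_square[OF N(1), of i j] N(2) by linarith
  qed
  then obtain w where w: "\<And>i j. i < N \<Longrightarrow> j < N \<Longrightarrow> w i j \<in> J \<and> h ` (grid_step N i \<times> grid_step N j) \<subseteq> U (w i j)"
    by metis
  have track: "track (h \<circ> Pair s) N (w i)" if "i < N" "s \<in> grid_step N i" for i s
    using w that N unfolding track_def image_comp[symmetric] by fastforce
  have "hol (h \<circ> Pair (real i / real N)) = hol (h \<circ> Pair 0)" if "i \<le> N" for i
    using that
  proof (induction i)
    case (Suc i)
    have s: "real i / real N \<in> grid_step N i" "real (Suc i) / real N \<in> grid_step N i"
      by (auto simp: divide_right_mono)
    then have t: "real i / real N \<in> {0..1}" "real (Suc i) / real N \<in> {0..1}"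
      using grid_step_subset[of i N] Suc.prems by auto
    have "hol (h \<circ> Pair (real (Suc i) / real N)) = hol (h \<circ> Pair (real i / real N))"
      using hol_eq[OF tr[OF t(1)] track[OF _ s(1)]] hol_eq[OF tr[OF t(2)] track[OF _ s(2)]] Suc.prems by simp
    then show ?case using Suc.IH Suc.prems by (metis Suc_leD)
  qed simp
  from this[of N] have "hol (h \<circ> Pair 1) = hol (h \<circ> Pair 0)" using N by simp
  moreover have "hol r = hol r'" if eq: "\<And>x. x \<in> {0..1} \<Longrightarrow> r x = r' x" for r r'
  proof -
    have "track r M v \<longleftrightarrow> track r' M v" for M v
    proof -
      have "r ` grid_step M j = r' ` grid_step M j" if "j < M" for j
      proof (rule image_cong)
        fix x assume "x \<in> grid_step M j"
        then have "x \<in> {0..1}" using grid_step_subset[OF that] by blast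
        then show "r x = r' x" by (rule eq)
      qed simp
      then show ?thesis by (auto simp: track_def)
    qed
    then show ?thesis by (simp add: hol_def)
  qed
  from this[of "h \<circ> Pair 0" p] this[of "h \<circ> Pair 1" q] have "hol (h \<circ> Pair 0) = hol p" "hol (h \<circ> Pair 1) = hol q"
    using h(3,4) by auto
  ultimately show ?thesis by simp
qed

lemma hol_const:
  assumes "only_in x"
  shows "hol (\<lambda>_. x) = \<one>\<^bsub>\<Gamma>\<^esub>"
proof -
  have tr: "trackable (\<lambda>_. x)"
    using assms by (simp add: trackable_def only_in_def pathstart_def pathfinish_def)
  obtain v where "v \<in> J" "x \<in> U v" using assms cover by (auto simp: only_in_def)
  then have "track (\<lambda>_. x) 1 (\<lambda>_. v)" by (auto simp: track_def)
  from hol_eq[OF tr this] show ?thesis by simp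
qed

lemma hol_join:
  assumes p: "trackable p" and q: "trackable q" and pq: "pathfinish p = pathstart q"
  shows "hol (p +++ q) = hol p \<cdot> hol q"
proof -
  have pX: "path_in X p" and qX: "path_in X q" using p q by (simp_all add: trackable_def)
  obtain N u where u: "track p N u" using ex_track[OF pX] .
  obtain M v where v: "track q M v" using ex_track[OF qX] .
  have pos: "N > 0" "M > 0" using u v by (simp_all add: track_def)
  define L where "L = N * M"
  have L: "L > 0" using pos by (simp add: L_def)
  obtain u' where u': "track p L u'" using track_refine(1)[OF pX u pos(2)] by (auto simp: L_def)
  obtain v' where v': "track q L v'" using track_refine(1)[OF qX v pos(1)] by (auto simp: L_def mult.commute)
  define w where "w j = (if j < L then u' j else v' (j - L))" for j
  have tr: "trackable (p +++ q)" using p q pq by (simp add: trackable_def)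
  have track: "track (p +++ q) (L + L) w"
    unfolding track_def
  proof (intro conjI allI impI)
    fix j assume j: "j < L + L"
    show "w j \<in> J" using j u' v' by (auto simp: w_def track_def)
    show "(p +++ q) ` grid_step (L + L) j \<subseteq> U (w j)"
    proof (cases "j < L")
      case True
      have "(p +++ q) t \<in> U (u' j)" if t: "t \<in> grid_step (L + L) j" for t
      proof -
        have "t \<le> real (Suc j) / real (L + L)" using t by simp
        also have "\<dots> \<le> real L / real (L + L)" using True L by (intro divide_right_mono) auto
        also have "\<dots> = 1 / 2" using L by simp
        finally have "(p +++ q) t = p (2 * t)" by (simp add: joinpaths_def)
        moreover have "2 * t \<in> grid_step L j" using t L by (auto simp: field_simps)
        ultimately show ?thesis using u' True unfolding track_def image_subset_iff by metis
      qed
      then show ?thesis using True by (auto simp: w_def)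
    next
      case False
      have "(p +++ q) t \<in> U (v' (j - L))" if t: "t \<in> grid_step (L + L) j" for t
      proof -
        have "1 / 2 = real L / real (L + L)" using L by simp
        also have "\<dots> \<le> real j / real (L + L)" using False L by (intro divide_right_mono) auto
        also have "\<dots> \<le> t" using t by simp
        finally have t2: "1 / 2 \<le> t" .
        have "(p +++ q) t = q (2 * t - 1)"
        proof (cases "t = 1 / 2")
          case True
          show ?thesis unfolding True using pq by (simp add: joinpaths_def pathstart_def pathfinish_def)
        qed (use t2 in \<open>simp add: joinpaths_def\<close>)
        moreover have "2 * t - 1 \<in> grid_step L (j - L)"
          using t L False by (auto simp: field_simps of_nat_diff Suc_diff_le)
        moreover have "j - L < L" using j by simp
        ultimately show ?thesis using v' unfolding track_def image_subset_iff by metis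
      qed
      then show ?thesis using False by (auto simp: w_def)
    qed
  qed (use L in simp)
  have "u' (L - 1) = v' 0"
    using track_ends[OF u'] track_ends[OF v'] p pq by (auto simp: trackable_def only_in_def)
  moreover have "g (v' 0) (v' 0) = \<one>\<^bsub>\<Gamma>\<^esub>"
    using track_ends[OF v'] q by (auto simp: trackable_def only_in_def intro: transition_refl)
  ultimately have mid: "g (u' (L - 1)) (v' 0) = \<one>\<^bsub>\<Gamma>\<^esub>" by simp
  have first: "track_value w k = track_value u' k" if "k < L" for k
    using that by (induction k) (auto simp: w_def)
  have second: "track_value w (L + k) = track_value u' (L - 1) \<cdot> track_value v' k" if "k < L" for k
    using that
  proof (induction k)
    case 0
    obtain L' where L': "L = Suc L'" using L by (cases L) auto
    have "w L' = u' L'" "w L = v' 0" by (simp_all add: w_def L')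
    then have "track_value w L = track_value u' L' \<cdot> g (u' L') (v' 0)"
      using first[of L'] by (simp add: L')
    then show ?case
      using mid track_value_closed[OF pX u', of L'] by (simp add: L')
  next
    case (Suc k)
    have "g (v' k) (v' (Suc k)) \<in> carrier \<Gamma>"
      using Suc.prems track_grid_points[OF v', of k] track_grid_points[OF v', of "Suc k"]
        grid_point_in[OF qX, of "Suc k" L] by (intro transition_closed[of _ _ "q (real (Suc k) / real L)"]) auto
    then show ?case
      using Suc track_value_closed[OF pX u', of "L - 1"] track_value_closed[OF qX v', of k]
      by (simp add: w_def \<Gamma>.m_assoc)
  qed
  have "L + L - 1 = L + (L - 1)" using L by simp
  then have "hol (p +++ q) = track_value u' (L - 1) \<cdot> track_value v' (L - 1)"
    using hol_eq[OF tr track] second[of "L - 1"] L by simp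
  then show ?thesis
    using hol_eq[OF p u'] hol_eq[OF q v'] by simp
qed

lemma hol_reversepath:
  assumes p: "trackable p"
  shows "hol (reversepath p) = inv\<^bsub>\<Gamma>\<^esub> hol p"
proof -
  have r: "trackable (reversepath p)" using p by (simp add: trackable_def)
  have "trackable (reversepath p +++ p)" using p by (simp add: trackable_def)
  then have "hol (reversepath p +++ p) = hol (\<lambda>_. pathfinish p)"
    using p by (intro hol_homotopic homotopic_linv) (auto simp: trackable_def)
  then have "hol (reversepath p) \<cdot> hol p = \<one>\<^bsub>\<Gamma>\<^esub>"
    using p r by (simp add: hol_join hol_const trackable_def)
  then show ?thesis
    using hol_closed p r by (intro \<Gamma>.inv_equality[symmetric]) auto
qed

lemma hol_two_steps:
  assumes p: "trackable p" and uv: "u \<in> J" "v \<in> J"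
    and "\<And>t. t \<in> {0..1/2} \<Longrightarrow> p t \<in> U u" "\<And>t. t \<in> {1/2..1} \<Longrightarrow> p t \<in> U v"
  shows "hol p = g u v"
proof -
  have track: "track p 2 (\<lambda>j. if j = 0 then u else v)"
    using assms by (auto simp: track_def less_2_cases_iff)
  have "p (1/2) \<in> X" "p (1/2) \<in> U u" "p (1/2) \<in> U v"
    using assms by (auto simp: trackable_def path_in_def path_image_def image_subset_iff)
  then have "g u v \<in> carrier \<Gamma>" using uv transition_closed by blast
  then show ?thesis using hol_eq[OF p track] by simp
qed

end

section \<open>Presentation of the fundamental group of a square complex\<close>

lemma (in group) cancel_middle:
  assumes "a \<in> carrier G" "b \<in> carrier G" "c \<in> carrier G"
  shows "inv a \<otimes> b \<otimes> (inv b \<otimes> c) = inv a \<otimes> c"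
proof -
  have "b \<otimes> (inv b \<otimes> c) = c" using assms by (simp add: m_assoc[symmetric])
  then show ?thesis using assms by (simp add: m_assoc)
qed

definition vertex :: "nat set \<Rightarrow> nat \<Rightarrow> real" where
  "vertex A = (\<lambda>i. if i \<in> A then 1 else 0)"

definition free_coords :: "(nat \<Rightarrow> real) \<Rightarrow> nat set" where
  "free_coords x = {i. 0 < x i \<and> x i < 1}"

definition one_coords :: "(nat \<Rightarrow> real) \<Rightarrow> nat set" where
  "one_coords x = {i. x i = 1}"

text \<open>A point of the cube lies in the relative interior of exactly one face, whose free coordinates are
  \<open>free_coords\<close> and whose coordinates fixed to \<open>1\<close> are \<open>one_coords\<close>. So the union of the \<open>1\<close>-skeleton and of
  the squares \<open>(I, V)\<close> in \<open>Fs\<close> is described by a condition on the face of each point.\<close>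

definition square_complex :: "nat \<Rightarrow> (nat set \<times> nat set) set \<Rightarrow> (nat \<Rightarrow> real) set" where
  "square_complex n Fs = {x. (\<forall>i. 0 \<le> x i \<and> x i \<le> 1) \<and> (\<forall>i\<ge>n. x i = 0) \<and>
     (card (free_coords x) \<le> 1 \<or> card (free_coords x) = 2 \<and> (free_coords x, one_coords x) \<in> Fs)}"

definition star :: "nat \<Rightarrow> nat set \<Rightarrow> (nat \<Rightarrow> real) set" where
  "star n A = {x. \<forall>i<n. \<bar>x i - vertex A i\<bar> < 1}"

text \<open>The vertices of the face whose relative interior contains \<open>x\<close>.\<close>

definition corners :: "(nat \<Rightarrow> real) \<Rightarrow> nat set set" where
  "corners x = {u. one_coords x \<subseteq> u \<and> u \<subseteq> one_coords x \<union> free_coords x}"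

definition flip :: "nat \<Rightarrow> nat set \<Rightarrow> nat set" where
  "flip i u = (if i \<in> u then u - {i} else insert i u)"

definition adjacent :: "nat \<Rightarrow> nat set \<Rightarrow> nat set \<Rightarrow> bool" where
  "adjacent n u v \<longleftrightarrow> u \<subseteq> {..<n} \<and> (\<exists>i<n. v = flip i u)"

definition sdiff :: "nat set \<Rightarrow> nat set \<Rightarrow> nat set" where
  "sdiff A B = (A - B) \<union> (B - A)"

text \<open>The spanning tree with root \<open>w\<close> in which the parent of a vertex is obtained by correcting the largest
  coordinate in which it differs from \<open>w\<close>. By the choice of the largest coordinate, the tree meets the
  subcube through \<open>w\<close> in the directions below \<open>m\<close> in the tree of the same form of this subcube, and
  joins every other vertex to it without using further edges of the subcube.\<close>

definition tree_edge :: "nat \<Rightarrow> nat set \<Rightarrow> nat set \<Rightarrow> nat set \<Rightarrow> bool" where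
  "tree_edge n w u v \<longleftrightarrow> u \<subseteq> {..<n} \<and> (\<exists>i<n. v = flip i u \<and> sdiff w u \<subseteq> {..<i})"

lemma mem_flip: "a \<in> flip i u \<longleftrightarrow> (a \<in> u \<longleftrightarrow> a \<noteq> i)"
  by (auto simp: flip_def)

lemma mem_sdiff: "a \<in> sdiff A B \<longleftrightarrow> (a \<in> A) \<noteq> (a \<in> B)"
  by (auto simp: sdiff_def)

lemma sdiff_simps [simp]: "sdiff A {} = A" "sdiff A A = {}" "sdiff w (sdiff w u) = u"
  by (auto simp: sdiff_def)

lemma flip_flip [simp]: "flip i (flip i u) = u"
  by (auto simp: set_eq_iff mem_flip)

lemma flip_neq [simp]: "flip i u \<noteq> u" "u \<noteq> flip i u"
  by (auto simp: set_eq_iff mem_flip)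

lemma flip_subset: "u \<subseteq> {..<n} \<Longrightarrow> i < n \<Longrightarrow> flip i u \<subseteq> {..<n}"
  by (auto simp: flip_def split: if_splits)

lemma adjacent_sym: "adjacent n u v \<Longrightarrow> adjacent n v u"
  unfolding adjacent_def using flip_subset flip_flip by metis

lemma adjacent_subset: "adjacent n u v \<Longrightarrow> u \<subseteq> {..<n} \<and> v \<subseteq> {..<n}"
  unfolding adjacent_def using flip_subset by metis

lemma adjacent_irrefl [simp]: "\<not> adjacent n u u"
  by (simp add: adjacent_def)

lemma tree_edge_adjacent: "tree_edge n w u v \<Longrightarrow> adjacent n u v"
  by (auto simp: tree_edge_def adjacent_def)

lemma vertex_simps: "free_coords (vertex A) = {}" "one_coords (vertex A) = A"
  by (auto simp: free_coords_def one_coords_def vertex_def)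

lemma vertex_in_complex: "A \<subseteq> {..<n} \<Longrightarrow> vertex A \<in> square_complex n Fs"
  by (auto simp: square_complex_def vertex_simps) (auto simp: vertex_def)

lemma corners_iff_star:
  assumes x: "x \<in> square_complex n Fs" and u: "u \<subseteq> {..<n}"
  shows "x \<in> star n u \<longleftrightarrow> u \<in> corners x"
proof
  assume "x \<in> star n u"
  then have *: "\<bar>x i - vertex u i\<bar> < 1" if "i < n" for i
    using that by (auto simp: star_def)
  have 0: "x i = 0" if "\<not> i < n" for i using x that by (auto simp: square_complex_def)
  have 1: "0 \<le> x i" "x i \<le> 1" for i using x by (auto simp: square_complex_def)
  show "u \<in> corners x"
    unfolding corners_def one_coords_def free_coords_def
  proof (intro CollectI conjI subsetI)
    fix i assume "i \<in> {i. x i = 1}"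
    then show "i \<in> u" using *[of i] 0[of i] by (cases "i < n") (auto simp: vertex_def split: if_splits)
  next
    fix i assume "i \<in> u"
    then show "i \<in> {i. x i = 1} \<union> {i. 0 < x i \<and> x i < 1}"
      using *[of i] u 1[of i] by (auto simp: vertex_def)
  qed
next
  assume c: "u \<in> corners x"
  have "\<bar>x i - vertex u i\<bar> < 1" for i
  proof (cases "i \<in> u")
    case True
    then have "x i = 1 \<or> 0 < x i \<and> x i < 1"
      using c by (auto simp: corners_def one_coords_def free_coords_def)
    then show ?thesis using True by (auto simp: vertex_def)
  next
    case False
    then have "x i \<noteq> 1" using c by (auto simp: corners_def one_coords_def)
    moreover have "0 \<le> x i" "x i \<le> 1" using x by (auto simp: square_complex_def)
    ultimately show ?thesis using False by (simp add: vertex_def)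
  qed
  then show "x \<in> star n u" by (simp add: star_def)
qed

lemma coord_zero: "x \<in> square_complex n Fs \<Longrightarrow> \<not> i < n \<Longrightarrow> x i = 0"
  by (simp add: square_complex_def)

lemma coord_bounds: "x \<in> square_complex n Fs \<Longrightarrow> 0 \<le> x i \<and> x i \<le> 1"
  by (simp add: square_complex_def)

lemma free_coords_subset:
  assumes "x \<in> square_complex n Fs"
  shows "free_coords x \<subseteq> {..<n}"
proof
  show "i \<in> {..<n}" if "i \<in> free_coords x" for i
    using that coord_zero[OF assms, of i] by (cases "i < n") (auto simp: free_coords_def)
qed

lemma one_coords_subset:
  assumes "x \<in> square_complex n Fs"
  shows "one_coords x \<subseteq> {..<n}"
proof
  show "i \<in> {..<n}" if "i \<in> one_coords x" for i
    using that coord_zero[OF assms, of i] by (cases "i < n") (auto simp: one_coords_def)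
qed

lemma corners_subset: "x \<in> square_complex n Fs \<Longrightarrow> u \<in> corners x \<Longrightarrow> u \<subseteq> {..<n}"
  using free_coords_subset one_coords_subset unfolding corners_def by blast

text \<open>The complex contains the whole closed face of each of its points.\<close>

lemma closed_face_subset:
  assumes x: "x \<in> square_complex n Fs" and y: "\<And>i. 0 \<le> y i \<and> y i \<le> 1" "\<And>i. i \<notin> free_coords x \<Longrightarrow> y i = x i"
  shows "y \<in> square_complex n Fs"
proof -
  have fin: "finite (free_coords x)" using free_coords_subset[OF x] finite_subset by blast
  have sub: "free_coords y \<subseteq> free_coords x"
    using y(2) by (force simp: free_coords_def)
  have zero: "\<forall>i\<ge>n. y i = 0"
  proof (intro allI impI)
    fix i assume "n \<le> i"
    then have "i \<notin> free_coords x" "x i = 0"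
      using free_coords_subset[OF x] coord_zero[OF x, of i] by auto
    then show "y i = 0" using y(2) by simp
  qed
  have "card (free_coords y) \<le> 1 \<or> card (free_coords y) = 2 \<and> (free_coords y, one_coords y) \<in> Fs"
  proof (cases "free_coords y = free_coords x")
    case True
    have "i \<in> one_coords y \<longleftrightarrow> i \<in> one_coords x" for i
    proof (cases "i \<in> free_coords x")
      case i: True
      then have "i \<in> free_coords y" using True by simp
      with i show ?thesis by (simp add: one_coords_def free_coords_def)
    next
      case False
      then show ?thesis using y(2) by (simp add: one_coords_def)
    qed
    then have "one_coords y = one_coords x" by blast
    then show ?thesis using True x by (simp add: square_complex_def)
  next
    case False
    then have "card (free_coords y) < card (free_coords x)"
      using sub fin by (intro psubset_card_mono) auto
    moreover have "card (free_coords x) \<le> 2" using x by (auto simp: square_complex_def)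
    ultimately show ?thesis by linarith
  qed
  then show ?thesis using y(1) zero by (simp add: square_complex_def)
qed

lemma segment_bounds:
  assumes "0 \<le> x i \<and> x i \<le> 1" "0 \<le> y i \<and> y i \<le> (1::real)" "t \<in> {0..1}"
  shows "0 \<le> segment x y t i \<and> segment x y t i \<le> 1"
  using assms by (auto simp: segment_def intro!: convex_bound_le)

lemma corner_agrees:
  assumes "x \<in> square_complex n Fs" "u \<in> corners x" "i \<notin> free_coords x"
  shows "vertex u i = x i"
proof -
  have "x i = 0 \<or> x i = 1" using coord_bounds[OF assms(1), of i] assms(3) by (auto simp: free_coords_def)
  then show ?thesis
    using assms by (auto simp: corners_def one_coords_def vertex_def)
qed

lemma vertex_bounds: "0 \<le> vertex u i \<and> vertex u i \<le> 1"
  by (simp add: vertex_def)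

lemma segment_to_corner:
  assumes "x \<in> square_complex n Fs" "u \<in> corners x" "t \<in> {0..1}"
  shows "segment x (vertex u) t \<in> square_complex n Fs"
proof (rule closed_face_subset[OF assms(1)])
  show "0 \<le> segment x (vertex u) t i \<and> segment x (vertex u) t i \<le> 1" for i
    using assms by (intro segment_bounds vertex_bounds coord_bounds[OF assms(1)]) auto
  show "segment x (vertex u) t i = x i" if "i \<notin> free_coords x" for i
    using corner_agrees[OF assms(1,2) that] by (simp add: segment_def algebra_simps)
qed

lemma triangle_in_complex:
  assumes "x \<in> square_complex n Fs" "u \<in> corners x" "v \<in> corners x" "s \<in> {0..1}" "t \<in> {0..1}"
  shows "segment (segment (vertex u) (vertex v) t) x s \<in> square_complex n Fs"
proof (rule closed_face_subset[OF assms(1)])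
  show "0 \<le> segment (segment (vertex u) (vertex v) t) x s i \<and> segment (segment (vertex u) (vertex v) t) x s i \<le> 1" for i
    using assms by (intro segment_bounds vertex_bounds coord_bounds[OF assms(1)]) auto
  show "segment (segment (vertex u) (vertex v) t) x s i = x i" if "i \<notin> free_coords x" for i
    using corner_agrees[OF assms(1,2) that] corner_agrees[OF assms(1,3) that] by (simp add: segment_def algebra_simps)
qed

definition face_center :: "nat set \<Rightarrow> nat set \<Rightarrow> nat \<Rightarrow> real" where
  "face_center I V = (\<lambda>i. if i \<in> I then 1/2 else if i \<in> V then 1 else 0)"

lemma face_center_simps:
  "free_coords (face_center I V) = I" "one_coords (face_center I V) = V - I"
  by (auto simp: face_center_def free_coords_def one_coords_def)

lemma face_center_in_complex:
  assumes "I \<union> V \<subseteq> {..<n}" "I \<inter> V = {}" "card I \<le> 1 \<or> card I = 2 \<and> (I, V) \<in> Fs"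
  shows "face_center I V \<in> square_complex n Fs"
proof -
  have "V - I = V" using assms(2) by auto
  moreover have "\<forall>i\<ge>n. face_center I V i = 0" using assms(1) by (auto simp: face_center_def)
  ultimately show ?thesis
    using assms by (auto simp: square_complex_def face_center_simps) (auto simp: face_center_def)
qed

lemma edge_center:
  assumes "adjacent n u v"
  obtains x where "x \<in> square_complex n Fs" "u \<in> corners x" "v \<in> corners x"
proof -
  obtain i where i: "i < n" "v = flip i u" "u \<subseteq> {..<n}" using assms by (auto simp: adjacent_def)
  have "face_center {i} (u - {i}) \<in> square_complex n Fs"
    using i by (intro face_center_in_complex) auto
  moreover have "u \<in> corners (face_center {i} (u - {i}))" "v \<in> corners (face_center {i} (u - {i}))"
    using i by (auto simp: corners_def face_center_simps mem_flip)
  ultimately show ?thesis using that by blast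
qed

lemma edge_in_complex:
  assumes "adjacent n u v"
  shows "path_in (square_complex n Fs) (segment (vertex u) (vertex v))"
proof (rule path_in_segment)
  fix t :: real assume t: "t \<in> {0..1}"
  obtain x where "x \<in> square_complex n Fs" "u \<in> corners x" "v \<in> corners x"
    using edge_center[OF assms] .
  from triangle_in_complex[OF this, of 0 t] t
  show "segment (vertex u) (vertex v) t \<in> square_complex n Fs" by simp
qed

lemma open_star: "open (star n A)"
proof -
  have "open {x :: nat \<Rightarrow> real. \<bar>x i - vertex A i\<bar> < 1}" for i
    by (intro open_Collect_less continuous_intros continuous_on_product_coordinates)
  then have "open (\<Inter>i\<in>{..<n}. {x :: nat \<Rightarrow> real. \<bar>x i - vertex A i\<bar> < 1})"
    by (intro open_INT) auto
  moreover have "star n A = (\<Inter>i\<in>{..<n}. {x. \<bar>x i - vertex A i\<bar> < 1})"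
    by (auto simp: star_def)
  ultimately show ?thesis by simp
qed

text \<open>The path in the tree that starts at \<open>w\<close> and changes the coordinates in \<open>D\<close> below the given bound, in
  increasing order.\<close>

primrec tree_path :: "nat set \<Rightarrow> nat set \<Rightarrow> nat \<Rightarrow> real \<Rightarrow> nat \<Rightarrow> real" where
  "tree_path w D 0 = (\<lambda>_. vertex w)"
| "tree_path w D (Suc k) = (if k \<in> D
     then tree_path w D k +++ segment (vertex (sdiff w (D \<inter> {..<k}))) (vertex (sdiff w (D \<inter> {..<Suc k})))
     else tree_path w D k)"

locale rooted_square_complex =
  fixes n :: nat and Fs :: "(nat set \<times> nat set) set" and w :: "nat set"
  assumes w: "w \<subseteq> {..<n}"
begin

abbreviation "X \<equiv> square_complex n Fs"

lemma tree_step: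
  assumes "k \<in> D" "k < n" "D \<subseteq> {..<n}"
  shows "tree_edge n w (sdiff w (D \<inter> {..<k})) (sdiff w (D \<inter> {..<Suc k}))"
  unfolding tree_edge_def
proof (intro conjI exI[of _ k])
  show "sdiff w (D \<inter> {..<Suc k}) = flip k (sdiff w (D \<inter> {..<k}))"
    using assms by (auto simp: set_eq_iff mem_flip mem_sdiff less_Suc_eq)
qed (use assms w in \<open>auto simp: sdiff_def\<close>)

lemma tree_path_props:
  assumes "k \<le> n" "D \<subseteq> {..<n}"
  shows "path_in X (tree_path w D k) \<and> pathstart (tree_path w D k) = vertex w \<and>
    pathfinish (tree_path w D k) = vertex (sdiff w (D \<inter> {..<k}))"
  using assms
proof (induction k)
  case 0
  then show ?case using vertex_in_complex[OF w] by (simp add: pathstart_def pathfinish_def)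
next
  case (Suc k)
  show ?case
  proof (cases "k \<in> D")
    case True
    then show ?thesis
      using Suc edge_in_complex[OF tree_edge_adjacent[OF tree_step[of k D]]] by simp
  next
    case False
    then have "D \<inter> {..<Suc k} = D \<inter> {..<k}" by (auto simp: less_Suc_eq)
    then show ?thesis using False Suc by simp
  qed
qed

lemma tree_path_cong:
  assumes "D \<inter> {..<k} = D' \<inter> {..<k}"
  shows "tree_path w D k = tree_path w D' k"
  using assms
proof (induction k)
  case (Suc k)
  then have "D \<inter> {..<k} = D' \<inter> {..<k}" "k \<in> D \<longleftrightarrow> k \<in> D'" by (auto simp: set_eq_iff less_Suc_eq)
  then show ?case using Suc by simp
qed simp

lemma tree_path_stable:
  assumes "D \<subseteq> {..<k}" "k \<le> m"
  shows "tree_path w D m = tree_path w D k"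
  using assms(2)
proof (induction m rule: dec_induct)
  case (step m)
  then have "m \<notin> D" using assms(1) by auto
  then show ?case using step by simp
qed simp

definition root_path :: "nat set \<Rightarrow> real \<Rightarrow> nat \<Rightarrow> real" where
  "root_path v = tree_path w (sdiff w v) n"

lemma root_path_props:
  assumes "v \<subseteq> {..<n}"
  shows "path_in X (root_path v)" "pathstart (root_path v) = vertex w" "pathfinish (root_path v) = vertex v"
proof -
  have "sdiff w v \<subseteq> {..<n}" using assms w by (auto simp: sdiff_def)
  moreover from this have "sdiff w v \<inter> {..<n} = sdiff w v" by auto
  ultimately show "path_in X (root_path v)" "pathstart (root_path v) = vertex w" "pathfinish (root_path v) = vertex v"
    using tree_path_props[of n "sdiff w v"] by (simp_all add: root_path_def)
qed

lemma root_path_root: "root_path w = (\<lambda>_. vertex w)"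
proof -
  have "tree_path w {} k = (\<lambda>_. vertex w)" for k by (induction k) auto
  then show ?thesis by (simp add: root_path_def)
qed

lemma root_path_tree_edge:
  assumes "tree_edge n w u v"
  shows "root_path v = root_path u +++ segment (vertex u) (vertex v)"
proof -
  obtain i where i: "i < n" "v = flip i u" "sdiff w u \<subseteq> {..<i}" "u \<subseteq> {..<n}"
    using assms by (auto simp: tree_edge_def)
  define D where "D = sdiff w v"
  have D: "i \<in> D" "D \<inter> {..<i} = sdiff w u" "D \<inter> {..<Suc i} = D" "D \<subseteq> {..<Suc i}"
    using i(2,3) by (auto simp: D_def set_eq_iff subset_iff mem_sdiff mem_flip less_Suc_eq)
  have "root_path v = tree_path w D (Suc i)"
    unfolding root_path_def D_def[symmetric] using D i by (intro tree_path_stable) auto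
  also have "\<dots> = tree_path w D i +++ segment (vertex u) (vertex v)"
    using D by (simp add: D_def)
  also have "tree_path w D i = tree_path w (sdiff w u) i"
    using D i by (intro tree_path_cong) auto
  also have "\<dots> = root_path u"
    unfolding root_path_def using i by (intro tree_path_stable[symmetric]) auto
  finally show ?thesis .
qed

definition nearest :: "(nat \<Rightarrow> real) \<Rightarrow> nat set" where
  "nearest x = {i. x i > 1/2}"

text \<open>The connecting path from the origin runs backwards to the root \<open>w\<close>, then along the tree to the vertex
  nearest to \<open>x\<close>, and straight on to \<open>x\<close>. With this choice the tree edges become trivial, while loops
  at the origin are changed by a trivial factor only.\<close>

definition connector :: "(nat \<Rightarrow> real) \<Rightarrow> real \<Rightarrow> nat \<Rightarrow> real" where
  "connector x = reversepath (root_path {}) +++ (root_path (nearest x) +++ segment (vertex (nearest x)) x)"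

lemma nearest_corner:
  assumes "x \<in> X"
  shows "nearest x \<in> corners x" "nearest x \<subseteq> {..<n}"
proof -
  show "nearest x \<in> corners x"
    unfolding corners_def
  proof (intro CollectI conjI subsetI)
    show "i \<in> nearest x" if "i \<in> one_coords x" for i
      using that by (simp add: nearest_def one_coords_def)
    show "i \<in> one_coords x \<union> free_coords x" if "i \<in> nearest x" for i
      using that coord_bounds[OF assms, of i] by (auto simp: nearest_def one_coords_def free_coords_def)
  qed
  then show "nearest x \<subseteq> {..<n}" by (rule corners_subset[OF assms])
qed

lemma nearest_vertex [simp]: "nearest (vertex v) = v"
  by (auto simp: nearest_def vertex_def)

lemma segment_from_corner:
  assumes "x \<in> X" "u \<in> corners x"
  shows "path_in X (segment (vertex u) x)" "path_in X (segment x (vertex u))"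
proof -
  show *: "path_in X (segment x (vertex u))"
    using segment_to_corner[OF assms] by (intro path_in_segment)
  show "path_in X (segment (vertex u) x)"
    using * path_in_simps(2)[of X "segment x (vertex u)"] by simp
qed

sublocale based_sequence_space X "vertex {}" connector
proof
  note root = root_path_props[of "{}"]
  fix x assume x: "x \<in> X"
  show "path_in X (connector x)" "pathstart (connector x) = vertex {}" "pathfinish (connector x) = x"
    using root root_path_props[OF nearest_corner(2)[OF x]] segment_from_corner[OF x nearest_corner(1)[OF x]]
    by (simp_all add: connector_def)
next
  show "vertex {} \<in> X" by (simp add: vertex_in_complex)
  have r: "path_in X (root_path {})" "pathfinish (root_path {}) = vertex {}"
    using root_path_props[of "{}"] by simp_all
  have "homotopic_paths X (root_path {} +++ (\<lambda>_. vertex {})) (root_path {})"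
    using r by (intro homotopic_rid)
  then have "homotopic_paths X (connector (vertex {})) (reversepath (root_path {}) +++ root_path {})"
    using r unfolding connector_def by (intro homotopic_join path_in_refl) auto
  also have "homotopic_paths X \<dots> (\<lambda>_. vertex {})"
    using r by (intro homotopic_linv)
  finally show "homotopic_paths X (connector (vertex {})) (\<lambda>_. vertex {})" .
qed

definition edge_class :: "nat set \<Rightarrow> nat set \<Rightarrow> (real \<Rightarrow> nat \<Rightarrow> real) set" where
  "edge_class u v = loop_class (segment (vertex u) (vertex v))"

lemma connector_vertex:
  assumes "v \<subseteq> {..<n}"
  shows "homotopic_paths X (connector (vertex v)) (reversepath (root_path {}) +++ root_path v)"
proof -
  have "homotopic_paths X (root_path v +++ (\<lambda>_. vertex v)) (root_path v)"
    using root_path_props[OF assms] by (intro homotopic_rid)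
  then show ?thesis
    using root_path_props[of "{}"] root_path_props[OF assms]
    unfolding connector_def by (intro homotopic_join path_in_refl) auto
qed

text \<open>The connecting path of \<open>v\<close> and the path from the root to \<open>v\<close> that is followed here are the same up to
  the common way from the origin to the root.\<close>

lemma loop_class_root_path:
  assumes v: "v \<subseteq> {..<n}"
  shows "loop_class (root_path v) = \<one>\<^bsub>K\<^esub>"
proof -
  define s where "s = root_path {}"
  note p [simp] = root_path_props[OF v] root_path_props[of "{}", simplified, folded s_def] vertex_in_complex[OF v]
    vertex_in_complex[OF w]
  have cw: "homotopic_paths X (connector (vertex w)) (reversepath s)"
  proof -
    have "homotopic_paths X (connector (vertex w)) (reversepath s +++ (\<lambda>_. vertex w))"
      using connector_vertex[OF w] by (simp add: root_path_root s_def)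
    also have "homotopic_paths X \<dots> (reversepath s)"
      by (intro homotopic_rid) auto
    finally show ?thesis .
  qed
  have "homotopic_paths X (reversepath (connector (vertex v))) (reversepath (root_path v) +++ s)"
    using homotopic_paths_reversepath_D[OF connector_vertex[OF v]]
    by (simp add: s_def[symmetric] reversepath_joinpaths)
  then have "homotopic_paths X (connector (vertex w) +++ (root_path v +++ reversepath (connector (vertex v))))
      (reversepath s +++ (root_path v +++ (reversepath (root_path v) +++ s)))"
    using cw by (intro homotopic_join path_in_refl) auto
  also have "homotopic_paths X \<dots> (reversepath s +++ ((root_path v +++ reversepath (root_path v)) +++ s))"
    by (intro homotopic_join path_in_refl homotopic_paths_sym[OF homotopic_assoc]) auto
  also have "homotopic_paths X \<dots> (reversepath s +++ ((\<lambda>_. vertex w) +++ s))"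
    by (intro homotopic_join path_in_refl homotopic_rinv) auto
  also have "homotopic_paths X \<dots> (reversepath s +++ s)"
    by (intro homotopic_join path_in_refl homotopic_lid) auto
  also have "homotopic_paths X \<dots> (\<lambda>_. vertex {})"
    by (intro homotopic_linv) auto
  finally show ?thesis
    by (simp add: loop_class_def one_K path_class_eq_iff connector)
qed

lemma edge_class_closed [simp]: "adjacent n u v \<Longrightarrow> edge_class u v \<in> carrier K"
  by (simp add: edge_class_def edge_in_complex)

lemma edge_class_inv: "adjacent n u v \<Longrightarrow> edge_class v u = inv\<^bsub>K\<^esub> edge_class u v"
  unfolding edge_class_def using loop_class_reversepath[OF edge_in_complex, of u v] by simp

lemma edge_class_tree:
  assumes "tree_edge n w u v"
  shows "edge_class u v = \<one>\<^bsub>K\<^esub>"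
proof -
  note adj = tree_edge_adjacent[OF assms]
  have uv: "u \<subseteq> {..<n}" "v \<subseteq> {..<n}" using adjacent_subset[OF adj] by auto
  have "loop_class (root_path v) = loop_class (root_path u) \<otimes>\<^bsub>K\<^esub> edge_class u v"
    unfolding edge_class_def root_path_tree_edge[OF assms]
    using root_path_props[OF uv(1)] edge_in_complex[OF adj] by (intro loop_class_join) auto
  then show ?thesis using adj uv by (simp add: loop_class_root_path)
qed

definition corner_class :: "(nat \<Rightarrow> real) \<Rightarrow> nat set \<Rightarrow> (real \<Rightarrow> nat \<Rightarrow> real) set" where
  "corner_class x u = loop_class (segment x (vertex u))"

lemma corner_class_closed [simp]: "x \<in> X \<Longrightarrow> u \<in> corners x \<Longrightarrow> corner_class x u \<in> carrier K"
  by (simp add: corner_class_def segment_from_corner)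

text \<open>The edge classes of one face are the differences of a function on its vertices: the triangle with
  corners \<open>x\<close>, \<open>u\<close>, \<open>v\<close> lies in the face.\<close>

lemma edge_class_corners:
  assumes "x \<in> X" "u \<in> corners x" "v \<in> corners x"
  shows "edge_class u v = inv\<^bsub>K\<^esub> corner_class x u \<otimes>\<^bsub>K\<^esub> corner_class x v"
proof -
  have "edge_class u v = loop_class (segment (vertex u) x) \<otimes>\<^bsub>K\<^esub> inv\<^bsub>K\<^esub> loop_class (segment (vertex v) x)"
    using loop_class_cone[of "segment (vertex u) (vertex v)" x] triangle_in_complex[OF assms]
    by (simp add: edge_class_def)
  then show ?thesis
    using loop_class_reversepath[OF segment_from_corner(2)[OF assms(1,2)]]
      loop_class_reversepath[OF segment_from_corner(1)[OF assms(1,3)]]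
    by (simp add: corner_class_def)
qed

lemma edge_class_square:
  assumes "({i, j}, V) \<in> Fs" "i \<noteq> j" "i < n" "j < n" "V \<subseteq> {..<n}" "i \<notin> V" "j \<notin> V"
  shows "edge_class V (insert i V) \<otimes>\<^bsub>K\<^esub> edge_class (insert i V) (insert i (insert j V)) =
    edge_class V (insert j V) \<otimes>\<^bsub>K\<^esub> edge_class (insert j V) (insert i (insert j V))"
proof -
  define x where "x = face_center {i, j} V"
  have x: "x \<in> X" unfolding x_def using assms by (intro face_center_in_complex) auto
  have c: "V \<in> corners x" "insert i V \<in> corners x" "insert j V \<in> corners x" "insert i (insert j V) \<in> corners x"
    using assms by (auto simp: x_def corners_def face_center_simps)
  have "edge_class V u \<otimes>\<^bsub>K\<^esub> edge_class u v = inv\<^bsub>K\<^esub> corner_class x V \<otimes>\<^bsub>K\<^esub> corner_class x v"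
    if "u \<in> corners x" "v \<in> corners x" for u v
    using x c that edge_class_corners[OF x c(1) that(1)] edge_class_corners[OF x that(1,2)]
    by (simp add: K.cancel_middle)
  then show ?thesis using c by simp
qed

end

text \<open>If the stars of \<open>u\<close> and \<open>v\<close> have a common point in the complex, then \<open>u\<close> and \<open>v\<close> are vertices of one
  face and differ in at most two coordinates. If they are opposite vertices of a square, both ways
  around it have the same label, so any intermediate vertex \<open>z\<close> will do.\<close>

definition transition :: "('k, 'd) monoid_scheme \<Rightarrow> nat \<Rightarrow> (nat set \<Rightarrow> nat set \<Rightarrow> 'k) \<Rightarrow> nat set \<Rightarrow> nat set \<Rightarrow> 'k" where
  "transition \<Gamma> n L u v = (if u = v then \<one>\<^bsub>\<Gamma>\<^esub> else if adjacent n u v then L u v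
     else let z = (SOME z. adjacent n u z \<and> adjacent n z v) in L u z \<otimes>\<^bsub>\<Gamma>\<^esub> L z v)"

lemma corner_flip:
  assumes "u \<in> corners x" "i \<in> free_coords x"
  shows "flip i u \<in> corners x"
  using assms by (auto simp: corners_def flip_def one_coords_def free_coords_def)

lemma corners_middle:
  assumes x: "x \<in> square_complex n Fs" and uv: "u \<in> corners x" "v \<in> corners x" "u \<noteq> v" "\<not> adjacent n u v"
  shows "\<exists>z. adjacent n u z \<and> adjacent n z v"
    and "adjacent n u z \<Longrightarrow> adjacent n z v \<Longrightarrow> z \<in> corners x"
proof -
  have fin: "finite (free_coords x)" using free_coords_subset[OF x] finite_subset by blast
  have u: "u \<subseteq> {..<n}" using corners_subset[OF x uv(1)] .
  have sub: "sdiff u v \<subseteq> free_coords x"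
    using uv(1,2) by (auto simp: sdiff_def corners_def)
  have "sdiff u v \<noteq> {}" using uv(3) by (auto simp: sdiff_def)
  then obtain i where i: "i \<in> sdiff u v" by blast
  then have ix: "i \<in> free_coords x" "i < n" using sub free_coords_subset[OF x] by auto
  have "v \<noteq> flip i u" using uv(4) u ix by (auto simp: adjacent_def)
  then obtain j where j: "j \<in> sdiff u v" "j \<noteq> i"
    using i by (auto simp: set_eq_iff mem_sdiff mem_flip)
  then have jx: "j \<in> free_coords x" "j < n" using sub free_coords_subset[OF x] by auto
  have "card {i, j} = 2" using j by simp
  moreover have "card (free_coords x) \<le> 2" using x by (auto simp: square_complex_def)
  ultimately have "free_coords x = {i, j}"
    using ix jx fin by (intro card_seteq[symmetric]) auto
  then have "sdiff u v = {i, j}" using sub i j by auto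
  then have v: "v = flip j (flip i u)"
    using j(2) by (auto simp: set_eq_iff mem_sdiff mem_flip)
  then show "\<exists>z. adjacent n u z \<and> adjacent n z v"
    using u ix jx flip_subset[OF u ix(2)] by (auto simp: adjacent_def)
  show "z \<in> corners x" if z: "adjacent n u z" "adjacent n z v"
  proof -
    obtain a b where ab: "z = flip a u" "v = flip b z" using z by (auto simp: adjacent_def)
    have "a \<in> free_coords x"
    proof (rule ccontr)
      assume a: "a \<notin> free_coords x"
      then have "a \<in> u \<longleftrightarrow> a \<in> v" using sub by (auto simp: mem_sdiff)
      then have "b = a" using ab by (auto simp: mem_flip)
      then show False using ab uv(3) by simp
    qed
    then show ?thesis using ab corner_flip[OF uv(1)] by simp
  qed
qed

text \<open>A labelling that is on one face the difference of a function \<open>h\<close> has the differences of \<open>h\<close> as its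
  transitions there. This makes the cocycle condition evident.\<close>

lemma transition_eq_potential:
  assumes \<Gamma>: "group \<Gamma>" and x: "x \<in> square_complex n Fs"
    and h: "\<And>u. u \<in> corners x \<Longrightarrow> h u \<in> carrier \<Gamma>"
    and L: "\<And>u v. u \<in> corners x \<Longrightarrow> v \<in> corners x \<Longrightarrow> adjacent n u v \<Longrightarrow> L u v = inv\<^bsub>\<Gamma>\<^esub> h u \<otimes>\<^bsub>\<Gamma>\<^esub> h v"
    and uv: "u \<in> corners x" "v \<in> corners x"
  shows "transition \<Gamma> n L u v = inv\<^bsub>\<Gamma>\<^esub> h u \<otimes>\<^bsub>\<Gamma>\<^esub> h v"
proof -
  interpret \<Gamma>: group \<Gamma> by fact
  consider "u = v" | "u \<noteq> v" "adjacent n u v" | "u \<noteq> v" "\<not> adjacent n u v" by blast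
  then show ?thesis
  proof cases
    case 3
    define z where "z = (SOME z. adjacent n u z \<and> adjacent n z v)"
    have z: "adjacent n u z" "adjacent n z v"
      using someI_ex[OF corners_middle(1)[OF x uv 3]] by (simp_all add: z_def)
    then have "z \<in> corners x" using corners_middle(2)[OF x uv 3] by simp
    then have "L u z \<otimes>\<^bsub>\<Gamma>\<^esub> L z v = inv\<^bsub>\<Gamma>\<^esub> h u \<otimes>\<^bsub>\<Gamma>\<^esub> h v"
      using z L uv h by (simp add: \<Gamma>.cancel_middle)
    then show ?thesis using 3 by (simp add: transition_def Let_def z_def)
  qed (use uv h L in \<open>simp_all add: transition_def\<close>)
qed

text \<open>A labelling of the directed edges with trivial holonomy around each square in \<open>Fs\<close>.\<close>

definition flat_labelling :: "('k, 'd) monoid_scheme \<Rightarrow> nat \<Rightarrow> (nat set \<times> nat set) set \<Rightarrow> (nat set \<Rightarrow> nat set \<Rightarrow> 'k) \<Rightarrow> bool" where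
  "flat_labelling \<Gamma> n Fs L \<longleftrightarrow>
     (\<forall>u v. adjacent n u v \<longrightarrow> L u v \<in> carrier \<Gamma> \<and> L v u = inv\<^bsub>\<Gamma>\<^esub> L u v) \<and>
     (\<forall>i j V. ({i, j}, V) \<in> Fs \<and> i \<noteq> j \<and> i < n \<and> j < n \<and> V \<subseteq> {..<n} \<and> i \<notin> V \<and> j \<notin> V \<longrightarrow>
        L V (insert i V) \<otimes>\<^bsub>\<Gamma>\<^esub> L (insert i V) (insert i (insert j V)) =
        L V (insert j V) \<otimes>\<^bsub>\<Gamma>\<^esub> L (insert j V) (insert i (insert j V)))"

lemma adjacent_insert: "V \<subseteq> {..<n} \<Longrightarrow> i < n \<Longrightarrow> i \<notin> V \<Longrightarrow> adjacent n V (insert i V)"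
  by (auto simp: adjacent_def flip_def)

text \<open>On a single face a flat labelling can be integrated, starting from the lowest vertex.\<close>

lemma flat_labelling_potential:
  assumes \<Gamma>: "group \<Gamma>" and L: "flat_labelling \<Gamma> n Fs L" and x: "x \<in> square_complex n Fs"
  shows "\<exists>h. (\<forall>u\<in>corners x. h u \<in> carrier \<Gamma>) \<and>
    (\<forall>u\<in>corners x. \<forall>v\<in>corners x. adjacent n u v \<longrightarrow> L u v = inv\<^bsub>\<Gamma>\<^esub> h u \<otimes>\<^bsub>\<Gamma>\<^esub> h v)"
proof -
  interpret \<Gamma>: group \<Gamma> by fact
  define V I where "V = one_coords x" and "I = free_coords x"
  have VI: "V \<inter> I = {}" by (auto simp: V_def I_def one_coords_def free_coords_def)
  have Vn: "V \<subseteq> {..<n}" and In: "I \<subseteq> {..<n}" using one_coords_subset[OF x] free_coords_subset[OF x] by (auto simp: V_def I_def)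
  have finI: "finite I" using In finite_subset by blast
  have corners: "corners x = {u. V \<subseteq> u \<and> u \<subseteq> V \<union> I}" by (simp add: corners_def V_def I_def)
  have Lc: "L u v \<in> carrier \<Gamma>" and Li: "L v u = inv\<^bsub>\<Gamma>\<^esub> L u v" if "adjacent n u v" for u v
    using L that by (auto simp: flat_labelling_def)
  \<comment> \<open>It suffices to treat the edges that lead upwards.\<close>
  have up: "\<exists>h. (\<forall>u\<in>corners x. h u \<in> carrier \<Gamma>) \<and>
    (\<forall>u\<in>corners x. \<forall>v\<in>corners x. adjacent n u v \<longrightarrow> L u v = inv\<^bsub>\<Gamma>\<^esub> h u \<otimes>\<^bsub>\<Gamma>\<^esub> h v)"
    if hc: "\<And>u. u \<in> corners x \<Longrightarrow> h u \<in> carrier \<Gamma>"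
      and hL: "\<And>u i. u \<in> corners x \<Longrightarrow> i \<in> I \<Longrightarrow> i \<notin> u \<Longrightarrow> L u (insert i u) = inv\<^bsub>\<Gamma>\<^esub> h u \<otimes>\<^bsub>\<Gamma>\<^esub> h (insert i u)" for h
  proof (intro exI[of _ h] conjI ballI impI)
    fix u v assume uv: "u \<in> corners x" "v \<in> corners x" "adjacent n u v"
    then obtain i where i: "i < n" "v = flip i u" by (auto simp: adjacent_def)
    have iI: "i \<in> I" using uv(1,2) i by (auto simp: corners flip_def split: if_splits)
    show "L u v = inv\<^bsub>\<Gamma>\<^esub> h u \<otimes>\<^bsub>\<Gamma>\<^esub> h v"
    proof (cases "i \<in> u")
      case False
      then show ?thesis using hL[OF uv(1) iI] i by (simp add: flip_def)
    next
      case True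
      then have "i \<notin> v" "u = insert i v" using i by (auto simp: flip_def)
      then have "L v u = inv\<^bsub>\<Gamma>\<^esub> h v \<otimes>\<^bsub>\<Gamma>\<^esub> h u" using hL[OF uv(2) iI] by simp
      moreover have "L u v = inv\<^bsub>\<Gamma>\<^esub> L v u" using Li[OF adjacent_sym[OF uv(3)]] .
      ultimately show ?thesis using hc uv by (simp add: \<Gamma>.inv_mult_group)
    qed
  qed (use hc in auto)
  have "card I \<le> 1 \<or> card I = 2 \<and> (I, V) \<in> Fs" using x by (simp add: square_complex_def I_def V_def)
  then consider "I = {}" | i where "I = {i}" | i j where "I = {i, j}" "i \<noteq> j" "(I, V) \<in> Fs"
    using finI by (auto simp: card_2_iff le_Suc_eq card_1_singleton_iff)
  then show ?thesis
  proof cases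
    case 1
    then show ?thesis by (intro up[of "\<lambda>_. \<one>\<^bsub>\<Gamma>\<^esub>"]) auto
  next
    case (2 i)
    then have i: "i \<notin> V" "adjacent n V (insert i V)" using VI In Vn by (auto intro: adjacent_insert)
    define h where "h u = (if i \<in> u then L V (insert i V) else \<one>\<^bsub>\<Gamma>\<^esub>)" for u
    show ?thesis
    proof (rule up[of h])
      show "h u \<in> carrier \<Gamma>" for u using Lc[OF i(2)] by (simp add: h_def)
      fix u k assume u: "u \<in> corners x" "k \<in> I" "k \<notin> u"
      then have "k = i" "u = V" using 2 by (auto simp: corners)
      then show "L u (insert k u) = inv\<^bsub>\<Gamma>\<^esub> h u \<otimes>\<^bsub>\<Gamma>\<^esub> h (insert k u)"
        using i Lc[OF i(2)] by (simp add: h_def)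
    qed
  next
    case (3 i j)
    have ij: "i \<notin> V" "j \<notin> V" "i < n" "j < n" using 3 VI In by auto
    have adj: "adjacent n V (insert i V)" "adjacent n V (insert j V)"
      "adjacent n (insert i V) (insert i (insert j V))" "adjacent n (insert j V) (insert i (insert j V))"
      using ij Vn 3(2) adjacent_insert[of V n i] adjacent_insert[of V n j] adjacent_insert[of "insert i V" n j]
        adjacent_insert[of "insert j V" n i] by (auto simp: insert_commute)
    have sq: "L V (insert i V) \<otimes>\<^bsub>\<Gamma>\<^esub> L (insert i V) (insert i (insert j V)) =
        L V (insert j V) \<otimes>\<^bsub>\<Gamma>\<^esub> L (insert j V) (insert i (insert j V))"
      using L 3 ij Vn unfolding flat_labelling_def by blast
    define h where "h u = (if i \<in> u then if j \<in> u
        then L V (insert i V) \<otimes>\<^bsub>\<Gamma>\<^esub> L (insert i V) (insert i (insert j V)) else L V (insert i V)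
        else if j \<in> u then L V (insert j V) else \<one>\<^bsub>\<Gamma>\<^esub>)" for u
    note cl = adj[THEN Lc]
    show ?thesis
    proof (rule up[of h])
      show "h u \<in> carrier \<Gamma>" for u using cl by (simp add: h_def)
      fix u k assume u: "u \<in> corners x" "k \<in> I" "k \<notin> u"
      have "u = V \<or> u = insert i V \<or> u = insert j V \<or> u = insert i (insert j V)"
        using u(1) 3(1) by (auto simp: corners)
      then have "u = V \<and> k = i \<or> u = V \<and> k = j \<or> u = insert i V \<and> k = j \<or> u = insert j V \<and> k = i"
        using u(2,3) 3(1,2) by auto
      then show "L u (insert k u) = inv\<^bsub>\<Gamma>\<^esub> h u \<otimes>\<^bsub>\<Gamma>\<^esub> h (insert k u)"
      proof (elim disjE conjE)
        assume "u = insert i V" "k = j"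
        moreover have "inv\<^bsub>\<Gamma>\<^esub> L V (insert i V) \<otimes>\<^bsub>\<Gamma>\<^esub> (L V (insert i V) \<otimes>\<^bsub>\<Gamma>\<^esub> L (insert i V) (insert i (insert j V)))
            = L (insert i V) (insert i (insert j V))"
          using cl by (simp add: \<Gamma>.m_assoc[symmetric])
        ultimately show ?thesis
          using ij 3(2) by (simp add: h_def insert_commute)
      next
        assume "u = insert j V" "k = i"
        moreover have "inv\<^bsub>\<Gamma>\<^esub> L V (insert j V) \<otimes>\<^bsub>\<Gamma>\<^esub> (L V (insert j V) \<otimes>\<^bsub>\<Gamma>\<^esub> L (insert j V) (insert i (insert j V)))
            = L (insert j V) (insert i (insert j V))"
          using cl by (simp add: \<Gamma>.m_assoc[symmetric])
        ultimately show ?thesis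
          using ij 3(2) sq by (simp add: h_def)
      qed (use ij 3(2) cl in \<open>simp_all add: h_def\<close>)
    qed
  qed
qed

lemma cover_by_stars: "square_complex n Fs \<subseteq> (\<Union>v\<in>Pow {..<n}. star n v)"
proof
  fix x assume x: "x \<in> square_complex n Fs"
  have "one_coords x \<in> corners x" by (auto simp: corners_def)
  then show "x \<in> (\<Union>v\<in>Pow {..<n}. star n v)"
    using corners_iff_star[OF x one_coords_subset[OF x]] one_coords_subset[OF x] by blast
qed

lemma holonomy_transition:
  assumes \<Gamma>: "group \<Gamma>" and L: "flat_labelling \<Gamma> n Fs L"
  shows "holonomy \<Gamma> (square_complex n Fs) (Pow {..<n}) (star n) (transition \<Gamma> n L)"
proof -
  interpret \<Gamma>: group \<Gamma> by fact
  show ?thesis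
  proof (unfold_locales)
    show "open (star n v)" for v by (rule open_star)
    show "square_complex n Fs \<subseteq> (\<Union>v\<in>Pow {..<n}. star n v)" by (rule cover_by_stars)
  next
    fix u v x assume "u \<in> Pow {..<n}" "v \<in> Pow {..<n}" and x: "x \<in> square_complex n Fs" and "x \<in> star n u" "x \<in> star n v"
    then have uv: "u \<in> corners x" "v \<in> corners x" using corners_iff_star[OF x] by auto
    obtain h where h: "\<And>u. u \<in> corners x \<Longrightarrow> h u \<in> carrier \<Gamma>"
      "\<And>u v. u \<in> corners x \<Longrightarrow> v \<in> corners x \<Longrightarrow> adjacent n u v \<Longrightarrow> L u v = inv\<^bsub>\<Gamma>\<^esub> h u \<otimes>\<^bsub>\<Gamma>\<^esub> h v"
      using flat_labelling_potential[OF \<Gamma> L x] by blast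
    show "transition \<Gamma> n L u v \<in> carrier \<Gamma>"
      using transition_eq_potential[OF \<Gamma> x h uv] h uv by simp
  next
    fix u v w x assume "u \<in> Pow {..<n}" "v \<in> Pow {..<n}" "w \<in> Pow {..<n}" and x: "x \<in> square_complex n Fs"
      and "x \<in> star n u" "x \<in> star n v" "x \<in> star n w"
    then have uv: "u \<in> corners x" "v \<in> corners x" "w \<in> corners x" using corners_iff_star[OF x] by auto
    obtain h where h: "\<And>u. u \<in> corners x \<Longrightarrow> h u \<in> carrier \<Gamma>"
      "\<And>u v. u \<in> corners x \<Longrightarrow> v \<in> corners x \<Longrightarrow> adjacent n u v \<Longrightarrow> L u v = inv\<^bsub>\<Gamma>\<^esub> h u \<otimes>\<^bsub>\<Gamma>\<^esub> h v"
      using flat_labelling_potential[OF \<Gamma> L x] by blast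
    show "transition \<Gamma> n L u v \<otimes>\<^bsub>\<Gamma>\<^esub> transition \<Gamma> n L v w = transition \<Gamma> n L u w"
      using transition_eq_potential[OF \<Gamma> x h uv(1,2)] transition_eq_potential[OF \<Gamma> x h uv(2,3)]
        transition_eq_potential[OF \<Gamma> x h uv(1,3)] h uv by (simp add: \<Gamma>.cancel_middle)
  qed
qed

context rooted_square_complex
begin

lemma flat_edge_class: "flat_labelling K n Fs edge_class"
proof -
  have "\<forall>u v. adjacent n u v \<longrightarrow> edge_class u v \<in> carrier K \<and> edge_class v u = inv\<^bsub>K\<^esub> edge_class u v"
    by (simp add: edge_class_inv)
  then show ?thesis
    unfolding flat_labelling_def using edge_class_square by blast
qed

text \<open>Cut a loop into pieces each of which lies in the star of a vertex. The star of a vertex is a cone, so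
  a piece is homotopic to the way to the vertex and back (\<open>loop_class_cone\<close>). At a cut point \<open>x\<close> this
  leaves the way from one vertex through \<open>x\<close> to the next one, inside the face of \<open>x\<close>, which is
  homotopic to one or two edges, or constant.\<close>

theorem edge_classes_generate: "generate K {edge_class u v |u v. adjacent n u v} = carrier K"
proof
  let ?E = "generate K {edge_class u v |u v. adjacent n u v}"
  have sub: "{edge_class u v |u v. adjacent n u v} \<subseteq> carrier K" by auto
  show "?E \<subseteq> carrier K" by (rule K.generate_incl[OF sub])
  interpret E: subgroup ?E K by (rule K.generate_is_subgroup[OF sub])
  interpret holonomy K X "Pow {..<n}" "star n" "transition K n edge_class"
    by (rule holonomy_transition[OF group_K flat_edge_class])
  have trans: "inv\<^bsub>K\<^esub> corner_class x u \<otimes>\<^bsub>K\<^esub> corner_class x v \<in> ?E"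
    if x: "x \<in> X" and uv: "u \<in> corners x" "v \<in> corners x" for x u v
  proof -
    have "transition K n edge_class u v = inv\<^bsub>K\<^esub> corner_class x u \<otimes>\<^bsub>K\<^esub> corner_class x v"
      by (rule transition_eq_potential[where h = "corner_class x", OF group_K x _ _ uv])
        (use corner_class_closed[OF x] edge_class_corners[OF x] in blast)+
    moreover have "transition K n edge_class u v \<in> ?E"
    proof (cases "u = v \<or> adjacent n u v")
      case True
      then show ?thesis
        by (auto simp: transition_def intro: generate.incl generate.one)
    next
      case False
      define z where "z = (SOME z. adjacent n u z \<and> adjacent n z v)"
      have "\<exists>z. adjacent n u z \<and> adjacent n z v" using False corners_middle(1)[OF x uv] by simp
      then have "adjacent n u z" "adjacent n z v" unfolding z_def by (metis (mono_tags, lifting) someI_ex)+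
      then have "edge_class u z \<otimes>\<^bsub>K\<^esub> edge_class z v \<in> ?E"
        by (intro generate.eng generate.incl) blast+
      then show ?thesis
        using False by (simp add: transition_def Let_def z_def)
    qed
    ultimately show ?thesis by simp
  qed
  have "loop_class p \<in> ?E" if p: "path_in X p" "pathstart p = vertex {}" "pathfinish p = vertex {}" for p
  proof -
    obtain N s where s: "track p N s" using ex_track[OF p(1)] .
    have N: "N > 0" using s by (simp add: track_def)
    define y where "y j = p (real j / real N)" for j
    have y: "y j \<in> X" if "j \<le> N" for j
      using grid_point_in[OF p(1) that N] by (simp add: y_def)
    have cor: "s j \<in> corners (y j)" "s j \<in> corners (y (Suc j))" if "j < N" for j
      using track_grid_points[OF s that, folded y_def] corners_iff_star[OF y, of j "s j"]
        corners_iff_star[OF y, of "Suc j" "s j"] that by auto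
    have in01: "real j / real N \<in> {0..1}" if "j \<le> N" for j
      using that N by (auto simp: field_simps)
    have piece: "loop_class (subarc p (real j / real N) (real (Suc j) / real N)) =
        corner_class (y j) (s j) \<otimes>\<^bsub>K\<^esub> inv\<^bsub>K\<^esub> corner_class (y (Suc j)) (s j)" if j: "j < N" for j
    proof -
      define q where "q = subarc p (real j / real N) (real (Suc j) / real N)"
      have q: "path_in X q" using path_in_subarc[OF p(1) in01 in01, of j "Suc j"] j by (simp add: q_def)
      have "segment (q t) (vertex (s j)) r \<in> X" if "r \<in> {0..1}" "t \<in> {0..1}" for r t
      proof -
        have "q t \<in> path_image q" using that by (auto simp: path_image_def)
        also have "path_image q = p ` grid_step N j"
          by (simp add: q_def path_image_subarc closed_segment_eq_real_ivl divide_right_mono)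
        finally have "q t \<in> star n (s j)" "s j \<subseteq> {..<n}" using s j by (auto simp: track_def)
        moreover have "q t \<in> X" using q that by (auto simp: path_in_def path_image_def)
        ultimately show ?thesis using that corners_iff_star segment_to_corner by blast
      qed
      then have "loop_class q = loop_class (segment (pathstart q) (vertex (s j))) \<otimes>\<^bsub>K\<^esub>
          inv\<^bsub>K\<^esub> loop_class (segment (pathfinish q) (vertex (s j)))"
        using q by (intro loop_class_cone) (auto simp: path_in_def)
      then show ?thesis by (simp add: q_def corner_class_def y_def)
    qed
    have "loop_class (subarc p 0 (real (Suc k) / real N)) \<otimes>\<^bsub>K\<^esub> corner_class (y (Suc k)) (s k) \<in> ?E \<and>
        y 0 = vertex {}" if "k < N" for k
      using that
    proof (induction k)
      case 0
      have y0: "y 0 = vertex {}" using p by (simp add: y_def pathstart_def)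
      have "s 0 \<in> corners (vertex {})" using cor(1)[OF 0] y0 by simp
      then have "s 0 = {}" by (simp add: corners_def vertex_simps)
      then have "corner_class (y 0) (s 0) = \<one>\<^bsub>K\<^esub>" using y0 base_in by (simp add: corner_class_def)
      moreover have "corner_class (y (Suc 0)) (s 0) \<in> carrier K" using cor(2)[OF 0] y[of "Suc 0"] 0 by simp
      ultimately show ?case using piece[OF 0] y0 by (simp add: generate.one)
    next
      case (Suc k)
      define A where "A = loop_class (subarc p 0 (real (Suc k) / real N))"
      have j: "k < N" "Suc k < N" "Suc k \<le> N" "Suc (Suc k) \<le> N" using Suc.prems by auto
      have arcs: "path_in X (subarc p 0 (real (Suc k) / real N))"
        "path_in X (subarc p (real (Suc k) / real N) (real (Suc (Suc k)) / real N))"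
        using path_in_subarc[OF p(1), of 0] path_in_subarc[OF p(1)] in01[OF j(3)] in01[OF j(4)] by auto
      have "loop_class (subarc p 0 (real (Suc (Suc k)) / real N)) =
          loop_class (subarc p 0 (real (Suc k) / real N) +++ subarc p (real (Suc k) / real N) (real (Suc (Suc k)) / real N))"
        using in01[OF j(3)] in01[OF j(4)]
        by (intro loop_class_cong[symmetric] homotopic_join_subarcs p) auto
      also have "\<dots> = A \<otimes>\<^bsub>K\<^esub> (corner_class (y (Suc k)) (s (Suc k)) \<otimes>\<^bsub>K\<^esub> inv\<^bsub>K\<^esub> corner_class (y (Suc (Suc k))) (s (Suc k)))"
        using arcs by (simp add: loop_class_join A_def piece[OF j(2)] del: of_nat_Suc)
      finally have 1: "loop_class (subarc p 0 (real (Suc (Suc k)) / real N)) =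
          A \<otimes>\<^bsub>K\<^esub> (corner_class (y (Suc k)) (s (Suc k)) \<otimes>\<^bsub>K\<^esub> inv\<^bsub>K\<^esub> corner_class (y (Suc (Suc k))) (s (Suc k)))" .
      have A: "A \<in> carrier K" using arcs by (simp add: A_def)
      have c: "corner_class (y (Suc k)) (s (Suc k)) \<in> carrier K"
        "corner_class (y (Suc (Suc k))) (s (Suc k)) \<in> carrier K" "corner_class (y (Suc k)) (s k) \<in> carrier K"
        using cor[OF j(1)] cor[OF j(2)] y[OF j(3)] y[OF j(4)] by auto
      have "loop_class (subarc p 0 (real (Suc (Suc k)) / real N)) \<otimes>\<^bsub>K\<^esub> corner_class (y (Suc (Suc k))) (s (Suc k)) =
          A \<otimes>\<^bsub>K\<^esub> corner_class (y (Suc k)) (s (Suc k))"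
        unfolding 1 using A c by (simp add: K.m_assoc)
      also have "\<dots> = (A \<otimes>\<^bsub>K\<^esub> corner_class (y (Suc k)) (s k)) \<otimes>\<^bsub>K\<^esub>
          (inv\<^bsub>K\<^esub> corner_class (y (Suc k)) (s k) \<otimes>\<^bsub>K\<^esub> corner_class (y (Suc k)) (s (Suc k)))"
      proof -
        have "corner_class (y (Suc k)) (s k) \<otimes>\<^bsub>K\<^esub> (inv\<^bsub>K\<^esub> corner_class (y (Suc k)) (s k) \<otimes>\<^bsub>K\<^esub>
            corner_class (y (Suc k)) (s (Suc k))) = corner_class (y (Suc k)) (s (Suc k))"
          using c by (simp add: K.m_assoc[symmetric])
        then show ?thesis using A c by (simp add: K.m_assoc)
      qed
      also have "\<dots> \<in> ?E"
        using Suc.IH[OF j(1)] trans[OF y[OF j(3)] cor(2)[OF j(1)] cor(1)[OF j(2)]] by (auto simp: A_def)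
      finally show ?case using Suc.IH[OF j(1)] by blast
    qed
    from this[of "N - 1"] have *: "loop_class p \<otimes>\<^bsub>K\<^esub> corner_class (y N) (s (N - 1)) \<in> ?E"
      using N by simp
    have yN: "y N = vertex {}" using p N by (simp add: y_def pathfinish_def)
    have "s (N - 1) \<in> corners (vertex {})" using cor(2)[of "N - 1"] N yN by simp
    then have "s (N - 1) = {}" by (simp add: corners_def vertex_simps)
    then have "corner_class (y N) (s (N - 1)) = \<one>\<^bsub>K\<^esub>" using yN base_in by (simp add: corner_class_def)
    then show ?thesis using * p by simp
  qed
  then show "carrier K \<subseteq> ?E" unfolding carrier_eq_loop_classes by auto
qed

text \<open>The homomorphism sends a loop to its holonomy with respect to the transitions of \<open>L\<close>. The labels of the
  tree are trivial, so the connecting paths have trivial holonomy and the class of an edge is sent to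
  the label of the edge.\<close>

theorem edge_class_universal:
  assumes \<Gamma>: "group \<Gamma>" and L: "flat_labelling \<Gamma> n Fs L"
    and tree: "\<And>u v. tree_edge n w u v \<Longrightarrow> L u v = \<one>\<^bsub>\<Gamma>\<^esub>"
  shows "\<exists>\<phi> \<in> hom K \<Gamma>. \<forall>u v. adjacent n u v \<longrightarrow> \<phi> (edge_class u v) = L u v"
proof -
  interpret holonomy \<Gamma> X "Pow {..<n}" "star n" "transition \<Gamma> n L"
    by (rule holonomy_transition[OF \<Gamma> L])
  \<comment> \<open>A vertex lies in its own star only, so holonomies of paths between vertices are defined.\<close>
  have only: "only_in (vertex v)" if "v \<subseteq> {..<n}" for v
  proof -
    have "u = v" if "u \<subseteq> {..<n}" "vertex v \<in> star n u" for u
    proof -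
      have "u \<in> corners (vertex v)"
        using corners_iff_star[OF vertex_in_complex that(1)] \<open>v \<subseteq> {..<n}\<close> that(2) by blast
      then show ?thesis by (auto simp: corners_def vertex_simps)
    qed
    then show ?thesis using vertex_in_complex[OF that] unfolding only_in_def by blast
  qed
  have trackable: "trackable p" if "path_in X p" "pathstart p = vertex u" "pathfinish p = vertex v" "u \<subseteq> {..<n}" "v \<subseteq> {..<n}" for p u v
    using that only by (simp add: trackable_def)
  have edge: "trackable (segment (vertex u) (vertex v)) \<and> hol (segment (vertex u) (vertex v)) = L u v" if adj: "adjacent n u v" for u v
  proof -
    have uv: "u \<subseteq> {..<n}" "v \<subseteq> {..<n}" using adjacent_subset[OF adj] by auto
    have tr: "trackable (segment (vertex u) (vertex v))"
      using edge_in_complex[OF adj] uv by (intro trackable[of _ u v]) auto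
    obtain i where i: "i < n" "v = flip i u" using adj by (auto simp: adjacent_def)
    have coord: "segment (vertex u) (vertex v) t k = vertex u k" if "k \<noteq> i" for k t
    proof -
      have "vertex v k = vertex u k" using i that by (simp add: vertex_def mem_flip)
      then show ?thesis by (simp add: segment_def algebra_simps)
    qed
    have vi: "vertex v i = 1 - vertex u i" using i by (simp add: vertex_def mem_flip)
    have "hol (segment (vertex u) (vertex v)) = transition \<Gamma> n L u v"
    proof (rule hol_two_steps[OF tr])
      fix t :: real assume t: "t \<in> {0..1/2}"
      have "\<bar>segment (vertex u) (vertex v) t k - vertex u k\<bar> < 1" for k
      proof (cases "k = i")
        case True
        then show ?thesis using t vi by (auto simp: segment_def vertex_def)
      qed (simp add: coord)
      then show "segment (vertex u) (vertex v) t \<in> star n u" by (simp add: star_def)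
    next
      fix t :: real assume t: "t \<in> {1/2..1}"
      have "\<bar>segment (vertex u) (vertex v) t k - vertex v k\<bar> < 1" for k
      proof (cases "k = i")
        case True
        then show ?thesis using t vi by (auto simp: segment_def vertex_def)
      next
        case False
        then have "vertex v k = vertex u k" using i by (simp add: vertex_def mem_flip)
        with False show ?thesis by (simp add: coord)
      qed
      then show "segment (vertex u) (vertex v) t \<in> star n v" by (simp add: star_def)
    qed (use uv in auto)
    then show ?thesis using adj tr by (auto simp: transition_def)
  qed
  have *: "trackable (tree_path w D k) \<and> hol (tree_path w D k) = \<one>\<^bsub>\<Gamma>\<^esub>" if "k \<le> n" "D \<subseteq> {..<n}" for D k
    using that(1)
  proof (induction k)
    case 0
    show ?case using only[OF w] hol_const by (simp add: trackable_def vertex_in_complex[OF w])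
  next
    case (Suc k)
    show ?case
    proof (cases "k \<in> D")
      case True
      define u v where "u = sdiff w (D \<inter> {..<k})" and "v = sdiff w (D \<inter> {..<Suc k})"
      have te: "tree_edge n w u v" unfolding u_def v_def using True Suc.prems that by (intro tree_step) auto
      note e = edge[OF tree_edge_adjacent[OF te]]
      have "trackable (tree_path w D k +++ segment (vertex u) (vertex v))"
        using e Suc tree_path_props[of k D] that by (auto simp: trackable_def u_def)
      moreover have "hol (tree_path w D k +++ segment (vertex u) (vertex v)) = \<one>\<^bsub>\<Gamma>\<^esub>"
        using e Suc tree_path_props[of k D] that tree[OF te] by (subst hol_join) (auto simp: u_def)
      ultimately show ?thesis using True by (simp add: u_def v_def)
    qed (use Suc in simp)
  qed
  have root: "trackable (root_path v)" "hol (root_path v) = \<one>\<^bsub>\<Gamma>\<^esub>" if v: "v \<subseteq> {..<n}" for v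
  proof -
    have "sdiff w v \<subseteq> {..<n}" using v w by (auto simp: sdiff_def)
    with * show "trackable (root_path v)" "hol (root_path v) = \<one>\<^bsub>\<Gamma>\<^esub>"
      by (simp_all add: root_path_def)
  qed
  have conn: "trackable (connector (vertex v))" "hol (connector (vertex v)) = \<one>\<^bsub>\<Gamma>\<^esub>" if v: "v \<subseteq> {..<n}" for v
  proof -
    have c: "trackable (\<lambda>_. vertex v)" using only[OF v] by (simp add: trackable_def vertex_in_complex[OF v])
    have t: "trackable (root_path v +++ (\<lambda>_. vertex v))" "trackable (reversepath (root_path {}))"
      using root[OF v] root[of "{}"] root_path_props[OF v] c by (auto simp: trackable_def)
    show "trackable (connector (vertex v))"
      using t root_path_props[of "{}"] root_path_props[OF v] by (auto simp: connector_def trackable_def)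
    have "hol (root_path v +++ (\<lambda>_. vertex v)) = \<one>\<^bsub>\<Gamma>\<^esub>"
      using root[OF v] c root_path_props[OF v] only[OF v] by (simp add: hol_join hol_const)
    moreover have "hol (reversepath (root_path {})) = \<one>\<^bsub>\<Gamma>\<^esub>"
      using root[of "{}"] by (simp add: hol_reversepath)
    ultimately show "hol (connector (vertex v)) = \<one>\<^bsub>\<Gamma>\<^esub>"
      using t root_path_props[of "{}"] root_path_props[OF v] by (simp add: connector_def hol_join)
  qed
  have "\<exists>\<phi>. \<forall>p. path_in X p \<and> pathstart p = vertex {} \<and> pathfinish p = vertex {} \<longrightarrow> \<phi> (path_class X p) = hol p"
  proof (intro exI allI impI)
    fix p assume p: "path_in X p \<and> pathstart p = vertex {} \<and> pathfinish p = vertex {}"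
    then have "hol ` path_class X p = {hol p}"
      using hol_homotopic[OF trackable[of p "{}" "{}"]] path_in_refl[of X p] by (fastforce simp: path_class_def)
    then show "the_elem (hol ` path_class X p) = hol p" by simp
  qed
  then obtain \<phi> where \<phi>: "\<And>p. path_in X p \<Longrightarrow> pathstart p = vertex {} \<Longrightarrow> pathfinish p = vertex {} \<Longrightarrow> \<phi> (path_class X p) = hol p"
    by blast
  have "\<phi> \<in> hom K \<Gamma>"
  proof (rule homI)
    fix a b assume "a \<in> carrier K" "b \<in> carrier K"
    then obtain p q where pq: "path_in X p" "pathstart p = vertex {}" "pathfinish p = vertex {}" "a = path_class X p"
      "path_in X q" "pathstart q = vertex {}" "pathfinish q = vertex {}" "b = path_class X q"
      by (auto simp: carrier_K)
    then have "trackable p" "trackable q" using trackable[of _ "{}" "{}"] by auto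
    then show "\<phi> a \<in> carrier \<Gamma>" "\<phi> (a \<otimes>\<^bsub>K\<^esub> b) = \<phi> a \<otimes>\<^bsub>\<Gamma>\<^esub> \<phi> b"
      using pq by (simp_all add: \<phi> hol_closed mult_path_class hol_join)
  qed
  moreover have "\<phi> (edge_class u v) = L u v" if adj: "adjacent n u v" for u v
  proof -
    have uv: "u \<subseteq> {..<n}" "v \<subseteq> {..<n}" using adjacent_subset[OF adj] by auto
    have V [simp]: "vertex u \<in> X" "vertex v \<in> X" using uv vertex_in_complex by auto
    note e = edge[OF adj]
    define c where "c = reversepath (connector (vertex v))"
    have c: "trackable c" "hol c = \<one>\<^bsub>\<Gamma>\<^esub>" "pathstart c = vertex v" "pathfinish c = vertex {}"
      using conn[OF uv(2)] by (auto simp: c_def hol_reversepath trackable_def)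
    have ec: "trackable (segment (vertex u) (vertex v) +++ c)" using e c by (simp add: trackable_def)
    have Lc: "L u v \<in> carrier \<Gamma>" using L adj by (simp add: flat_labelling_def)
    have "edge_class u v = path_class X (connector (vertex u) +++ (segment (vertex u) (vertex v) +++ c))"
      by (simp add: edge_class_def loop_class_def c_def)
    also have "\<phi> \<dots> = hol (connector (vertex u) +++ (segment (vertex u) (vertex v) +++ c))"
      using conn[OF uv(1)] ec c by (intro \<phi>) (auto simp: trackable_def)
    also have "\<dots> = L u v"
      using conn[OF uv(1)] ec c e Lc by (simp add: hol_join)
    finally show ?thesis .
  qed
  ultimately show ?thesis by blast
qed

end

section \<open>A labelled cube that presents a given group\<close>

text \<open>The directions of the cube that enforces a multiplication table: one for each entry \<open>g\<close>, and four for
  each product of \<open>g\<close> and \<open>h\<close> that stays in the table.\<close>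

datatype 'a coord = Gen 'a | First 'a 'a | Second 'a 'a | Prod 'a 'a | Detour 'a 'a

text \<open>At the origin, the direction \<open>Gen b\<close> carries the label \<open>b\<close>, and \<open>First g h\<close>, \<open>Second g h\<close> and \<open>Prod g h\<close>
  carry copies of \<open>g\<close>, \<open>h\<close> and their product. The square at the origin in the directions \<open>First g h\<close> and
  \<open>Prod g h\<close> has the labels \<open>g\<close>, \<open>h\<close> one way round and the product and the unit the other way, so it
  states the product relation, provided the label \<open>h\<close> of \<open>Prod g h\<close> at the vertex \<open>{First g h}\<close> is known
  to be the same element as the label \<open>h\<close> at the origin. It cannot be carried there along the edge in
  direction \<open>First g h\<close>, whose label is \<open>g\<close>. Therefore the edge in direction \<open>Second g h\<close> is carried
  along the three other sides of a square, in directions \<open>Detour g h\<close>, \<open>First g h\<close> and again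
  \<open>Detour g h\<close>, whose labels are trivial. At the vertex
  \<open>{First g h}\<close> the square in the directions \<open>Second g h\<close> and \<open>Prod g h\<close> then compares the two.\<close>

fun gadget_label :: "('a, 'c) monoid_scheme \<Rightarrow> 'a coord set \<Rightarrow> 'a coord \<Rightarrow> 'a" where
  "gadget_label G A (Gen b) = (if A = {} then b else \<one>\<^bsub>G\<^esub>)"
| "gadget_label G A (First g h) = (if A = {} then g else \<one>\<^bsub>G\<^esub>)"
| "gadget_label G A (Second g h) =
     (if A \<in> {{}, {Detour g h}, {Detour g h, First g h}, {First g h}} then h else \<one>\<^bsub>G\<^esub>)"
| "gadget_label G A (Prod g h) =
     (if A = {} then g \<otimes>\<^bsub>G\<^esub> h else if A = {First g h} then h else \<one>\<^bsub>G\<^esub>)"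
| "gadget_label G A (Detour g h) = \<one>\<^bsub>G\<^esub>"

definition gadget_coords :: "('a, 'c) monoid_scheme \<Rightarrow> 'a set \<Rightarrow> 'a coord set" where
  "gadget_coords G B = Gen ` B \<union>
     (\<Union>(g, h)\<in>{(g, h). g \<in> B \<and> h \<in> B \<and> g \<otimes>\<^bsub>G\<^esub> h \<in> B}. {First g h, Second g h, Prod g h, Detour g h})"

lemma finite_gadget_coords: "finite B \<Longrightarrow> finite (gadget_coords G B)"
  unfolding gadget_coords_def
  by (intro finite_UnI finite_imageI finite_UN_I finite_subset[of "{(g, h). g \<in> B \<and> h \<in> B \<and> g \<otimes>\<^bsub>G\<^esub> h \<in> B}" "B \<times> B"]) auto

lemma gadget_label_in:
  assumes "x \<in> gadget_coords G B" "\<one>\<^bsub>G\<^esub> \<in> B"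
  shows "gadget_label G A x \<in> B"
  using assms by (auto simp: gadget_coords_def)

definition squares_commute :: "('k, 'd) monoid_scheme \<Rightarrow> ('x set \<Rightarrow> 'x \<Rightarrow> 'k) \<Rightarrow> 'x set \<Rightarrow> 'x \<Rightarrow> 'x \<Rightarrow> bool" where
  "squares_commute K f A x y \<longleftrightarrow> f A x \<otimes>\<^bsub>K\<^esub> f (insert x A) y = f A y \<otimes>\<^bsub>K\<^esub> f (insert y A) x"

text \<open>If all edges with trivial label are mapped to the unit and the commuting squares are respected,
  the copies of an element of \<open>B\<close> have the same image, and the images respect the multiplication table.\<close>

lemma gadget_universal:
  fixes G :: "('a, 'c) monoid_scheme" and K :: "('k, 'd) monoid_scheme"
  assumes G: "group G" and B: "B \<subseteq> carrier G" "\<one>\<^bsub>G\<^esub> \<in> B"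
    and univ: "\<And>f. f \<in> B \<rightarrow> carrier K \<Longrightarrow> f \<one>\<^bsub>G\<^esub> = \<one>\<^bsub>K\<^esub> \<Longrightarrow>
      (\<forall>g\<in>B. \<forall>h\<in>B. g \<otimes>\<^bsub>G\<^esub> h \<in> B \<longrightarrow> f (g \<otimes>\<^bsub>G\<^esub> h) = f g \<otimes>\<^bsub>K\<^esub> f h) \<Longrightarrow> \<exists>i\<in>hom G K. \<forall>b\<in>B. i b = f b"
    and K: "group K"
    and f: "\<And>A x. A \<subseteq> gadget_coords G B \<Longrightarrow> x \<in> gadget_coords G B \<Longrightarrow> x \<notin> A \<Longrightarrow> f A x \<in> carrier K"
    and f1: "\<And>A x. A \<subseteq> gadget_coords G B \<Longrightarrow> x \<in> gadget_coords G B \<Longrightarrow> x \<notin> A \<Longrightarrow>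
      gadget_label G A x = \<one>\<^bsub>G\<^esub> \<Longrightarrow> f A x = \<one>\<^bsub>K\<^esub>"
    and sq: "\<And>A x y. A \<subseteq> gadget_coords G B \<Longrightarrow> x \<in> gadget_coords G B \<Longrightarrow> y \<in> gadget_coords G B \<Longrightarrow>
      x \<notin> A \<Longrightarrow> y \<notin> A \<Longrightarrow> x \<noteq> y \<Longrightarrow> squares_commute G (gadget_label G) A x y \<Longrightarrow> squares_commute K f A x y"
  shows "\<exists>i\<in>hom G K. \<forall>A x. A \<subseteq> gadget_coords G B \<longrightarrow> x \<in> gadget_coords G B \<longrightarrow> x \<notin> A \<longrightarrow> f A x = i (gadget_label G A x)"
proof -
  interpret G: group G by fact
  interpret K: group K by fact
  define u where "u b = f {} (Gen b)" for b
  let ?U = "gadget_coords G B"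
  have gen: "Gen b \<in> ?U" if "b \<in> B" for b using that by (auto simp: gadget_coords_def)
  have u: "u b \<in> carrier K" if "b \<in> B" for b using f gen[OF that] by (simp add: u_def)
  have u1: "u \<one>\<^bsub>G\<^esub> = \<one>\<^bsub>K\<^esub>" using f1[of "{}" "Gen \<one>\<^bsub>G\<^esub>"] gen B by (simp add: u_def)
  have gadget: "f {} (First g h) = u g \<and> f {} (Second g h) = u h \<and> f {Detour g h} (Second g h) = u h \<and>
      f {Detour g h, First g h} (Second g h) = u h \<and> f {First g h} (Second g h) = u h \<and>
      f {} (Prod g h) = u (g \<otimes>\<^bsub>G\<^esub> h) \<and> f {First g h} (Prod g h) = u h \<and>
      u (g \<otimes>\<^bsub>G\<^esub> h) = u g \<otimes>\<^bsub>K\<^esub> u h"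
    if gh: "g \<in> B" "h \<in> B" "g \<otimes>\<^bsub>G\<^esub> h \<in> B" for g h
  proof -
    define l r p d where "l = First g h" and "r = Second g h" and "p = Prod g h" and "d = Detour g h"
    have U: "l \<in> ?U" "r \<in> ?U" "p \<in> ?U" "d \<in> ?U" "Gen g \<in> ?U" "Gen h \<in> ?U" "Gen (g \<otimes>\<^bsub>G\<^esub> h) \<in> ?U"
      using gh unfolding l_def r_def p_def d_def gadget_coords_def by blast+
    have car: "g \<in> carrier G" "h \<in> carrier G" using gh B by auto
    note [simp] = squares_commute_def doubleton_eq_iff
    have 1: "f {} l = u g"
      using sq[of "{}" "Gen g" l] f1[of "{Gen g}" l] f1[of "{l}" "Gen g"] U f[of "{}" l] u gh car
      by (simp add: u_def l_def)
    have 2: "f {} r = u h"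
      using sq[of "{}" "Gen h" r] f1[of "{Gen h}" r] f1[of "{r}" "Gen h"] U f[of "{}" r] u gh car
      by (simp add: u_def r_def)
    have 3: "f {} p = u (g \<otimes>\<^bsub>G\<^esub> h)"
      using sq[of "{}" "Gen (g \<otimes>\<^bsub>G\<^esub> h)" p] f1[of "{Gen (g \<otimes>\<^bsub>G\<^esub> h)}" p] f1[of "{p}" "Gen (g \<otimes>\<^bsub>G\<^esub> h)"] U f[of "{}" p] u gh car
      by (simp add: u_def p_def)
    have 4: "f {d} r = u h"
      using sq[of "{}" d r] f1[of "{}" d] f1[of "{r}" d] U f[of "{d}" r] u gh car 2
      by (simp add: r_def d_def)
    have 5: "f {d, l} r = u h"
      using sq[of "{d}" l r] f1[of "{d}" l] f1[of "{d, r}" l] U f[of "{d, l}" r] u gh car 4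
      by (simp add: r_def d_def l_def insert_commute)
    have 6: "f {l} r = u h"
      using sq[of "{l}" d r] f1[of "{l}" d] f1[of "{l, r}" d] U f[of "{l}" r] u gh car 5
      by (simp add: r_def d_def l_def insert_commute)
    have 7: "f {l} p = u h"
      using sq[of "{l}" r p] f1[of "{l, r}" p] f1[of "{l, p}" r] U f[of "{l}" p] u gh car 6
      by (simp add: r_def p_def l_def insert_commute)
    have 8: "u g \<otimes>\<^bsub>K\<^esub> u h = u (g \<otimes>\<^bsub>G\<^esub> h)"
      using sq[of "{}" l p] f1[of "{p}" l] U u gh car 1 3 7
      by (simp add: p_def l_def)
    show ?thesis using 1 2 3 4 5 6 7 8 by (simp add: l_def r_def p_def d_def)
  qed
  obtain i where i: "i \<in> hom G K" "\<And>b. b \<in> B \<Longrightarrow> i b = u b"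
    using univ[of u] u u1 gadget by blast
  have i1: "i \<one>\<^bsub>G\<^esub> = \<one>\<^bsub>K\<^esub>" using hom_one[OF i(1) G K] .
  have "f A x = i (gadget_label G A x)" if A: "A \<subseteq> ?U" "x \<in> ?U" "x \<notin> A" for A x
  proof (cases "gadget_label G A x = \<one>\<^bsub>G\<^esub>")
    case True
    then show ?thesis using f1[OF A] i1 by simp
  next
    case False
    consider b where "x = Gen b" "b \<in> B"
      | g h where "x \<in> {First g h, Second g h, Prod g h, Detour g h}" "g \<in> B" "h \<in> B" "g \<otimes>\<^bsub>G\<^esub> h \<in> B"
      using A(2) unfolding gadget_coords_def by blast
    then show ?thesis
    proof cases
      case 1
      then show ?thesis using False i(2) by (auto simp: u_def split: if_splits)
    next
      case (2 g h)
      then show ?thesis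
        using False gadget[OF 2(2-4)] i(2)[OF 2(2)] i(2)[OF 2(3)] i(2)[OF 2(4)]
        by (auto split: if_splits)
    qed
  qed
  then show ?thesis using i(1) by blast
qed

text \<open>This is the universal property, with respect to the single group \<open>K\<close>, of \<open>G\<close> as the group presented
  by the edges of the \<open>m\<close>-cube, where the squares that commute under \<open>L\<close> and the edges of the tree (those
  in a direction above all coordinates of their lower vertex) give the relations. An edge is given by
  its lower vertex \<open>V\<close> and its direction \<open>i\<close>.\<close>

definition presents :: "('a, 'c) monoid_scheme \<Rightarrow> nat \<Rightarrow> (nat set \<Rightarrow> nat \<Rightarrow> 'a) \<Rightarrow> ('k, 'd) monoid_scheme \<Rightarrow> bool" where
  "presents G m L K \<longleftrightarrow>
     (\<forall>F. (\<forall>V i. V \<subseteq> {..<m} \<and> i < m \<and> i \<notin> V \<longrightarrow> F V i \<in> carrier K) \<and>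
        (\<forall>V i. V \<subseteq> {..<i} \<and> i < m \<longrightarrow> F V i = \<one>\<^bsub>K\<^esub>) \<and>
        (\<forall>V i j. V \<subseteq> {..<m} \<and> i < m \<and> j < m \<and> i \<notin> V \<and> j \<notin> V \<and> i \<noteq> j \<and>
           squares_commute G L V i j \<longrightarrow> squares_commute K F V i j) \<longrightarrow>
        (\<exists>\<iota>\<in>hom G K. \<forall>V i. V \<subseteq> {..<m} \<and> i < m \<and> i \<notin> V \<longrightarrow> F V i = \<iota> (L V i)))"

text \<open>The gadgets need their trivially labelled edges to be mapped to the unit, but these edges contain
  cycles, so they cannot all belong to a tree. Therefore one direction \<open>t\<close>, above all others, is added.
  The bottom half of the cube has trivial labels, and with all squares present every edge in it is
  trivial. The vertical edges belong to the tree, because \<open>t\<close> is the largest direction. The top half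
  carries the labels of the gadgets. If an edge in it has trivial label, the vertical square below it
  commutes and identifies it with an edge of the bottom half.\<close>

theorem labelled_cube_exists:
  fixes G :: "('a, 'c) monoid_scheme"
  assumes "finitely_presented_group G"
  shows "\<exists>m L. (\<forall>V i. V \<subseteq> {..<m} \<and> i < m \<and> i \<notin> V \<longrightarrow> L V i \<in> carrier G) \<and>
    (\<forall>V i. V \<subseteq> {..<i} \<and> i < m \<longrightarrow> L V i = \<one>\<^bsub>G\<^esub>) \<and>
    generate G {L V i |V i. V \<subseteq> {..<m} \<and> i < m \<and> i \<notin> V} = carrier G \<and>
    (\<forall>K :: ('k, 'd) monoid_scheme. group K \<longrightarrow> presents G m L K)"
proof -
  have G: "group G" using assms by (simp add: finitely_presented_group_def)
  interpret G: group G by fact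
  obtain B where B: "finite B" "B \<subseteq> carrier G" "\<one>\<^bsub>G\<^esub> \<in> B" "generate G B = carrier G"
    and univ: "\<And>(K :: ('k, 'd) monoid_scheme) f. group K \<Longrightarrow> f \<in> B \<rightarrow> carrier K \<Longrightarrow> f \<one>\<^bsub>G\<^esub> = \<one>\<^bsub>K\<^esub> \<Longrightarrow>
      (\<forall>g\<in>B. \<forall>h\<in>B. g \<otimes>\<^bsub>G\<^esub> h \<in> B \<longrightarrow> f (g \<otimes>\<^bsub>G\<^esub> h) = f g \<otimes>\<^bsub>K\<^esub> f h) \<Longrightarrow> \<exists>i\<in>hom G K. \<forall>b\<in>B. i b = f b"
    using finite_multiplication_table[OF assms, where 'k = 'k and 'd = 'd] by blast
  define U where "U = gadget_coords G B"
  define t where "t = card U"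
  have "finite U" using B(1) by (simp add: U_def finite_gadget_coords)
  then obtain e where e: "bij_betw e U {..<t}"
    using ex_bij_betw_finite_nat[of U] by (auto simp: t_def atLeast0LessThan)
  define e' where "e' = inv_into U e"
  have e'e: "e' (e x) = x" if "x \<in> U" for x using e that by (simp add: e'_def bij_betw_def)
  have et: "e x < t" if "x \<in> U" for x using e that by (auto simp: bij_betw_def)
  have ee': "e' i \<in> U" "e (e' i) = i" if "i < t" for i
    using e that by (auto simp: e'_def bij_betw_def inv_into_into f_inv_into_f)
  have img: "e' ` (e ` A) = A" if "A \<subseteq> U" for A using that e'e by (force simp: image_image)
  define L where "L V i = (if t \<in> V \<and> i \<noteq> t then gadget_label G (e' ` (V - {t})) (e' i) else \<one>\<^bsub>G\<^esub>)" for V i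
  have Lval: "L (insert t (e ` A)) (e x) = gadget_label G A x" if "A \<subseteq> U" "x \<in> U" for A x
  proof -
    have "t \<notin> e ` A" using et that by force
    then show ?thesis using et[OF that(2)] that e'e img by (simp add: L_def)
  qed
  have L_in: "L V i \<in> B" if "V \<subseteq> {..<Suc t}" "i < Suc t" for V i
    using gadget_label_in[of "e' i" G B] ee'(1)[of i] that B(3) by (auto simp: L_def U_def)
  have upper: "\<exists>A x. A \<subseteq> U \<and> x \<in> U \<and> x \<notin> A \<and> V = insert t (e ` A) \<and> i = e x"
    if "V \<subseteq> {..<Suc t}" "i < Suc t" "i \<notin> V" "t \<in> V" "i \<noteq> t" for V i
  proof (intro exI conjI)
    have *: "V - {t} \<subseteq> {..<t}" "i < t" using that by (auto simp: less_Suc_eq)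
    show "e' ` (V - {t}) \<subseteq> U" using *(1) ee'(1) by blast
    show "e' i \<in> U" by (rule ee'(1)[OF *(2)])
    show "i = e (e' i)" by (rule ee'(2)[OF *(2), symmetric])
    have inv: "e (e' k) = k" if "k \<in> V - {t}" for k
      using that *(1) ee'(2) by blast
    then have "e ` e' ` (V - {t}) = V - {t}" by (simp add: image_image)
    then show "V = insert t (e ` e' ` (V - {t}))" using that(4) by blast
    show "e' i \<notin> e' ` (V - {t})"
    proof
      assume "e' i \<in> e' ` (V - {t})"
      then obtain k where "k \<in> V - {t}" "e' i = e' k" by blast
      then have "k = i" using inv[of k] ee'(2)[OF *(2)] by simp
      then show False using \<open>k \<in> V - {t}\<close> that(3) by blast
    qed
  qed
  show ?thesis
  proof (intro exI[of _ "Suc t"] exI[of _ L] conjI allI impI)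
    fix V i assume "V \<subseteq> {..<Suc t} \<and> i < Suc t \<and> i \<notin> V"
    then show "L V i \<in> carrier G" using L_in B(2) by blast
  next
    fix V i assume "V \<subseteq> {..<i} \<and> i < Suc t"
    then show "L V i = \<one>\<^bsub>G\<^esub>" by (auto simp: L_def)
  next
    have "b \<in> {L V i |V i. V \<subseteq> {..<Suc t} \<and> i < Suc t \<and> i \<notin> V}" if "b \<in> B" for b
    proof -
      have b: "Gen b \<in> U" using that by (auto simp: U_def gadget_coords_def)
      have "L {t} (e (Gen b)) = b" using Lval[of "{}" "Gen b"] b by simp
      then show ?thesis using et[OF b] by (intro CollectI exI[of _ "{t}"] exI[of _ "e (Gen b)"]) auto
    qed
    then have "generate G B \<subseteq> generate G {L V i |V i. V \<subseteq> {..<Suc t} \<and> i < Suc t \<and> i \<notin> V}"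
      by (intro G.mono_generate) blast
    moreover have "{L V i |V i. V \<subseteq> {..<Suc t} \<and> i < Suc t \<and> i \<notin> V} \<subseteq> carrier G"
      using L_in B(2) by blast
    ultimately show "generate G {L V i |V i. V \<subseteq> {..<Suc t} \<and> i < Suc t \<and> i \<notin> V} = carrier G"
      using B(4) G.generate_incl by blast
  next
    fix K :: "('k, 'd) monoid_scheme" assume K: "group K"
    interpret K: group K by fact
    show "presents G (Suc t) L K"
      unfolding presents_def
    proof (intro allI impI, elim conjE)
      fix F
      assume F0: "\<forall>V i. V \<subseteq> {..<Suc t} \<and> i < Suc t \<and> i \<notin> V \<longrightarrow> F V i \<in> carrier K"
        and tree0: "\<forall>V i. V \<subseteq> {..<i} \<and> i < Suc t \<longrightarrow> F V i = \<one>\<^bsub>K\<^esub>"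
        and sq0: "\<forall>V i j. V \<subseteq> {..<Suc t} \<and> i < Suc t \<and> j < Suc t \<and> i \<notin> V \<and> j \<notin> V \<and> i \<noteq> j \<and>
           squares_commute G L V i j \<longrightarrow> squares_commute K F V i j"
      have F: "F V i \<in> carrier K" if "V \<subseteq> {..<Suc t}" "i < Suc t" "i \<notin> V" for V i
        using F0 that by blast
      have tree: "F V i = \<one>\<^bsub>K\<^esub>" if "V \<subseteq> {..<i}" "i < Suc t" for V i
        using tree0 that by blast
      have sq: "F V i \<otimes>\<^bsub>K\<^esub> F (insert i V) j = F V j \<otimes>\<^bsub>K\<^esub> F (insert j V) i"
        if "V \<subseteq> {..<Suc t}" "i < Suc t" "j < Suc t" "i \<notin> V" "j \<notin> V" "i \<noteq> j"
          "L V i \<otimes>\<^bsub>G\<^esub> L (insert i V) j = L V j \<otimes>\<^bsub>G\<^esub> L (insert j V) i" for V i j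
        using sq0 that unfolding squares_commute_def by blast
      have bottom: "F V i = \<one>\<^bsub>K\<^esub>" if "V \<subseteq> {..<t}" "i < t" "i \<notin> V" for V i
        using that
      proof (induction "card V" arbitrary: V rule: less_induct)
        case less
        have finV: "finite V" using less.prems finite_subset by blast
        show ?case
        proof (cases "V \<subseteq> {..<i}")
          case True
          then show ?thesis using tree less.prems by simp
        next
          case False
          then obtain k where "k \<in> V" "\<not> k < i" by auto
          then have k: "k \<in> V" "i < k" using less.prems(3) by (auto simp: not_less le_less)
          \<comment> \<open>The other three edges of the square in directions \<open>i\<close> and \<open>j\<close> below this edge are known: one by
            induction, and the two in the larger direction \<open>j\<close> because they belong to the tree.\<close>
          define j where "j = Max V"
          have j: "j \<in> V" "i < j" "\<And>k. k \<in> V \<Longrightarrow> k \<le> j"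
          proof -
            have "V \<noteq> {}" using k by blast
            then show "j \<in> V" using Max_in[OF finV] by (simp add: j_def)
            show "k \<le> j" if "k \<in> V" for k using Max_ge[OF finV that] by (simp add: j_def)
            then show "i < j" using k by (meson less_le_trans)
          qed
          define W where "W = V - {j}"
          have W: "V = insert j W" "j \<notin> W" "W \<subseteq> {..<j}" "i \<notin> W" "W \<subseteq> {..<t}" "j < t"
            using j(1,2) less.prems by (auto simp: W_def order_less_le j(3))
          have t: "t \<notin> W" "t \<noteq> i" "t \<noteq> j" using W less.prems by auto
          have "F W i \<otimes>\<^bsub>K\<^esub> F (insert i W) j = F W j \<otimes>\<^bsub>K\<^esub> F (insert j W) i"
            using W j less.prems t by (intro sq) (auto simp: L_def)
          moreover have "F W i = \<one>\<^bsub>K\<^esub>"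
            using W less.prems less.hyps[of W] finV by (simp add: card_insert_if finite_subset)
          moreover have "F (insert i W) j = \<one>\<^bsub>K\<^esub>" "F W j = \<one>\<^bsub>K\<^esub>"
            using W j by (auto intro!: tree)
          moreover have "F (insert j W) i \<in> carrier K" using W less.prems j by (intro F) auto
          ultimately show ?thesis using W(1) by simp
        qed
      qed
      have vertical: "F V t = \<one>\<^bsub>K\<^esub>" if "V \<subseteq> {..<t}" for V using tree that by simp
      have prism: "F (insert t V) i = \<one>\<^bsub>K\<^esub>" if "V \<subseteq> {..<t}" "i < t" "i \<notin> V" "L (insert t V) i = \<one>\<^bsub>G\<^esub>" for V i
      proof -
        have "F V i \<otimes>\<^bsub>K\<^esub> F (insert i V) t = F V t \<otimes>\<^bsub>K\<^esub> F (insert t V) i"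
          using that by (intro sq) (auto simp: L_def)
        moreover have "F (insert t V) i \<in> carrier K" using that by (intro F) auto
        ultimately show ?thesis using that bottom[of V i] vertical[of V] vertical[of "insert i V"] by simp
      qed
      have eA: "e ` A \<subseteq> {..<t}" "insert t (e ` A) \<subseteq> {..<Suc t}" if "A \<subseteq> U" for A using et that by force+
      have ex: "e x \<notin> e ` A" "e x \<notin> insert t (e ` A)" if "A \<subseteq> U" "x \<in> U" "x \<notin> A" for A x
        using e that et[OF that(2)] by (auto simp: bij_betw_def inj_on_def subset_iff)
      define f where "f A x = F (insert t (e ` A)) (e x)" for A x
      have "\<exists>\<iota>\<in>hom G K. \<forall>A x. A \<subseteq> gadget_coords G B \<longrightarrow> x \<in> gadget_coords G B \<longrightarrow> x \<notin> A \<longrightarrow> f A x = \<iota> (gadget_label G A x)"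
      proof (rule gadget_universal[OF G B(2,3) univ[OF K] K]; (unfold U_def[symmetric])?)
        fix A x assume A: "A \<subseteq> U" "x \<in> U" "x \<notin> A"
        show "f A x \<in> carrier K" unfolding f_def using A eA ex et by (intro F) (auto intro: less_SucI)
        show "f A x = \<one>\<^bsub>K\<^esub>" if "gadget_label G A x = \<one>\<^bsub>G\<^esub>"
          unfolding f_def using A that eA(1)[OF A(1)] ex(1)[OF A] et[OF A(2)] Lval[OF A(1,2)] by (intro prism) auto
      next
        fix A x y assume A: "A \<subseteq> U" "x \<in> U" "y \<in> U" "x \<notin> A" "y \<notin> A" "x \<noteq> y"
          and c: "squares_commute G (gadget_label G) A x y"
        have "e x \<noteq> e y" using A e by (auto simp: bij_betw_def inj_on_def)
        have "f A x \<otimes>\<^bsub>K\<^esub> F (insert (e x) (insert t (e ` A))) (e y) = f A y \<otimes>\<^bsub>K\<^esub> F (insert (e y) (insert t (e ` A))) (e x)"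
          unfolding f_def
        proof (rule sq)
          show "insert t (e ` A) \<subseteq> {..<Suc t}" using eA A by blast
          show "e x < Suc t" "e y < Suc t" using et A by (auto intro: less_SucI)
          show "e x \<notin> insert t (e ` A)" "e y \<notin> insert t (e ` A)" using ex A by blast+
          have "insert (e x) (insert t (e ` A)) = insert t (e ` insert x A)" "insert (e y) (insert t (e ` A)) = insert t (e ` insert y A)"
            by auto
          then show "L (insert t (e ` A)) (e x) \<otimes>\<^bsub>G\<^esub> L (insert (e x) (insert t (e ` A))) (e y) =
            L (insert t (e ` A)) (e y) \<otimes>\<^bsub>G\<^esub> L (insert (e y) (insert t (e ` A))) (e x)"
            using c A Lval[of A x] Lval[of A y] Lval[of "insert x A" y] Lval[of "insert y A" x]
            by (simp add: squares_commute_def)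
        qed fact
        then show "squares_commute K f A x y"
          by (simp add: squares_commute_def f_def insert_commute)
      qed
      then obtain \<iota> where \<iota>: "\<iota> \<in> hom G K" "\<And>A x. A \<subseteq> U \<Longrightarrow> x \<in> U \<Longrightarrow> x \<notin> A \<Longrightarrow> f A x = \<iota> (gadget_label G A x)"
        unfolding U_def by blast
      have \<iota>1: "\<iota> \<one>\<^bsub>G\<^esub> = \<one>\<^bsub>K\<^esub>" using hom_one[OF \<iota>(1) G K] .
      have "F V i = \<iota> (L V i)" if Vi: "V \<subseteq> {..<Suc t}" "i < Suc t" "i \<notin> V" for V i
      proof (cases "t \<in> V \<and> i \<noteq> t")
        case True
        then obtain A x where Ax: "A \<subseteq> U" "x \<in> U" "x \<notin> A" "V = insert t (e ` A)" "i = e x"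
          using upper[OF Vi] by blast
        show ?thesis unfolding Ax(4,5) Lval[OF Ax(1,2)] using \<iota>(2)[OF Ax(1-3)] by (simp add: f_def)
      next
        case False
        then have "L V i = \<one>\<^bsub>G\<^esub>" by (auto simp: L_def)
        moreover have "F V i = \<one>\<^bsub>K\<^esub>"
        proof (cases "i = t")
          case True
          then have "V \<subseteq> {..<t}" using Vi by (auto simp: less_Suc_eq)
          then show ?thesis using vertical True by simp
        next
          case i: False
          then have "t \<notin> V" using False by blast
          then have "V \<subseteq> {..<t}" using Vi(1) by (auto simp: less_Suc_eq subset_iff)
          then show ?thesis using bottom[of V i] i Vi by simp
        qed
        ultimately show ?thesis using \<iota>1 by simp
      qed
      then show "\<exists>\<iota>\<in>hom G K. \<forall>V i. V \<subseteq> {..<Suc t} \<and> i < Suc t \<and> i \<notin> V \<longrightarrow> F V i = \<iota> (L V i)"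
        using \<iota>(1) by blast
    qed
  qed
qed

section \<open>An isolated labelled cube splits off a free factor\<close>

text \<open>The squares with an edge in the subcube through \<open>w\<close> with directions below \<open>m\<close>. Here \<open>i\<close> is the direction
  of such an edge, and its lower vertex is \<open>V\<close> or \<open>insert j V\<close>.\<close>

definition near_faces :: "nat \<Rightarrow> nat \<Rightarrow> nat set \<Rightarrow> (nat set \<times> nat set) set" where
  "near_faces n m w = {({i, j}, V) |i j V. i \<noteq> j \<and> i < m \<and> i < n \<and> j < n \<and> V \<subseteq> {..<n} \<and> i \<notin> V \<and> j \<notin> V \<and>
     (V - {..<m} = w \<or> insert j V - {..<m} = w)}"

definition patch :: "('a, 'c) monoid_scheme \<Rightarrow> nat \<Rightarrow> (nat set \<Rightarrow> nat \<Rightarrow> 'a) \<Rightarrow> nat \<Rightarrow> nat set \<Rightarrow> (nat set \<times> nat set) set" where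
  "patch G m L n w = {({i, j}, V) |i j V. i \<noteq> j \<and> i < m \<and> j < m \<and> V \<subseteq> {..<n} \<and> i \<notin> V \<and> j \<notin> V \<and>
     V - {..<m} = w \<and> squares_commute G L (V \<inter> {..<m}) i j}"

lemma squares_commute_sym: "squares_commute G L V i j \<longleftrightarrow> squares_commute G L V j i"
  by (auto simp: squares_commute_def)

lemma patch_iff:
  assumes "i \<noteq> j"
  shows "({i, j}, V) \<in> patch G m L n w \<longleftrightarrow> i < m \<and> j < m \<and> V \<subseteq> {..<n} \<and> i \<notin> V \<and> j \<notin> V \<and>
     V - {..<m} = w \<and> squares_commute G L (V \<inter> {..<m}) i j"
  using assms squares_commute_sym[of G L "V \<inter> {..<m}" i j]
  by (auto simp: patch_def doubleton_eq_iff)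

text \<open>Call an edge local if it lies in the isolated cube, and let \<open>H\<close> be the subgroup generated by the
  classes of the other edges. Since \<open>L\<close> presents \<open>G\<close>, the classes of the local edges define a
  homomorphism from \<open>G\<close> to the fundamental group, and together with the inclusion of \<open>H\<close> a
  homomorphism \<open>\<Psi>\<close> from the free product. Conversely, label the local edges by their \<open>L\<close>-labels in the
  first factor and the other edges by their classes in the second one. By isolation every square is
  either in the patch, where it commutes in \<open>G\<close>, or has no local edge, where it commutes in \<open>H\<close>
  because it does so in the fundamental group. So the labelling is flat and gives a homomorphism \<open>\<Phi>\<close>
  into the free product. Both compositions fix the generators.\<close>

theorem isolated_cube_free_factor:
  fixes G :: "('a, 'c) monoid_scheme"
  assumes G: "group G"
    and L: "\<And>V i. V \<subseteq> {..<m} \<Longrightarrow> i < m \<Longrightarrow> i \<notin> V \<Longrightarrow> L V i \<in> carrier G"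
    and L_tree: "\<And>V i. V \<subseteq> {..<i} \<Longrightarrow> i < m \<Longrightarrow> L V i = \<one>\<^bsub>G\<^esub>"
    and L_gen: "generate G {L V i |V i. V \<subseteq> {..<m} \<and> i < m \<and> i \<notin> V} = carrier G"
    and pres: "presents G m L (fundamental_group (square_complex n Fs) (vertex {}))"
    and m: "m \<le> n" and w: "w \<subseteq> {m..<n}"
    and isolated: "near_faces n m w \<inter> Fs = patch G m L n w"
  shows "free_factor G (fundamental_group (square_complex n Fs) (vertex {}))"
proof -
  interpret G: group G by fact
  have wn: "w \<subseteq> {..<n}" and wm: "w \<inter> {..<m} = {}" using w by auto
  interpret rooted_square_complex n Fs w by (rule rooted_square_complex.intro[OF wn])
  define local_edge where "local_edge u v \<longleftrightarrow> adjacent n u v \<and> u - {..<m} = w \<and> v - {..<m} = w" for u v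
  define S where "S = {edge_class u v |u v. adjacent n u v \<and> \<not> local_edge u v}"
  define H where "H = K\<lparr>carrier := generate K S\<rparr>"
  have S: "S \<subseteq> carrier K" by (auto simp: S_def)
  have subH: "subgroup (generate K S) K" by (rule K.generate_is_subgroup[OF S])
  have H: "group H" unfolding H_def by (rule K.subgroup_imp_group[OF subH])
  interpret H: group H by fact
  interpret two_groups G H by unfold_locales
  define \<Gamma> where "\<Gamma> = free_product G H"
  have \<Gamma>: "group \<Gamma>" unfolding \<Gamma>_def by (rule group_free_product)
  interpret \<Gamma>: group \<Gamma> by fact
  define inl where "inl = fp_inl G H"
  define inr where "inr = fp_inr G H"
  have inl: "inl \<in> hom G \<Gamma>" and inr: "inr \<in> hom H \<Gamma>"
    unfolding inl_def inr_def \<Gamma>_def by (rule fp_inl_hom fp_inr_hom)+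
  have inl1: "inl \<one>\<^bsub>G\<^esub> = \<one>\<^bsub>\<Gamma>\<^esub>" and inr1: "inr \<one>\<^bsub>K\<^esub> = \<one>\<^bsub>\<Gamma>\<^esub>"
    using hom_one[OF inl G \<Gamma>] hom_one[OF inr H \<Gamma>] by (simp_all add: H_def)
  have SH: "x \<in> carrier H" if "x \<in> S" for x using that by (simp add: H_def generate.incl)
  have cancel: "(V \<union> w) - {..<m} = w" "(V \<union> w) \<inter> {..<m} = V" if "V \<subseteq> {..<m}" for V
    using that wm by auto
  have local_up: "local_edge u (insert i u) \<longleftrightarrow> u \<subseteq> {..<n} \<and> i < m \<and> u - {..<m} = w" if "i \<notin> u" "i < n" for u i
  proof -
    have "insert i u - {..<m} = u - {..<m} \<longleftrightarrow> i < m" using that by auto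
    then show ?thesis
      using that adjacent_insert[of u n i] adjacent_subset[of n u "insert i u"]
      unfolding local_edge_def by blast
  qed
  have local_sym: "local_edge u v \<longleftrightarrow> local_edge v u" for u v
    unfolding local_edge_def using adjacent_sym by blast

  \<comment> \<open>The homomorphism from \<open>G\<close>: the squares of the patch are all present.\<close>
  define F where "F V i = edge_class (V \<union> w) (insert i (V \<union> w))" for V i
  have F_adj: "adjacent n (V \<union> w) (insert i (V \<union> w))" if "V \<subseteq> {..<m}" "i < m" "i \<notin> V" for V i
    using that wn wm m by (intro adjacent_insert) auto
  have "\<exists>\<iota>\<in>hom G K. \<forall>V i. V \<subseteq> {..<m} \<and> i < m \<and> i \<notin> V \<longrightarrow> F V i = \<iota> (L V i)"
  proof (rule pres[unfolded presents_def, rule_format], intro conjI allI impI; elim conjE)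
    fix V i assume "V \<subseteq> {..<m}" "i < m" "i \<notin> V"
    then show "F V i \<in> carrier K" unfolding F_def by (intro edge_class_closed F_adj)
  next
    fix V i assume Vi: "V \<subseteq> {..<i}" "i < m"
    then have "i \<notin> w" using wm by auto
    have "V \<subseteq> {..<m}" using Vi by auto
    then have "V \<subseteq> {..<n}" "V \<inter> w = {}" using m wm by auto
    have "tree_edge n w (V \<union> w) (insert i (V \<union> w))"
      unfolding tree_edge_def
    proof (intro conjI exI[of _ i])
      show "insert i (V \<union> w) = flip i (V \<union> w)" using Vi \<open>i \<notin> w\<close> by (auto simp: flip_def)
    qed (use Vi m wn \<open>V \<subseteq> {..<n}\<close> \<open>V \<inter> w = {}\<close> in \<open>auto simp: sdiff_def\<close>)
    then show "F V i = \<one>\<^bsub>K\<^esub>" unfolding F_def by (rule edge_class_tree)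
  next
    fix V i j assume V: "V \<subseteq> {..<m}" "i < m" "j < m" "i \<notin> V" "j \<notin> V" "i \<noteq> j" and c: "squares_commute G L V i j"
    have ij: "i \<notin> V \<union> w" "j \<notin> V \<union> w" "V \<union> w \<subseteq> {..<n}" using V wm wn m by auto
    then have "({i, j}, V \<union> w) \<in> patch G m L n w"
      using V c cancel[OF V(1)] by (simp add: patch_iff)
    then have "({i, j}, V \<union> w) \<in> Fs" using isolated by blast
    then show "squares_commute K F V i j"
      using edge_class_square[of i j "V \<union> w"] V ij m by (simp add: squares_commute_def F_def insert_commute)
  qed
  then obtain \<iota> where \<iota>: "\<iota> \<in> hom G K"
    "\<And>V i. V \<subseteq> {..<m} \<Longrightarrow> i < m \<Longrightarrow> i \<notin> V \<Longrightarrow> \<iota> (L V i) = edge_class (V \<union> w) (insert i (V \<union> w))"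
    unfolding F_def by metis

  have HK: "x \<in> carrier K" if "x \<in> carrier H" for x
    using that K.generate_incl[OF S] by (auto simp: H_def)
  have H_mult: "x \<otimes>\<^bsub>H\<^esub> y = x \<otimes>\<^bsub>K\<^esub> y" for x y by (simp add: H_def)
  have id: "(\<lambda>x. x) \<in> hom H K"
    by (rule homI) (simp_all add: HK H_mult)
  have "\<exists>\<Psi>\<in>hom \<Gamma> K. (\<forall>x\<in>carrier G. \<Psi> (inl x) = \<iota> x) \<and> (\<forall>y\<in>carrier H. \<Psi> (inr y) = y)"
    unfolding \<Gamma>_def inl_def inr_def by (rule free_product_hom_exists[OF group_K \<iota>(1) id])
  then obtain \<Psi> where \<Psi>: "\<Psi> \<in> hom \<Gamma> K" "\<And>x. x \<in> carrier G \<Longrightarrow> \<Psi> (inl x) = \<iota> x" "\<And>y. y \<in> carrier H \<Longrightarrow> \<Psi> (inr y) = y"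
    by (elim bexE conjE) (rule that, auto)

  define up where "up u v = inl (L (u \<inter> {..<m}) (the_elem (v - u)))" for u v
  define M where "M u v = (if local_edge u v then if u \<subseteq> v then up u v else inv\<^bsub>\<Gamma>\<^esub> up v u else inr (edge_class u v))" for u v
  have M_up: "M u (insert i u) = inl (L (u \<inter> {..<m}) i)" if "i \<notin> u" "local_edge u (insert i u)" for u i
  proof -
    have "insert i u - u = {i}" using that by auto
    then show ?thesis using that by (auto simp: M_def up_def)
  qed
  have M_nonlocal: "M u v = inr (edge_class u v)" if "\<not> local_edge u v" for u v
    using that by (simp add: M_def)
  have up_closed: "up u v \<in> carrier \<Gamma>" if loc: "local_edge u v" and sub: "u \<subseteq> v" for u v
  proof -
    obtain i where i: "i < n" "v = flip i u" "u \<subseteq> {..<n}" using loc by (auto simp: local_edge_def adjacent_def)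
    then have "i \<notin> u" "v = insert i u" using sub by (auto simp: flip_def split: if_splits)
    moreover from this have "i < m" using loc local_up i by blast
    moreover have "v - u = {i}" using calculation by auto
    ultimately show ?thesis
      unfolding up_def by (auto intro!: hom_in_carrier[OF inl] L)
  qed
  have comparable: "u \<subseteq> v \<or> v \<subseteq> u" and not_both: "\<not> (u \<subseteq> v \<and> v \<subseteq> u)" if "adjacent n u v" for u v
    using that by (auto simp: adjacent_def flip_def split: if_splits)
  have M_closed: "M u v \<in> carrier \<Gamma>" if adj: "adjacent n u v" for u v
  proof (cases "local_edge u v")
    case True
    then show ?thesis
      using up_closed[of u v] up_closed[of v u] comparable[OF adj] local_sym[of u v] by (auto simp: M_def)
  next
    case False
    then have "edge_class u v \<in> S" using adj by (auto simp: S_def)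
    then show ?thesis using False hom_in_carrier[OF inr SH] by (simp add: M_def)
  qed
  have M_inv: "M v u = inv\<^bsub>\<Gamma>\<^esub> M u v" if adj: "adjacent n u v" for u v
  proof (cases "local_edge u v")
    case True
    then show ?thesis
      using up_closed[of u v] up_closed[of v u] comparable[OF adj] not_both[OF adj] local_sym[of u v] by (auto simp: M_def)
  next
    case False
    then have uv: "edge_class u v \<in> S" using adj by (auto simp: S_def)
    interpret inr: group_hom H \<Gamma> inr by (intro group_hom.intro group_hom_axioms.intro H \<Gamma> inr)
    have "inv\<^bsub>K\<^esub> edge_class u v = inv\<^bsub>H\<^esub> edge_class u v"
      using K.m_inv_consistent[OF subH generate.incl[OF uv]] by (simp add: H_def)
    then show ?thesis
      using False local_sym[of u v] inr.hom_inv[OF SH[OF uv]] by (simp add: M_def edge_class_inv[OF adj])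
  qed
  have M_square: "M V (insert i V) \<otimes>\<^bsub>\<Gamma>\<^esub> M (insert i V) (insert i (insert j V)) =
      M V (insert j V) \<otimes>\<^bsub>\<Gamma>\<^esub> M (insert j V) (insert i (insert j V))"
    if f: "({i, j}, V) \<in> Fs" and ij: "i \<noteq> j" "i < n" "j < n" "V \<subseteq> {..<n}" "i \<notin> V" "j \<notin> V" for i j V
  proof (cases "({i, j}, V) \<in> near_faces n m w")
    case True
    then have "({i, j}, V) \<in> patch G m L n w" using f isolated by blast
    then have p: "i < m" "j < m" "V - {..<m} = w" "squares_commute G L (V \<inter> {..<m}) i j"
      using ij by (auto simp: patch_iff)
    have e: "local_edge V (insert i V)" "local_edge V (insert j V)"
      "local_edge (insert i V) (insert j (insert i V))" "local_edge (insert j V) (insert i (insert j V))"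
      using local_up[of i V] local_up[of j V] local_up[of j "insert i V"] local_up[of i "insert j V"] ij p by auto
    have c: "insert i V \<inter> {..<m} = insert i (V \<inter> {..<m})" "insert j V \<inter> {..<m} = insert j (V \<inter> {..<m})"
      using p by auto
    have Lc: "L (V \<inter> {..<m}) i \<in> carrier G" "L (V \<inter> {..<m}) j \<in> carrier G"
      "L (insert i (V \<inter> {..<m})) j \<in> carrier G" "L (insert j (V \<inter> {..<m})) i \<in> carrier G"
      using ij p by (auto intro!: L)
    have "M V (insert i V) \<otimes>\<^bsub>\<Gamma>\<^esub> M (insert i V) (insert j (insert i V)) =
        inl (L (V \<inter> {..<m}) i \<otimes>\<^bsub>G\<^esub> L (insert i (V \<inter> {..<m})) j)"
      using e ij Lc by (simp add: M_up c hom_mult[OF inl])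
    also have "\<dots> = inl (L (V \<inter> {..<m}) j \<otimes>\<^bsub>G\<^esub> L (insert j (V \<inter> {..<m})) i)"
      using p(4) by (simp add: squares_commute_def)
    also have "\<dots> = M V (insert j V) \<otimes>\<^bsub>\<Gamma>\<^esub> M (insert j V) (insert i (insert j V))"
      using e ij Lc by (simp add: M_up c hom_mult[OF inl])
    finally show ?thesis by (simp add: insert_commute)
  next
    case False
    have "({i, j}, V) = ({j, i}, V)" by auto
    with False have far: "\<not> (i < m \<and> (V - {..<m} = w \<or> insert j V - {..<m} = w))"
      "\<not> (j < m \<and> (V - {..<m} = w \<or> insert i V - {..<m} = w))"
      using ij unfolding near_faces_def by blast+
    have e: "\<not> local_edge V (insert i V)" "\<not> local_edge V (insert j V)"
      "\<not> local_edge (insert i V) (insert j (insert i V))" "\<not> local_edge (insert j V) (insert i (insert j V))"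
      using local_up[of i V] local_up[of j V] local_up[of j "insert i V"] local_up[of i "insert j V"] ij far by auto
    have adj: "adjacent n V (insert i V)" "adjacent n V (insert j V)"
      "adjacent n (insert i V) (insert j (insert i V))" "adjacent n (insert j V) (insert i (insert j V))"
      using ij by (auto intro!: adjacent_insert)
    have inS: "edge_class V (insert i V) \<in> S" "edge_class V (insert j V) \<in> S"
      "edge_class (insert i V) (insert j (insert i V)) \<in> S" "edge_class (insert j V) (insert i (insert j V)) \<in> S"
      unfolding S_def using e adj by blast+
    have mult: "inr x \<otimes>\<^bsub>\<Gamma>\<^esub> inr y = inr (x \<otimes>\<^bsub>K\<^esub> y)" if "x \<in> S" "y \<in> S" for x y
      using hom_mult[OF inr SH[OF that(1)] SH[OF that(2)]] by (simp add: H_def)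
    have "M V (insert i V) \<otimes>\<^bsub>\<Gamma>\<^esub> M (insert i V) (insert j (insert i V)) =
        inr (edge_class V (insert i V) \<otimes>\<^bsub>K\<^esub> edge_class (insert i V) (insert j (insert i V)))"
      using e inS by (simp add: M_nonlocal mult)
    also have "\<dots> = inr (edge_class V (insert j V) \<otimes>\<^bsub>K\<^esub> edge_class (insert j V) (insert i (insert j V)))"
      using edge_class_square[OF f ij] by (simp add: insert_commute)
    also have "\<dots> = M V (insert j V) \<otimes>\<^bsub>\<Gamma>\<^esub> M (insert j V) (insert i (insert j V))"
      using e inS by (simp add: M_nonlocal mult)
    finally show ?thesis by (simp add: insert_commute)
  qed
  have flat: "flat_labelling \<Gamma> n Fs M"
    unfolding flat_labelling_def using M_closed M_inv M_square by blast
  have tree: "M u v = \<one>\<^bsub>\<Gamma>\<^esub>" if te: "tree_edge n w u v" for u v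
  proof (cases "local_edge u v")
    case True
    obtain i where i: "i < n" "v = flip i u" "sdiff w u \<subseteq> {..<i}" "u \<subseteq> {..<n}"
      using te by (auto simp: tree_edge_def)
    have "i < m"
    proof (rule ccontr)
      assume "\<not> i < m"
      then have "i \<in> u - {..<m} \<longleftrightarrow> i \<notin> v - {..<m}" using i by (auto simp: mem_flip)
      then show False using True by (auto simp: local_edge_def)
    qed
    then have "i \<notin> w" using wm by auto
    then have "i \<notin> u" using i(3) by (auto simp: sdiff_def)
    then have v: "v = insert i u" using i by (simp add: flip_def)
    have "u \<inter> {..<m} \<subseteq> {..<i}"
    proof
      fix k assume "k \<in> u \<inter> {..<m}"
      then have "k \<in> sdiff w u" using wm by (auto simp: sdiff_def)
      then show "k \<in> {..<i}" using i(3) by blast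
    qed
    then show ?thesis using M_up[of i u] True v \<open>i \<notin> u\<close> L_tree \<open>i < m\<close> inl1 by simp
  next
    case False
    then show ?thesis using edge_class_tree[OF te] inr1 by (simp add: M_def)
  qed
  obtain \<Phi> where \<Phi>: "\<Phi> \<in> hom K \<Gamma>" "\<And>u v. adjacent n u v \<Longrightarrow> \<Phi> (edge_class u v) = M u v"
    using edge_class_universal[OF \<Gamma> flat tree] by blast

  have \<Phi>\<Psi>: "\<Phi> (\<Psi> z) = z" if z: "z \<in> carrier \<Gamma>" for z
  proof -
    have comp: "\<Phi> \<circ> \<Psi> \<in> hom \<Gamma> \<Gamma>" by (rule hom_compose[OF \<Psi>(1) \<Phi>(1)])
    have on_G: "(\<Phi> \<circ> \<Psi>) (inl x) = inl x" if x: "x \<in> carrier G" for x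
    proof -
      have "(\<Phi> \<circ> \<iota>) x = inl x"
      proof (rule hom_eq_on_generate[OF G \<Gamma> hom_compose[OF \<iota>(1) \<Phi>(1)] inl])
        show "{L V i |V i. V \<subseteq> {..<m} \<and> i < m \<and> i \<notin> V} \<subseteq> carrier G" using L by blast
        show "x \<in> generate G {L V i |V i. V \<subseteq> {..<m} \<and> i < m \<and> i \<notin> V}" using x L_gen by simp
        fix y assume "y \<in> {L V i |V i. V \<subseteq> {..<m} \<and> i < m \<and> i \<notin> V}"
        then obtain V i where V: "V \<subseteq> {..<m}" "i < m" "i \<notin> V" "y = L V i" by blast
        have "i \<notin> V \<union> w" "i < n" "V \<union> w \<subseteq> {..<n}" using V wm wn m by auto
        then have "local_edge (V \<union> w) (insert i (V \<union> w))"
          using local_up[of i "V \<union> w"] V cancel[OF V(1)] by simp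
        then have "M (V \<union> w) (insert i (V \<union> w)) = inl (L V i)"
          using M_up[OF \<open>i \<notin> V \<union> w\<close>] cancel[OF V(1)] by simp
        then show "(\<Phi> \<circ> \<iota>) y = inl y"
          using V \<iota>(2)[OF V(1-3)] \<Phi>(2)[OF F_adj[OF V(1-3)]] by simp
      qed
      then show ?thesis using \<Psi>(2)[OF x] by simp
    qed
    have on_H: "(\<Phi> \<circ> \<Psi>) (inr y) = inr y" if y: "y \<in> carrier H" for y
    proof -
      have \<Phi>H: "\<Phi> \<in> hom H \<Gamma>"
        by (rule homI) (simp_all add: HK H_mult hom_in_carrier[OF \<Phi>(1)] hom_mult[OF \<Phi>(1)])
      have yS: "y \<in> generate H S"
        using y K.generate_consistent[OF _ subH, of S] by (auto simp: H_def intro: generate.incl)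
      have "\<Phi> y = inr y"
      proof (rule hom_eq_on_generate[OF H \<Gamma> \<Phi>H inr _ _ yS])
        show "S \<subseteq> carrier H" using SH by blast
        fix s assume "s \<in> S"
        then show "\<Phi> s = inr s" using \<Phi>(2) by (auto simp: S_def M_def)
      qed
      then show ?thesis using \<Psi>(3)[OF y] by simp
    qed
    have "(\<Phi> \<circ> \<Psi>) z = (\<lambda>x. x) z"
    proof (rule free_product_hom_eqI[OF \<Gamma>])
      show "\<Phi> \<circ> \<Psi> \<in> hom (free_product G H) \<Gamma>" using comp by (simp add: \<Gamma>_def)
      show "(\<lambda>x. x) \<in> hom (free_product G H) \<Gamma>" by (simp add: \<Gamma>_def hom_def)
      show "z \<in> carrier (free_product G H)" using z by (simp add: \<Gamma>_def)
    qed (use on_G on_H in \<open>simp_all add: inl_def inr_def\<close>)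
    then show ?thesis by simp
  qed
  have \<Psi>\<Phi>: "\<Psi> (\<Phi> k) = k" if k: "k \<in> carrier K" for k
  proof -
    have "(\<Psi> \<circ> \<Phi>) k = (\<lambda>x. x) k"
    proof (rule hom_eq_on_generate[OF group_K group_K hom_compose[OF \<Phi>(1) \<Psi>(1)]])
      show "(\<lambda>x. x) \<in> hom K K" by (simp add: hom_def)
      show "{edge_class u v |u v. adjacent n u v} \<subseteq> carrier K" by auto
      show "k \<in> generate K {edge_class u v |u v. adjacent n u v}" using k edge_classes_generate by simp
      have up_case: "\<Psi> (M u v) = edge_class u v" if adj: "adjacent n u v" and loc: "local_edge u v" and sub: "u \<subseteq> v" for u v
      proof -
        obtain i where i: "i < n" "v = flip i u" "u \<subseteq> {..<n}" using adj by (auto simp: adjacent_def)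
        then have iu: "i \<notin> u" "v = insert i u" using sub by (auto simp: flip_def split: if_splits)
        then have im: "i < m" "u - {..<m} = w" using loc local_up i by blast+
        have u: "(u \<inter> {..<m}) \<union> w = u" using im by auto
        have "\<Psi> (M u v) = \<iota> (L (u \<inter> {..<m}) i)"
          using M_up[OF iu(1)] loc iu im \<Psi>(2) L[of "u \<inter> {..<m}" i] by simp
        also have "\<dots> = edge_class u v"
          using \<iota>(2)[of "u \<inter> {..<m}" i] iu im u by simp
        finally show ?thesis .
      qed
      fix y assume "y \<in> {edge_class u v |u v. adjacent n u v}"
      then obtain u v where uv: "adjacent n u v" "y = edge_class u v" by blast
      have "\<Psi> (M u v) = edge_class u v"
      proof (cases "local_edge u v")
        case False
        then have "edge_class u v \<in> S" using uv by (auto simp: S_def)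
        then show ?thesis using False \<Psi>(3)[OF SH] by (simp add: M_def)
      next
        case True
        show ?thesis
        proof (cases "u \<subseteq> v")
          case sub: True
          then show ?thesis using up_case uv True by simp
        next
          case False
          then have vu: "v \<subseteq> u" "local_edge v u" "adjacent n v u"
            using comparable uv True local_sym adjacent_sym by blast+
          interpret \<Psi>: group_hom \<Gamma> K \<Psi> by (intro group_hom.intro group_hom_axioms.intro \<Gamma> group_K \<Psi>)
          have "\<Psi> (M u v) = inv\<^bsub>K\<^esub> \<Psi> (M v u)"
            using M_inv[OF vu(3)] M_closed[OF vu(3)] by simp
          also have "\<dots> = edge_class u v"
            using up_case[OF vu(3,2,1)] edge_class_inv[OF vu(3)] by simp
          finally show ?thesis .
        qed
      qed
      then show "(\<Psi> \<circ> \<Phi>) y = y" using uv \<Phi>(2) by simp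
    qed
    then show ?thesis by simp
  qed
  have "bij_betw \<Phi> (carrier K) (carrier \<Gamma>)"
    using \<Phi>\<Psi> \<Psi>\<Phi> hom_in_carrier[OF \<Phi>(1)] hom_in_carrier[OF \<Psi>(1)]
    by (intro bij_betw_byWitness[where f' = \<Psi>]) auto
  then have "K \<cong> free_product G H"
    using \<Phi>(1) unfolding \<Gamma>_def by (intro is_isoI isoI)
  then show ?thesis unfolding free_factor_def using H by blast
qed

section \<open>An isolated cube occurs with high probability\<close>

lemma prob_pair_pmf_Times:
  "measure_pmf.prob (pair_pmf M N) (A \<times> B) = measure_pmf.prob M A * measure_pmf.prob N B"
proof -
  have "emeasure (measure_pmf (pair_pmf M N)) (A \<times> B) = (\<integral>\<^sup>+z. indicator (A \<times> B) z \<partial>measure_pmf (pair_pmf M N))"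
    by simp
  also have "\<dots> = (\<integral>\<^sup>+a. \<integral>\<^sup>+b. indicator A a * indicator B b \<partial>measure_pmf N \<partial>measure_pmf M)"
    by (simp add: nn_integral_pair_pmf' indicator_times)
  also have "\<dots> = emeasure (measure_pmf M) A * emeasure (measure_pmf N) B"
    by (simp add: nn_integral_cmult nn_integral_multc)
  finally show ?thesis
    by (simp add: measure_pmf.emeasure_eq_measure ennreal_mult[symmetric])
qed

text \<open>Prescriptions of the random bits on disjoint sets are fulfilled independently; the random function
  on \<open>E\<close> is split into its restriction to one of the sets and the rest.\<close>

lemma prob_all_prescriptions_fail:
  fixes W :: "'w set" and E :: "'e set"
  assumes W: "finite W" and E: "finite E" and A: "\<And>w. w \<in> W \<Longrightarrow> A w \<subseteq> E"
    and disj: "disjoint_family_on A W"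
    and q: "\<And>w. w \<in> W \<Longrightarrow> q \<le> (\<Prod>e\<in>A w. pmf (P e) (b w e))" and q01: "q \<le> 1"
  shows "measure_pmf.prob (Pi_pmf E d P) {\<omega>. \<forall>w\<in>W. \<exists>e\<in>A w. \<omega> e \<noteq> b w e} \<le> (1 - q) ^ card W"
  using W E A disj q
proof (induction W arbitrary: E rule: finite_induct)
  case empty
  then show ?case by simp
next
  case (insert w W)
  let ?N = "\<lambda>W. {\<omega>. \<forall>w\<in>W. \<exists>e\<in>A w. \<omega> e \<noteq> b w e}"
  define E' where "E' = E - A w"
  have AE: "A w \<subseteq> E" using insert.prems(2)[of w] by simp
  have fin: "finite (A w)" "finite E'"
    using finite_subset[OF AE insert.prems(1)] insert.prems(1) by (simp_all add: E'_def)
  have E: "E = A w \<union> E'" "A w \<inter> E' = {}" using AE by (auto simp: E'_def)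
  have sub: "A v \<subseteq> E'" if "v \<in> W" for v
  proof -
    have "v \<noteq> w" using that insert.hyps(2) by blast
    then have "A v \<inter> A w = {}" using that by (intro disjoint_family_onD[OF insert.prems(3)]) auto
    moreover have "A v \<subseteq> E" using that insert.prems(2)[of v] by simp
    ultimately show ?thesis unfolding E'_def by blast
  qed
  have N1: "measure_pmf.prob (Pi_pmf (A w) d P) (?N {w}) \<le> 1 - q"
  proof -
    have "?N {w} = space (measure_pmf (Pi_pmf (A w) d P)) - Pi (A w) (\<lambda>e. {b w e})"
      by (auto simp: Pi_iff)
    then have "measure_pmf.prob (Pi_pmf (A w) d P) (?N {w}) = 1 - measure_pmf.prob (Pi_pmf (A w) d P) (Pi (A w) (\<lambda>e. {b w e}))"
      using measure_pmf.prob_compl[of "Pi (A w) (\<lambda>e. {b w e})" "Pi_pmf (A w) d P"] by simp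
    also have "measure_pmf.prob (Pi_pmf (A w) d P) (Pi (A w) (\<lambda>e. {b w e})) = (\<Prod>e\<in>A w. pmf (P e) (b w e))"
      using fin by (simp add: measure_Pi_pmf_Pi measure_pmf_single)
    finally show ?thesis using insert.prems(4)[of w] by simp
  qed
  have N2: "measure_pmf.prob (Pi_pmf E' d P) (?N W) \<le> (1 - q) ^ card W"
    using insert.prems sub fin by (intro insert.IH) (auto simp: disjoint_family_on_def)
  let ?h = "\<lambda>(f, g) x. if x \<in> A w then f x else g x"
  have "measure_pmf.prob (Pi_pmf E d P) (?N (insert w W)) =
      measure_pmf.prob (pair_pmf (Pi_pmf (A w) d P) (Pi_pmf E' d P)) (?h -` ?N (insert w W))"
    unfolding E(1) Pi_pmf_union[OF fin E(2)] by simp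
  also have "?h -` ?N (insert w W) = ?N {w} \<times> ?N W"
  proof -
    have "e \<notin> A w" if "v \<in> W" "e \<in> A v" for v e
      using sub[OF that(1)] that(2) E(2) by blast
    then show ?thesis by auto
  qed
  also have "measure_pmf.prob (pair_pmf (Pi_pmf (A w) d P) (Pi_pmf E' d P)) \<dots> \<le> (1 - q) * (1 - q) ^ card W"
    unfolding prob_pair_pmf_Times using N1 N2 q01 by (intro mult_mono) auto
  finally show ?case using insert.hyps by simp
qed

lemma face_center_in_cube_face: "I \<inter> V = {} \<Longrightarrow> face_center I V \<in> cube_face I V"
  by (auto simp: face_center_def cube_face_def)

text \<open>The random bits are indexed by faces as sets of points, so different pairs \<open>(I, V)\<close> must give
  different faces in order to have independent bits.\<close>

lemma cube_face_inj:
  assumes "cube_face I V = cube_face I' V'" "I \<inter> V = {}" "I' \<inter> V' = {}"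
  shows "I = I' \<and> V = V'"
proof -
  have sub: "I \<subseteq> I' \<and> V \<subseteq> I' \<union> V'" if eq: "cube_face I V = cube_face I' V'" "I \<inter> V = {}" for I V I' V' :: "nat set"
  proof -
    have c: "face_center I V \<in> cube_face I' V'" using face_center_in_cube_face[OF that(2)] that(1) by simp
    have "i \<in> I'" if "i \<in> I" for i
    proof (rule ccontr)
      assume "i \<notin> I'"
      then have "face_center I V i = 0 \<or> face_center I V i = 1" using c by (auto simp: cube_face_def)
      then show False using that by (simp add: face_center_def)
    qed
    moreover have "i \<in> I' \<union> V'" if i: "i \<in> V" for i
    proof (rule ccontr)
      assume "i \<notin> I' \<union> V'"
      then have "face_center I V i = 0" using c by (auto simp: cube_face_def)
      then show False using i eq(2) by (auto simp: face_center_def split: if_splits)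
    qed
    ultimately show ?thesis by blast
  qed
  from sub[OF assms(1,2)] sub[OF assms(1)[symmetric] assms(3)] assms(2,3) show ?thesis by blast
qed

definition chosen_squares :: "nat \<Rightarrow> ((nat \<Rightarrow> real) set \<Rightarrow> bool) \<Rightarrow> (nat set \<times> nat set) set" where
  "chosen_squares n \<omega> = {(I, V). card I = 2 \<and> I \<union> V \<subseteq> {..<n} \<and> I \<inter> V = {} \<and> \<omega> (cube_face I V)}"

lemma cube_face_own:
  assumes "\<And>i. 0 \<le> x i \<and> x i \<le> (1 :: real)"
  shows "x \<in> cube_face (free_coords x) (one_coords x)"
proof -
  have "x i = 0" if "i \<notin> free_coords x \<union> one_coords x" for i
    using that assms[of i] by (auto simp: free_coords_def one_coords_def)
  then show ?thesis using assms by (auto simp: cube_face_def free_coords_def one_coords_def)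
qed

lemma cube_face_coords:
  assumes "x \<in> cube_face I V" "I \<inter> V = {}"
  shows "free_coords x \<subseteq> I" "0 \<le> x i \<and> x i \<le> 1" "free_coords x = I \<Longrightarrow> one_coords x = V"
proof -
  have val: "j \<in> I \<and> 0 \<le> x j \<and> x j \<le> 1 \<or> j \<notin> I \<and> j \<in> V \<and> x j = 1 \<or> j \<notin> I \<and> j \<notin> V \<and> x j = 0" for j
    using assms unfolding cube_face_def by (cases "j \<in> I"; cases "j \<in> V") auto
  show "0 \<le> x i \<and> x i \<le> 1" using val[of i] by auto
  show "free_coords x \<subseteq> I"
  proof
    show "j \<in> I" if "j \<in> free_coords x" for j using that val[of j] by (auto simp: free_coords_def)
  qed
  show "one_coords x = V" if "free_coords x = I"
  proof -
    have "j \<in> one_coords x \<longleftrightarrow> j \<in> V" for j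
      using val[of j] that assms(2) by (auto simp: one_coords_def free_coords_def)
    then show ?thesis by blast
  qed
qed

lemma union_of_faces:
  "\<Union>(cube_skeleton n 1 \<union> {F \<in> cube_faces n 2. \<omega> F}) = square_complex n (chosen_squares n \<omega>)"
proof (intro equalityI subsetI)
  fix x assume "x \<in> \<Union>(cube_skeleton n 1 \<union> {F \<in> cube_faces n 2. \<omega> F})"
  then obtain I V where IV: "I \<union> V \<subseteq> {..<n}" "I \<inter> V = {}" "x \<in> cube_face I V"
    "card I \<le> 1 \<or> card I = 2 \<and> \<omega> (cube_face I V)"
    by (auto simp: cube_skeleton_def cube_faces_def)
  note c = cube_face_coords[OF IV(3,2)]
  have finI: "finite I" using IV(1) finite_subset by blast
  have zero: "\<forall>i\<ge>n. x i = 0"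
  proof (intro allI impI)
    fix i assume "n \<le> i"
    then have "i \<notin> I \<union> V" using IV(1) by auto
    then show "x i = 0" using IV(3) by (simp add: cube_face_def)
  qed
  have "card (free_coords x) \<le> 1 \<or> card (free_coords x) = 2 \<and> (free_coords x, one_coords x) \<in> chosen_squares n \<omega>"
  proof (cases "free_coords x = I")
    case True
    then show ?thesis using IV c(3) by (auto simp: chosen_squares_def)
  next
    case False
    then have "card (free_coords x) < card I" using c(1) finI by (intro psubset_card_mono) auto
    then show ?thesis using IV(4) by linarith
  qed
  then show "x \<in> square_complex n (chosen_squares n \<omega>)"
    using c(2) zero by (simp add: square_complex_def)
next
  fix x assume x: "x \<in> square_complex n (chosen_squares n \<omega>)"
  define I V where "I = free_coords x" and "V = one_coords x"
  have sub: "I \<union> V \<subseteq> {..<n}" "I \<inter> V = {}"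
    using free_coords_subset[OF x] one_coords_subset[OF x] by (auto simp: I_def V_def free_coords_def one_coords_def)
  have xF: "x \<in> cube_face I V" unfolding I_def V_def by (intro cube_face_own coord_bounds[OF x])
  have "card I \<le> 1 \<or> card I = 2 \<and> (I, V) \<in> chosen_squares n \<omega>" using x by (simp add: square_complex_def I_def V_def)
  then show "x \<in> \<Union>(cube_skeleton n 1 \<union> {F \<in> cube_faces n 2. \<omega> F})"
  proof
    assume "card I \<le> 1"
    then have "cube_face I V \<in> cube_skeleton n 1" using sub by (auto simp: cube_skeleton_def cube_faces_def)
    then show ?thesis using xF by blast
  next
    assume "card I = 2 \<and> (I, V) \<in> chosen_squares n \<omega>"
    then have "cube_face I V \<in> {F \<in> cube_faces n 2. \<omega> F}" using sub by (auto simp: chosen_squares_def cube_faces_def)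
    then show ?thesis using xF by blast
  qed
qed

lemma finite_cube_faces: "finite (cube_faces n k)"
proof -
  have "cube_faces n k \<subseteq> (\<lambda>(I, V). cube_face I V) ` (Pow {..<n} \<times> Pow {..<n})"
    by (auto simp: cube_faces_def)
  then show ?thesis by (rule finite_subset) auto
qed

lemma near_faces_subset:
  assumes "(I, V) \<in> near_faces n m w"
  shows "card I = 2" "I \<union> V \<subseteq> {..<n}" "I \<inter> V = {}" "cube_face I V \<in> cube_faces n 2"
proof -
  obtain i j where "I = {i, j}" "i \<noteq> j" "i < n" "j < n" "V \<subseteq> {..<n}" "i \<notin> V" "j \<notin> V"
    using assms unfolding near_faces_def by blast
  then show *: "card I = 2" "I \<union> V \<subseteq> {..<n}" "I \<inter> V = {}" by auto
  then show "cube_face I V \<in> cube_faces n 2" unfolding cube_faces_def by blast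
qed

lemma patch_subset_near_faces:
  assumes "m \<le> n"
  shows "patch G m L n w \<subseteq> near_faces n m w"
proof
  fix z assume "z \<in> patch G m L n w"
  then obtain i j V where z: "z = ({i, j}, V)" "i \<noteq> j" "i < m" "j < m" "V \<subseteq> {..<n}" "i \<notin> V" "j \<notin> V" "V - {..<m} = w"
    unfolding patch_def by blast
  then have "i < n" "j < n" using assms by auto
  with z show "z \<in> near_faces n m w" unfolding near_faces_def by blast
qed

lemma isolated_iff:
  assumes "m \<le> n"
  shows "near_faces n m w \<inter> chosen_squares n \<omega> = patch G m L n w \<longleftrightarrow>
    (\<forall>F\<in>case_prod cube_face ` near_faces n m w. \<omega> F = (F \<in> case_prod cube_face ` patch G m L n w))"
proof -
  have inj: "cube_face I V \<in> case_prod cube_face ` patch G m L n w \<longleftrightarrow> (I, V) \<in> patch G m L n w"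
    if "(I, V) \<in> near_faces n m w" for I V
  proof
    assume "cube_face I V \<in> case_prod cube_face ` patch G m L n w"
    then obtain I' V' where "(I', V') \<in> patch G m L n w" "cube_face I V = cube_face I' V'" by auto
    then have "(I', V') \<in> near_faces n m w" using patch_subset_near_faces[OF assms] by blast
    then have "I = I' \<and> V = V'"
      using \<open>cube_face I V = cube_face I' V'\<close> near_faces_subset(3) that by (intro cube_face_inj) auto
    then show "(I, V) \<in> patch G m L n w" using \<open>(I', V') \<in> patch G m L n w\<close> by simp
  next
    assume "(I, V) \<in> patch G m L n w"
    then show "cube_face I V \<in> case_prod cube_face ` patch G m L n w"
      by (intro image_eqI[of _ _ "(I, V)"]) auto
  qed
  have chosen: "(I, V) \<in> chosen_squares n \<omega> \<longleftrightarrow> \<omega> (cube_face I V)" if "(I, V) \<in> near_faces n m w" for I V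
    using near_faces_subset[OF that] by (simp add: chosen_squares_def)
  have restrict_eq: "A \<inter> C = P \<longleftrightarrow> (\<forall>z\<in>A. z \<in> C \<longleftrightarrow> z \<in> P)" if "P \<subseteq> A" for A C P :: "(nat set \<times> nat set) set"
    using that by blast
  have "near_faces n m w \<inter> chosen_squares n \<omega> = patch G m L n w \<longleftrightarrow>
      (\<forall>z\<in>near_faces n m w. z \<in> chosen_squares n \<omega> \<longleftrightarrow> z \<in> patch G m L n w)"
    by (rule restrict_eq[OF patch_subset_near_faces[OF assms]])
  also have "\<dots> \<longleftrightarrow> (\<forall>z\<in>near_faces n m w. \<omega> (case_prod cube_face z) =
      (case_prod cube_face z \<in> case_prod cube_face ` patch G m L n w))"
  proof (rule ball_cong)
    fix z assume z: "z \<in> near_faces n m w"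
    obtain I V where IV: "z = (I, V)" by (cases z)
    show "(z \<in> chosen_squares n \<omega> \<longleftrightarrow> z \<in> patch G m L n w) \<longleftrightarrow>
        \<omega> (case_prod cube_face z) = (case_prod cube_face z \<in> case_prod cube_face ` patch G m L n w)"
      using inj[of I V] chosen[of I V] z unfolding IV prod.case by simp
  qed simp
  finally show ?thesis by (simp only: Ball_image_comp o_def)
qed

text \<open>If a square has an edge in both translates, then \<open>w\<close> and \<open>w'\<close> differ in at most one coordinate, and by
  parity not in exactly one.\<close>

lemma near_faces_disjoint:
  assumes "even (card w)" "even (card w')" "finite w" "finite w'" "w \<noteq> w'"
  shows "near_faces n m w \<inter> near_faces n m w' = {}"
proof (rule ccontr)
  assume "near_faces n m w \<inter> near_faces n m w' \<noteq> {}"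
  then obtain I V where "(I, V) \<in> near_faces n m w" "(I, V) \<in> near_faces n m w'" by auto
  then obtain i j i' j' where ij: "I = {i, j}" "i \<noteq> j" "i < m" "V - {..<m} = w \<or> insert j V - {..<m} = w"
    and ij': "I = {i', j'}" "i' \<noteq> j'" "i' < m" "V - {..<m} = w' \<or> insert j' V - {..<m} = w'"
    unfolding near_faces_def by blast
  define V0 where "V0 = V - {..<m}"
  have ins: "insert k V - {..<m} = (if k < m then V0 else insert k V0)" for k
    by (auto simp: V0_def)
  have "i' = i \<and> j' = j \<or> i' = j \<and> j' = i" using ij ij' by (auto simp: doubleton_eq_iff)
  then have "w = V0 \<and> w' = insert j V0 \<or> w' = V0 \<and> w = insert j V0"
    using ij(3,4) ij'(3,4) assms(5) unfolding ins V0_def[symmetric] by (auto split: if_splits)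
  then show False
    using assms by (auto simp: card_insert_if split: if_splits)
qed

text \<open>A square with an edge in the translate is determined by a vertex of the \<open>m\<close>-cube, a direction in it
  and a second direction; only the last choice depends on \<open>n\<close>.\<close>

lemma card_near_faces:
  assumes "w \<subseteq> {m..<n}"
  shows "finite (near_faces n m w)" "card (near_faces n m w) \<le> 2 ^ m * m * n"
proof -
  let ?f = "\<lambda>(V0, i, j). ({i, j}, V0 \<union> (w - {j}))"
  have sub: "near_faces n m w \<subseteq> ?f ` (Pow {..<m} \<times> {..<m} \<times> {..<n})"
  proof
    fix z assume "z \<in> near_faces n m w"
    then obtain i j V where z: "z = ({i, j}, V)" "i < m" "j < n" "j \<notin> V"
      and V: "V - {..<m} = w \<or> insert j V - {..<m} = w"
      unfolding near_faces_def by blast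
    have "V = (V \<inter> {..<m}) \<union> (w - {j})" using V z(4) by auto
    then have "z = ?f (V \<inter> {..<m}, i, j)" using z(1) by simp
    then show "z \<in> ?f ` (Pow {..<m} \<times> {..<m} \<times> {..<n})"
      using z by (intro image_eqI[of _ _ "(V \<inter> {..<m}, i, j)"]) auto
  qed
  have fin: "finite (Pow {..<m} \<times> {..<m} \<times> {..<n})" by simp
  show "finite (near_faces n m w)" using sub by (rule finite_subset) simp
  have "card (near_faces n m w) \<le> card (?f ` (Pow {..<m} \<times> {..<m} \<times> {..<n}))"
    using sub by (intro card_mono) auto
  also have "\<dots> \<le> card (Pow {..<m} \<times> {..<m} \<times> {..<n})" using fin by (rule card_image_le)
  also have "\<dots> = 2 ^ m * m * n" by (simp add: card_cartesian_product card_Pow)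
  finally show "card (near_faces n m w) \<le> 2 ^ m * m * n" .
qed

lemma card_patch:
  assumes "m \<le> n" "w \<subseteq> {m..<n}"
  shows "card (patch G m L n w) \<le> 2 ^ m * m * m"
proof -
  let ?f = "\<lambda>(V0, i, j). ({i, j}, V0 \<union> w)"
  have "patch G m L n w \<subseteq> ?f ` (Pow {..<m} \<times> {..<m} \<times> {..<m})"
  proof
    fix z assume "z \<in> patch G m L n w"
    then obtain i j V where z: "z = ({i, j}, V)" "i < m" "j < m" and V: "V - {..<m} = w"
      unfolding patch_def by blast
    have "V = (V \<inter> {..<m}) \<union> w" using V by auto
    then have "z = ?f (V \<inter> {..<m}, i, j)" using z(1) by simp
    then show "z \<in> ?f ` (Pow {..<m} \<times> {..<m} \<times> {..<m})"
      using z by (intro image_eqI[of _ _ "(V \<inter> {..<m}, i, j)"]) auto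
  qed
  then have "card (patch G m L n w) \<le> card (?f ` (Pow {..<m} \<times> {..<m} \<times> {..<m}))"
    by (intro card_mono) auto
  also have "\<dots> \<le> card (Pow {..<m} \<times> {..<m} \<times> {..<m})" by (rule card_image_le) simp
  also have "\<dots> = 2 ^ m * m * m" by (simp add: card_cartesian_product card_Pow)
  finally show ?thesis .
qed

definition even_subsets :: "nat \<Rightarrow> nat \<Rightarrow> nat set set" where
  "even_subsets m n = {w. w \<subseteq> {m..<n} \<and> even (card w)}"

text \<open>The last coordinate serves as a parity bit.\<close>

lemma card_even_subsets:
  assumes "m < n"
  shows "2 ^ (n - 1 - m) \<le> card (even_subsets m n)"
proof -
  define f where "f u = (if even (card u) then u else insert (n - 1) u)" for u :: "nat set"
  have f: "f u \<in> even_subsets m n" if "u \<subseteq> {m..<n - 1}" for u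
  proof -
    have "finite u" "n - 1 \<notin> u" using that finite_subset by auto
    moreover have "u \<subseteq> {m..<n}" using that ivl_subset[of m "n - 1" m n] by (meson diff_le_self le_refl order_trans)
    ultimately show ?thesis using assms by (auto simp: f_def even_subsets_def)
  qed
  have "inj_on f (Pow {m..<n - 1})"
  proof (rule inj_on_inverseI)
    show "f u - {n - 1} = u" if "u \<in> Pow {m..<n - 1}" for u
      using that by (auto simp: f_def)
  qed
  then have "card (f ` Pow {m..<n - 1}) = 2 ^ (n - 1 - m)"
    by (simp add: card_image card_Pow)
  moreover have "f ` Pow {m..<n - 1} \<subseteq> even_subsets m n" using f by auto
  moreover have "finite (even_subsets m n)" by (simp add: even_subsets_def)
  ultimately show ?thesis by (metis card_mono)
qed

lemma prob_isolated_cube: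
  assumes p: "0 < p" "p < 1" and m: "m < n"
  defines "a \<equiv> 2 ^ m * m * m" and "c \<equiv> 2 ^ m * m"
  shows "measure_pmf.prob (Pi_pmf (cube_faces n 2) False (\<lambda>_. bernoulli_pmf p))
     {\<omega>. \<exists>w. w \<subseteq> {m..<n} \<and> near_faces n m w \<inter> chosen_squares n \<omega> = patch G m L n w}
    \<ge> 1 - exp (- (p ^ a * (1 - p) ^ (c * n) * 2 ^ (n - 1 - m)))"
proof -
  define q where "q = p ^ a * (1 - p) ^ (c * n)"
  let ?M = "Pi_pmf (cube_faces n 2) False (\<lambda>_. bernoulli_pmf p)"
  define A where "A w = case_prod cube_face ` near_faces n m w" for w
  define T where "T w = case_prod cube_face ` patch G m L n w" for w
  let ?W = "even_subsets m n"
  have finW: "finite ?W" by (simp add: even_subsets_def)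
  have TA: "T w \<subseteq> A w" for w
    unfolding T_def A_def using patch_subset_near_faces[of m n] m by (intro image_mono) auto
  have q_le: "q \<le> (\<Prod>F\<in>A w. pmf (bernoulli_pmf p) (F \<in> T w))" if w: "w \<in> ?W" for w
  proof -
    have w': "w \<subseteq> {m..<n}" using w by (simp add: even_subsets_def)
    have finA: "finite (A w)" using card_near_faces(1)[OF w'] by (simp add: A_def)
    have cA: "card (A w) \<le> c * n"
      using card_image_le[OF card_near_faces(1)[OF w'], of "case_prod cube_face"] card_near_faces(2)[OF w']
      by (simp add: A_def c_def)
    have "finite (patch G m L n w)"
      using card_near_faces(1)[OF w'] patch_subset_near_faces[of m n] m finite_subset by (metis less_imp_le)
    then have cT: "card (T w) \<le> a"
      using card_image_le[of "patch G m L n w" "case_prod cube_face"] card_patch[of m n w G L] w' m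
      by (simp add: T_def a_def)
    have "(\<Prod>F\<in>A w. pmf (bernoulli_pmf p) (F \<in> T w)) = (\<Prod>F\<in>A w. if F \<in> T w then p else 1 - p)"
      using p by (intro prod.cong) auto
    also have "\<dots> = (\<Prod>F\<in>T w. p) * (\<Prod>F\<in>A w - T w. 1 - p)"
      using finA TA[of w] by (subst prod.If_cases) (auto simp: Int_absorb1 Diff_eq)
    also have "\<dots> = p ^ card (T w) * (1 - p) ^ card (A w - T w)" by simp
    also have "\<dots> \<ge> p ^ a * (1 - p) ^ (c * n)"
    proof (intro mult_mono power_decreasing)
      have "card (A w - T w) \<le> card (A w)" using finA by (intro card_mono) auto
      then show "card (A w - T w) \<le> c * n" using cA by simp
    qed (use p cT in auto)
    finally show ?thesis by (simp add: q_def)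
  qed
  have q01: "0 \<le> q" "q \<le> 1" using p by (auto simp: q_def intro!: mult_le_one power_le_one)
  let ?N = "{\<omega>. \<forall>w\<in>?W. \<exists>F\<in>A w. \<omega> F \<noteq> (F \<in> T w)}"
  have "measure_pmf.prob ?M ?N \<le> (1 - q) ^ card ?W"
  proof (rule prob_all_prescriptions_fail[OF finW finite_cube_faces])
    show "A w \<subseteq> cube_faces n 2" if "w \<in> ?W" for w
      using near_faces_subset(4) by (auto simp: A_def)
    show "disjoint_family_on A ?W"
      unfolding disjoint_family_on_def
    proof (intro ballI impI)
      fix w w' assume w: "w \<in> ?W" "w' \<in> ?W" "w \<noteq> w'"
      then have "near_faces n m w \<inter> near_faces n m w' = {}"
        by (intro near_faces_disjoint) (auto simp: even_subsets_def intro: finite_subset[OF _ finite_atLeastLessThan])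
      then show "A w \<inter> A w' = {}"
      proof (intro equals0I)
        fix F assume "F \<in> A w \<inter> A w'"
        then obtain I V I' V' where IV: "(I, V) \<in> near_faces n m w" "(I', V') \<in> near_faces n m w'"
          "F = cube_face I V" "F = cube_face I' V'"
          by (auto simp: A_def)
        then have "I = I' \<and> V = V'" using near_faces_subset(3) by (intro cube_face_inj) auto
        with IV \<open>near_faces n m w \<inter> near_faces n m w' = {}\<close> show False by blast
      qed
    qed
  qed (use q_le q01 in auto)
  also have "\<dots> \<le> (1 - q) ^ (2 ^ (n - 1 - m))"
    using card_even_subsets[OF m] q01 by (intro power_decreasing) auto
  also have "\<dots> \<le> exp (- q) ^ (2 ^ (n - 1 - m))"
    using q01 exp_ge_add_one_self[of "- q"] by (intro power_mono) auto
  also have "\<dots> = exp (- (q * 2 ^ (n - 1 - m)))"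
    by (simp add: exp_of_nat_mult[symmetric] mult.commute)
  finally have N: "measure_pmf.prob ?M ?N \<le> exp (- (q * 2 ^ (n - 1 - m)))" .
  have "1 - measure_pmf.prob ?M ?N = measure_pmf.prob ?M (- ?N)"
    using measure_pmf.prob_compl[of ?N ?M] by (simp add: Compl_eq_Diff_UNIV)
  also have "\<dots> \<le> measure_pmf.prob ?M {\<omega>. \<exists>w. w \<subseteq> {m..<n} \<and> near_faces n m w \<inter> chosen_squares n \<omega> = patch G m L n w}"
  proof (intro measure_pmf.finite_measure_mono subsetI)
    fix \<omega> assume "\<omega> \<in> - ?N"
    then obtain w where "w \<in> ?W" "\<forall>F\<in>A w. \<omega> F = (F \<in> T w)" by auto
    then show "\<omega> \<in> {\<omega>. \<exists>w. w \<subseteq> {m..<n} \<and> near_faces n m w \<inter> chosen_squares n \<omega> = patch G m L n w}"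
      using isolated_iff[of m n w \<omega> G L] m by (auto simp: A_def T_def even_subsets_def)
  qed simp
  finally show ?thesis using N unfolding q_def by linarith
qed

theorem corollary5p2:
  fixes G :: "'a monoid"
  assumes "finitely_presented_group G"
  shows "\<exists>P\<^sub>G > 0. \<forall>p. 0 < p \<and> p < P\<^sub>G \<longrightarrow>
    (\<lambda>n. measure_pmf.prob (random_cubical_complex n p)
            {Q. free_factor G (fundamental_group (\<Union>Q) (\<lambda>_. 0))}) \<longlonglongrightarrow> 1"
proof -
  have G: "group G" using assms by (simp add: finitely_presented_group_def)
  obtain m L where cube: "(\<forall>V i. V \<subseteq> {..<m} \<and> i < m \<and> i \<notin> V \<longrightarrow> L V i \<in> carrier G) \<and>
    (\<forall>V i. V \<subseteq> {..<i} \<and> i < m \<longrightarrow> L V i = \<one>\<^bsub>G\<^esub>) \<and>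
    generate G {L V i |V i. V \<subseteq> {..<m} \<and> i < m \<and> i \<notin> V} = carrier G \<and>
    (\<forall>K :: (real \<Rightarrow> nat \<Rightarrow> real) set monoid. group K \<longrightarrow> presents G m L K)"
    using labelled_cube_exists[OF assms, where 'k = "(real \<Rightarrow> nat \<Rightarrow> real) set" and 'd = unit]
    by (elim exE) (rule that)
  have L: "\<And>V i. V \<subseteq> {..<m} \<Longrightarrow> i < m \<Longrightarrow> i \<notin> V \<Longrightarrow> L V i \<in> carrier G"
    "\<And>V i. V \<subseteq> {..<i} \<Longrightarrow> i < m \<Longrightarrow> L V i = \<one>\<^bsub>G\<^esub>"
    "generate G {L V i |V i. V \<subseteq> {..<m} \<and> i < m \<and> i \<notin> V} = carrier G"
    "\<And>K :: (real \<Rightarrow> nat \<Rightarrow> real) set monoid. group K \<Longrightarrow> presents G m L K"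
    using cube by simp_all
  define a c :: nat where "a = 2 ^ m * m * m" and "c = 2 ^ m * m"
  define P where "P = 1 / (2 * (real c + 1))"
  have P: "P > 0" by (simp add: P_def)
  show ?thesis
  proof (intro exI[of _ P] conjI P allI impI)
    fix p :: real assume p: "0 < p \<and> p < P"
    have P_half: "P \<le> 1 / 2" by (simp add: P_def field_simps)
    then have p1: "0 < p" "p < 1" using p by auto
    \<comment> \<open>The expected number of successful translates is at least a constant times \<open>r ^ n\<close>, where the
      factor \<open>2\<close> counts translates and \<open>(1 - p) ^ c\<close> is the price of isolation.\<close>
    define r where "r = 2 * (1 - p) ^ c"
    have "real c * p < 1 / 2"
    proof -
      have "real c * p \<le> real c * P" using p by (intro mult_left_mono) auto
      also have "\<dots> < 1 / 2" by (simp add: P_def field_simps)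
      finally show ?thesis .
    qed
    moreover have "1 + real c * (- p) \<le> (1 + - p) ^ c" using p1 by (intro Bernoulli_inequality) auto
    ultimately have r: "r > 1" by (simp add: r_def)
    define s where "s n = measure_pmf.prob (random_cubical_complex n p)
            {Q. free_factor G (fundamental_group (\<Union>Q) (\<lambda>_. 0))}" for n
    define k where "k = p ^ a / 2 ^ (m + 1)"
    have k: "k > 0" using p1 by (simp add: k_def)
    have lower: "1 - exp (- (k * r ^ n)) \<le> s n" if m: "m < n" for n
    proof -
      let ?M = "Pi_pmf (cube_faces n 2) False (\<lambda>_. bernoulli_pmf p)"
      have "k * r ^ n = p ^ a * (1 - p) ^ (c * n) * 2 ^ (n - 1 - m)"
      proof -
        have "(2::real) ^ n = 2 ^ (m + 1) * 2 ^ (n - 1 - m)"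
        proof -
          have "n = (m + 1) + (n - 1 - m)" using m by simp
          then show ?thesis by (metis power_add)
        qed
        then show ?thesis by (simp add: k_def r_def power_mult_distrib power_mult field_simps)
      qed
      then have "1 - exp (- (k * r ^ n)) \<le> measure_pmf.prob ?M
          {\<omega>. \<exists>w. w \<subseteq> {m..<n} \<and> near_faces n m w \<inter> chosen_squares n \<omega> = patch G m L n w}"
        using prob_isolated_cube[OF p1 m, of G L] by (simp add: a_def c_def)
      also have "\<dots> \<le> measure_pmf.prob ?M {\<omega>. free_factor G (fundamental_group (square_complex n (chosen_squares n \<omega>)) (vertex {}))}"
      proof (intro measure_pmf.finite_measure_mono subsetI)
        fix \<omega> assume "\<omega> \<in> {\<omega>. \<exists>w. w \<subseteq> {m..<n} \<and> near_faces n m w \<inter> chosen_squares n \<omega> = patch G m L n w}"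
        then obtain w where iso: "w \<subseteq> {m..<n}" "near_faces n m w \<inter> chosen_squares n \<omega> = patch G m L n w" by blast
        then have "w \<subseteq> {..<n}" by auto
        then interpret rooted_square_complex n "chosen_squares n \<omega>" w by (rule rooted_square_complex.intro)
        have "free_factor G (fundamental_group (square_complex n (chosen_squares n \<omega>)) (vertex {}))"
          using m by (intro isolated_cube_free_factor[OF G L(1-3) L(4)[OF group_K] _ iso]) auto
        then show "\<omega> \<in> {\<omega>. free_factor G (fundamental_group (square_complex n (chosen_squares n \<omega>)) (vertex {}))}"
          by simp
      qed simp
      also have "\<dots> = s n"
      proof -
        have "vertex {} = (\<lambda>_. 0)" by (simp add: vertex_def)
        then show ?thesis
          unfolding s_def random_cubical_complex_def measure_map_pmf vimage_def
          by (simp only: mem_Collect_eq union_of_faces)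
      qed
      finally show ?thesis .
    qed
    have "filterlim (\<lambda>n. r ^ n) at_top sequentially"
      using r by (intro filterlim_at_infinity_imp_filterlim_at_top filterlim_realpow_sequentially_gt1) auto
    then have "filterlim (\<lambda>n. k * r ^ n) at_top sequentially"
      using k by (intro filterlim_tendsto_pos_mult_at_top[OF tendsto_const])
    then have "(\<lambda>n. exp (- (k * r ^ n))) \<longlonglongrightarrow> 0"
      by (intro filterlim_compose[OF exp_at_bot]) (simp add: filterlim_uminus_at_bot)
    then have "(\<lambda>n. 1 - exp (- (k * r ^ n))) \<longlonglongrightarrow> 1 - 0"
      by (intro tendsto_diff tendsto_const)
    then have "(\<lambda>n. 1 - exp (- (k * r ^ n))) \<longlonglongrightarrow> 1" by simp
    then have "s \<longlonglongrightarrow> 1"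
    proof (rule tendsto_sandwich[rotated 2, OF _ tendsto_const])
      show "\<forall>\<^sub>F n in sequentially. 1 - exp (- (k * r ^ n)) \<le> s n"
        using eventually_gt_at_top[of m] by eventually_elim (rule lower)
      show "\<forall>\<^sub>F n in sequentially. s n \<le> 1" by (simp add: s_def)
    qed
    then show "(\<lambda>n. measure_pmf.prob (random_cubical_complex n p)
            {Q. free_factor G (fundamental_group (\<Union>Q) (\<lambda>_. 0))}) \<longlonglongrightarrow> 1"
      by (simp add: s_def[abs_def])
  qed
qed

end
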